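(* Let $\Lambda$ be the Bedford-McMullen carpet with digit set $D$ and let $\mu$ be the Bernoulli measure on $\Lambda$ given by the probability vector $\{p_{i,j}\}_{(i,j)\in D}$. Sums over $i$ below run over those $i$ with $n_i\neq 0$. (1) If $$\sum_i \frac{1}{L_1}\log q_i \neq \sum_i \frac{n_i}{L_0}\log q_i ,$$ then for every $\alpha\in\mathbb{R}$ both $\dim_P X_\alpha^{\mathrm{symb}}<\dim_P\Lambda$ and $\dim_P X_\alpha<\dim_P\Lambda$. (2) If both $$\sum_i \frac{1}{L_1}\log q_i=\sum_i\frac{n_i}{L_0}\log q_i=:A$$ and $$\sum_{(i,j)\in D}\frac{1}{L_0}\log p_{i,j}=\sum_{(i,j)\in D}\frac{1}{n_iL_1}\log p_{i,j}=:B$$ hold, then, for $$\alpha_0=-\frac{1}{\log m}\bigl(\sigma B+(1-\sigma)A\bigr),$$ we have $\dim_P X_{\alpha_0}=\dim_P X_{\alpha_0}^{\mathrm{symb}}=\dim_P\Lambda$.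
   Context: $\dim_P$ denotes packing dimension. Let $2\le m<n$ be integers, $\sigma=\log m/\log n$, and $D\subseteq\{0,\ldots,m-1\}\times\{0,\ldots,n-1\}$ with $|D|\ge 2$. For $(i,j)\in D$ let $T_{i,j}(x,y)=\left(\frac{x+j}{n},\frac{y+i}{m}\right)$ on $\mathbb{R}^2$; the Bedford-McMullen carpet $\Lambda$ is the unique nonempty compact set with $\Lambda=\bigcup_{(i,j)\in D}T_{i,j}(\Lambda)$. Put $L_0=|D|$, $n_i=|\{j:(i,j)\in D\}|$ and $L_1=|\{i:n_i\ne0\}|$. Let $\{p_{i,j}\}_{(i,j)\in D}$ be a probability vector with all $p_{i,j}>0$, $q_i=\sum_j p_{i,j}$, and let $\mu$ be the unique Borel probability measure with $\mu(B)=\sum_{(i,j)\in D}p_{i,j}\,\mu(T_{i,j}^{-1}(B))$ for all Borel $B\subseteq\mathbb{R}^2$ (a Bernoulli measure). Each $x\in\Lambda$ has a symbolic expansion $(i_k(x),j_k(x))_{k\ge1}\in D^{\mathbb{N}}$, i.e. a sequence with $x=\lim_{k\to\infty}T_{i_1,j_1}\circ\cdots\circ T_{i_k,j_k}(0)$. The level-$N$ approximate square is $C_N(x)=\{y\in\Lambda: i_k(y)=i_k(x)\ \forall k\le N,\ j_k(y)=j_k(x)\ \forall k\le\lceil\sigma N\rceil\}$. The real local dimension is $d_\mu(x)=\lim_{r\to0}\frac{\log\mu(B_r(x))}{\log r}$ and the symbolic local dimension is $\delta_\mu(x)=\lim_{N\to\infty}\frac{\log\mu(C_N(x))}{-N\log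 m}$, when the limits exist. $X_\alpha=\{x\in\Lambda:d_\mu(x)=\alpha\}$ and $X_\alpha^{\mathrm{symb}}=\{x\in\Lambda:\delta_\mu(x)=\alpha\}$; for a point with several symbolic expansions, $x\in X_\alpha^{\mathrm{symb}}$ means that the condition holds for some symbolic expansion of $x$. The functions $\alpha\mapsto\dim_P X_\alpha$ and $\alpha\mapsto\dim_P X_\alpha^{\mathrm{symb}}$ are the real and symbolic packing (local dimension) spectra. *)

theory Defs
  imports "HOL-Probability.Probability"
begin

section \<open>Packing dimension\<close>

text \<open>A countable packing is encoded as a set of pairs (centre, radius). The closed balls are
  nonempty, so disjointness of the indexed family also rules out repetitions.\<close>

definition is_packing :: "real \<Rightarrow> 'a::metric_space set \<Rightarrow> ('a \<times> real) set \<Rightarrow> bool" where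
  "is_packing \<delta> E F \<longleftrightarrow>
     countable F \<and> (\<forall>(x, r)\<in>F. x \<in> E \<and> 0 < r \<and> r \<le> \<delta>) \<and>
     disjoint_family_on (\<lambda>(x, r). cball x r) F"

text \<open>The inner supremum is monotone in \<open>\<delta>\<close>, so the infimum is the limit as \<open>\<delta>\<close> tends to 0.\<close>

definition packing_premeasure :: "real \<Rightarrow> 'a::metric_space set \<Rightarrow> ennreal" where
  "packing_premeasure s E =
     (INF \<delta>\<in>{0<..}. SUP F\<in>{F. is_packing \<delta> E F}. \<Sum>\<^sub>\<infinity>(x, r)\<in>F. ennreal ((2 * r) powr s))"

definition packing_measure :: "real \<Rightarrow> 'a::metric_space set \<Rightarrow> ennreal" where
  "packing_measure s E =
     (INF A\<in>{A :: nat \<Rightarrow> 'a set. E \<subseteq> (\<Union>k. A k)}. \<Sum>k. packing_premeasure s (A k))"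

text \<open>With this definition the empty set has dimension 0.\<close>

definition packing_dim :: "'a::metric_space set \<Rightarrow> ereal" where
  "packing_dim E = Inf {ereal s | s. 0 \<le> s \<and> packing_measure s E = 0}"

section \<open>Bedford-McMullen carpets\<close>

text \<open>A digit is a pair \<open>(i, j)\<close>: the row \<open>i < m\<close> acts on the second coordinate and the column
  \<open>j < n\<close> on the first.\<close>

definition bm_map :: "nat \<Rightarrow> nat \<Rightarrow> nat \<times> nat \<Rightarrow> real \<times> real \<Rightarrow> real \<times> real" where
  "bm_map m n = (\<lambda>(i, j) (x, y). ((x + real j) / real n, (y + real i) / real m))"

definition bm_digits :: "nat \<Rightarrow> nat \<Rightarrow> (nat \<times> nat) set \<Rightarrow> bool" where
  "bm_digits m n D \<longleftrightarrow> 2 \<le> m \<and> m < n \<and> D \<subseteq> {0..<m} \<times> {0..<n} \<and> 2 \<le> card D"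

definition is_bm_carpet :: "nat \<Rightarrow> nat \<Rightarrow> (nat \<times> nat) set \<Rightarrow> (real \<times> real) set \<Rightarrow> bool" where
  "is_bm_carpet m n D \<Lambda> \<longleftrightarrow> \<Lambda> \<noteq> {} \<and> compact \<Lambda> \<and> \<Lambda> = (\<Union>d\<in>D. bm_map m n d ` \<Lambda>)"

definition bm_sigma :: "nat \<Rightarrow> nat \<Rightarrow> real" where
  "bm_sigma m n = ln (real m) / ln (real n)"

definition row_count :: "(nat \<times> nat) set \<Rightarrow> nat \<Rightarrow> nat" where
  "row_count D i = card {j. (i, j) \<in> D}"

definition occupied_rows :: "(nat \<times> nat) set \<Rightarrow> nat set" where
  "occupied_rows D = {i. row_count D i \<noteq> 0}"

section \<open>Bernoulli measures\<close>

definition pos_prob_vector :: "(nat \<times> nat) set \<Rightarrow> (nat \<times> nat \<Rightarrow> real) \<Rightarrow> bool" where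
  "pos_prob_vector D p \<longleftrightarrow> (\<forall>d\<in>D. 0 < p d) \<and> (\<Sum>d\<in>D. p d) = 1"

definition row_prob :: "(nat \<times> nat) set \<Rightarrow> (nat \<times> nat \<Rightarrow> real) \<Rightarrow> nat \<Rightarrow> real" where
  "row_prob D p i = (\<Sum>j | (i, j) \<in> D. p (i, j))"

definition is_bernoulli_measure ::
  "nat \<Rightarrow> nat \<Rightarrow> (nat \<times> nat) set \<Rightarrow> (nat \<times> nat \<Rightarrow> real) \<Rightarrow> (real \<times> real) measure \<Rightarrow> bool" where
  "is_bernoulli_measure m n D p \<mu> \<longleftrightarrow>
     prob_space \<mu> \<and> sets \<mu> = sets borel \<and>
     (\<forall>B\<in>sets borel. emeasure \<mu> B = (\<Sum>d\<in>D. ennreal (p d) * emeasure \<mu> (bm_map m n d -` B)))"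

section \<open>Symbolic expansions and local dimensions\<close>

primrec bm_comp :: "nat \<Rightarrow> nat \<Rightarrow> (nat \<Rightarrow> nat \<times> nat) \<Rightarrow> nat \<Rightarrow> real \<times> real \<Rightarrow> real \<times> real" where
  "bm_comp m n \<omega> 0 = id"
| "bm_comp m n \<omega> (Suc k) = bm_comp m n \<omega> k \<circ> bm_map m n (\<omega> k)"

text \<open>Digit sequences are indexed from 0: \<open>\<omega> k\<close> is the digit \<open>(i\<^bsub>k+1\<^esub>, j\<^bsub>k+1\<^esub>)\<close>.\<close>

definition is_expansion ::
  "nat \<Rightarrow> nat \<Rightarrow> (nat \<times> nat) set \<Rightarrow> (nat \<Rightarrow> nat \<times> nat) \<Rightarrow> real \<times> real \<Rightarrow> bool" where
  "is_expansion m n D \<omega> x \<longleftrightarrow>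
     (\<forall>k. \<omega> k \<in> D) \<and> (\<lambda>k. bm_comp m n \<omega> k (0, 0)) \<longlonglongrightarrow> x"

text \<open>The approximate square depends on the expansion \<open>\<omega>\<close> chosen for its centre; a point \<open>y\<close> belongs
  to it when some expansion of \<open>y\<close> agrees with \<open>\<omega>\<close> on the prescribed digits.\<close>

definition approx_square ::
  "nat \<Rightarrow> nat \<Rightarrow> (nat \<times> nat) set \<Rightarrow> (real \<times> real) set \<Rightarrow> (nat \<Rightarrow> nat \<times> nat) \<Rightarrow> nat \<Rightarrow> (real \<times> real) set"
where
  "approx_square m n D \<Lambda> \<omega> N =
     {y \<in> \<Lambda>. \<exists>\<tau>. is_expansion m n D \<tau> y \<and>
        (\<forall>k<N. fst (\<tau> k) = fst (\<omega> k)) \<and>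
        (\<forall>k<nat \<lceil>bm_sigma m n * real N\<rceil>. snd (\<tau> k) = snd (\<omega> k))}"

definition has_local_dim :: "'a::metric_space measure \<Rightarrow> 'a \<Rightarrow> real \<Rightarrow> bool" where
  "has_local_dim \<mu> x \<alpha> \<longleftrightarrow>
     ((\<lambda>r. ln (measure \<mu> (cball x r)) / ln r) \<longlongrightarrow> \<alpha>) (at_right 0)"

definition has_symb_local_dim ::
  "nat \<Rightarrow> nat \<Rightarrow> (nat \<times> nat) set \<Rightarrow> (real \<times> real) set \<Rightarrow> (real \<times> real) measure \<Rightarrow>
   (nat \<Rightarrow> nat \<times> nat) \<Rightarrow> real \<Rightarrow> bool" where
  "has_symb_local_dim m n D \<Lambda> \<mu> \<omega> \<alpha> \<longleftrightarrow>
     (\<lambda>N. ln (measure \<mu> (approx_square m n D \<Lambda> \<omega> N)) / (- real N * ln (real m))) \<longlonglongrightarrow> \<alpha>"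

definition level_set ::
  "(real \<times> real) set \<Rightarrow> (real \<times> real) measure \<Rightarrow> real \<Rightarrow> (real \<times> real) set" where
  "level_set \<Lambda> \<mu> \<alpha> = {x \<in> \<Lambda>. has_local_dim \<mu> x \<alpha>}"

definition symb_level_set ::
  "nat \<Rightarrow> nat \<Rightarrow> (nat \<times> nat) set \<Rightarrow> (real \<times> real) set \<Rightarrow> (real \<times> real) measure \<Rightarrow> real \<Rightarrow>
   (real \<times> real) set" where
  "symb_level_set m n D \<Lambda> \<mu> \<alpha> =
     {x \<in> \<Lambda>. \<exists>\<omega>. is_expansion m n D \<omega> x \<and> has_symb_local_dim m n D \<Lambda> \<mu> \<omega> \<alpha>}"

end

theory Submission
  imports Defs "HOL-Real_Asymp.Real_Asymp"
begin

text \<open>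
  Write \<open>lev N = \<lceil>\<sigma>N\<rceil>\<close>. An approximate square of level \<open>N\<close> is given by \<open>lev N\<close> digits followed by
  \<open>N - lev N\<close> rows, so there are about \<open>L\<^sub>0\<^bsup>\<sigma>N\<^esup> L\<^sub>1\<^bsup>(1-\<sigma>)N\<^esup>\<close> of them, which gives \<open>dim\<^sub>P \<Lambda>\<close>. For most of
  them the average of \<open>ln q\<close> is \<open>\<Sum> n\<^sub>i/L\<^sub>0 ln q\<^sub>i\<close> over the first \<open>lev N\<close> positions and
  \<open>\<Sum> 1/L\<^sub>1 ln q\<^sub>i\<close> over the others. Hence \<open>ln \<mu>(C\<^bsub>J\<^esub>) / J\<close> has different typical values for \<open>J = N\<close>
  and for \<open>J = lev N\<close> if these two averages differ. A point of a level set has nearly the same value at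
  all large levels, so by Hoeffding's inequality an exponentially small proportion of the squares of
  level \<open>N\<close> meets the level set, which bounds its packing dimension.

  If the averages agree, consider random digits which are alternately uniform on \<open>D\<close> and uniform on
  rows, along super-exponentially growing blocks. At suitable levels every approximate square has
  probability at most about \<open>L\<^sub>0\<^bsup>-\<sigma>N\<^esup> L\<^sub>1\<^bsup>-(1-\<sigma>)N\<^esup>\<close>, so a set of full probability has full packing
  dimension, while the strong law of large numbers puts almost every point into the level set.

  Balls and approximate squares have comparable measure unless the digits following the level contain
  a long constant run, which is exponentially unlikely.
\<close>

section \<open>Expansions in an integer base\<close>

text \<open>Upper bounds use the countable decomposition in packing measure: on the points for which
  an eventual property holds from one fixed level on, counting the squares of every large level
  \<open>K\<close> bounds the dimension. Incompatibility at one level \<open>J\<close> per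
  \<open>K\<close> is enough, and as \<open>J\<close> is at least \<open>\<sigma> * K\<close>, a
  gain that is exponential in \<open>J\<close> is exponential in \<open>K\<close>.

  The alternating blocks are forced. With identically distributed digits the rows between
  \<open>lev N\<close> and \<open>N\<close> have the same law as the rows of the first
  \<open>lev N\<close> digits. Uniform digits then make a row \<open>i\<close> have probability
  proportional to \<open>row_count D i\<close>, which is not the uniform law on rows unless all
  occupied rows have equally many digits. Packing dimension can be detected along a sparse sequence
  of scales, so it is enough to have both uniform laws in their proper places at the levels
  \<open>j!\<close>. The two equalities in (2) say that switching between the laws changes neither
  the mean of \<open>ln p\<close> nor that of \<open>ln q\<close>; this is why the local dimensions
  are limits over all levels and not only over the sparse ones.\<close>

definition digit_value :: "nat \<Rightarrow> (nat \<Rightarrow> nat) \<Rightarrow> real" where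
  "digit_value b a = (\<Sum>k. real (a k) / real b ^ Suc k)"

primrec prefix_value :: "nat \<Rightarrow> (nat \<Rightarrow> nat) \<Rightarrow> nat \<Rightarrow> nat" where
  "prefix_value b a 0 = 0"
| "prefix_value b a (Suc k) = b * prefix_value b a k + a k"

lemma prefix_value_less:
  assumes "\<And>k. a k < b"
  shows "prefix_value b a N < b ^ N"
proof (induction N)
  case (Suc N)
  have "prefix_value b a (Suc N) < b * prefix_value b a N + b"
    using assms by simp
  also have "\<dots> = b * Suc (prefix_value b a N)" by simp
  also have "\<dots> \<le> b * b ^ N" using Suc by (intro mult_left_mono) auto
  finally show ?case by simp
qed simp

lemma prefix_value_eq_iff:
  assumes "\<And>k. a k < b" "\<And>k. a' k < b"
  shows "prefix_value b a N = prefix_value b a' N \<longleftrightarrow> (\<forall>k<N. a k = a' k)"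
proof (induction N)
  case (Suc N)
  have "b * x + y = b * x' + y' \<longleftrightarrow> x = x' \<and> y = y'" if "y < b" "y' < b" for x y x' y' :: nat
  proof
    assume eq: "b * x + y = b * x' + y'"
    have "(b * x + y) div b = x" "(b * x' + y') div b = x'"
      "(b * x + y) mod b = y" "(b * x' + y') mod b = y'"
      using that by auto
    thus "x = x' \<and> y = y'" using eq by simp
  qed auto
  from this[OF assms(1) assms(2)] show ?case
    using Suc by (auto simp: less_Suc_eq)
qed simp

lemma digit_value_summable:
  assumes "2 \<le> b" "\<And>k. a k < b"
  shows "summable (\<lambda>k. real (a k) / real b ^ Suc k)"
proof (rule summable_comparison_test')
  show "summable (\<lambda>k. real b * (1 / real b) ^ Suc k)"
    using assms(1) by (subst summable_Suc_iff) (auto intro!: summable_mult summable_geometric)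
  show "norm (real (a k) / real b ^ Suc k) \<le> real b * (1 / real b) ^ Suc k" for k
    using assms(2)[of k] assms(1) by (simp add: power_divide field_simps)
qed

lemma digit_value_nonneg: "2 \<le> b \<Longrightarrow> (\<And>k. a k < b) \<Longrightarrow> 0 \<le> digit_value b a"
  unfolding digit_value_def by (intro suminf_nonneg digit_value_summable) auto

lemma digit_value_le_1:
  assumes "2 \<le> b" "\<And>k. a k < b"
  shows "digit_value b a \<le> 1"
proof -
  have b: "real b > 1" using assms by auto
  have s: "(\<lambda>k. (real b - 1) / real b * (1 / real b) ^ k) sums ((real b - 1) / real b * (1 / (1 - 1 / real b)))"
    using b by (intro sums_mult geometric_sums) auto
  have e: "(real b - 1) / real b * (1 / (1 - 1 / real b)) = 1"
    using b by (simp add: field_simps)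
  have "digit_value b a \<le> (\<Sum>k. (real b - 1) / real b * (1 / real b) ^ k)"
    unfolding digit_value_def
  proof (intro suminf_le digit_value_summable assms)
    fix k
    have "real (a k) \<le> real b - 1" using assms(2)[of k] by linarith
    thus "real (a k) / real b ^ Suc k \<le> (real b - 1) / real b * (1 / real b) ^ k"
      using b by (simp add: power_divide divide_right_mono)
  qed (use s in \<open>auto simp: sums_iff\<close>)
  also have "\<dots> = 1" using s unfolding e by (simp only: sums_iff)
  finally show ?thesis .
qed

lemma digit_value_split:
  assumes "2 \<le> b" "\<And>k. a k < b"
  shows "digit_value b a = (real (prefix_value b a N) + digit_value b (\<lambda>k. a (k + N))) / real b ^ N"
proof (induction N)
  case (Suc N)
  have b: "real b > 0" using assms by auto
  have "digit_value b (\<lambda>k. a (k + N)) =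
      real (a N) / real b + (\<Sum>k. real (a (k + Suc N)) / real b ^ Suc (Suc k))"
    unfolding digit_value_def
    using suminf_split_head[OF digit_value_summable[of b "\<lambda>k. a (k + N)"]] assms by simp
  also have "(\<Sum>k. real (a (k + Suc N)) / real b ^ Suc (Suc k)) =
      (\<Sum>k. (real (a (k + Suc N)) / real b ^ Suc k) / real b)"
    by (simp add: field_simps)
  also have "\<dots> = digit_value b (\<lambda>k. a (k + Suc N)) / real b"
    unfolding digit_value_def
    by (intro suminf_divide digit_value_summable assms)
  finally have "digit_value b (\<lambda>k. a (k + N)) =
    (real (a N) + digit_value b (\<lambda>k. a (k + Suc N))) / real b" by (simp add: add_divide_distrib)
  thus ?case using Suc b by (simp add: field_simps)
qed simp

lemma digit_value_Suc:
  assumes "2 \<le> b" "\<And>k. a k < b"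
  shows "digit_value b a = (real (a 0) + digit_value b (\<lambda>k. a (Suc k))) / real b"
  using digit_value_split[of b a 1] assms by simp

lemma digit_value_LIMSEQ:
  assumes "2 \<le> b" "\<And>k. a k < b"
  shows "(\<lambda>N. real (prefix_value b a N) / real b ^ N) \<longlonglongrightarrow> digit_value b a"
proof -
  have b: "real b > 1" using assms by auto
  have "(\<lambda>N. digit_value b (\<lambda>k. a (k + N)) / real b ^ N) \<longlonglongrightarrow> 0"
  proof (rule tendsto_sandwich[of "\<lambda>_. 0" _ _ "\<lambda>N. (1 / real b) ^ N"])
    show "(\<lambda>N. (1 / real b) ^ N) \<longlonglongrightarrow> 0"
      using b by (intro LIMSEQ_power_zero) auto
  qed (use assms b in \<open>auto simp: power_divide digit_value_nonneg digit_value_le_1 divide_right_mono\<close>)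
  from tendsto_diff[OF tendsto_const[of "digit_value b a"] this]
  have lim: "(\<lambda>N. digit_value b a - digit_value b (\<lambda>k. a (k + N)) / real b ^ N) \<longlonglongrightarrow> digit_value b a"
    by simp
  have eq: "digit_value b a - digit_value b (\<lambda>k. a (k + N)) / real b ^ N =
      real (prefix_value b a N) / real b ^ N" for N
    by (subst digit_value_split[where N = N]) (use assms in \<open>auto simp: add_divide_distrib\<close>)
  show ?thesis using lim unfolding eq .
qed

lemma digit_value_bounds:
  assumes "2 \<le> b" "\<And>k. a k < b"
  shows "real (prefix_value b a N) / real b ^ N \<le> digit_value b a"
    "digit_value b a \<le> (real (prefix_value b a N) + 1) / real b ^ N"
  using digit_value_nonneg[of b "\<lambda>k. a (k + N)"] digit_value_le_1[of b "\<lambda>k. a (k + N)"] assms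
  by (subst digit_value_split[of b a N]; auto intro!: divide_right_mono)+

lemma digit_value_agree:
  assumes "2 \<le> b" "\<And>k. a k < b" "\<And>k. a' k < b" "\<forall>k<N. a k = a' k"
  shows "\<bar>digit_value b a - digit_value b a'\<bar> \<le> 1 / real b ^ N"
proof -
  have "prefix_value b a N = prefix_value b a' N"
    using assms by (subst prefix_value_eq_iff) auto
  thus ?thesis
    using digit_value_bounds[of b a N] digit_value_bounds[of b a' N] assms
    by (auto simp: abs_le_iff add_divide_distrib algebra_simps)
qed

section \<open>Digits of expansions whose values are close\<close>

lemma digit_value_small_run:
  assumes "2 \<le> b" "\<And>k. a k < b" "digit_value b a < 1 / real b ^ l" "k < l"
  shows "a k = 0"
proof (rule ccontr)
  assume nz: "a k \<noteq> 0"
  have "1 / real b ^ l \<le> 1 / real b ^ Suc k"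
    using assms by (intro divide_left_mono power_increasing) auto
  also have "1 \<le> prefix_value b a (Suc k)" using nz by simp
  hence "1 / real b ^ Suc k \<le> real (prefix_value b a (Suc k)) / real b ^ Suc k"
    by (intro divide_right_mono) (auto simp del: prefix_value.simps)
  also have "\<dots> \<le> digit_value b a" by (intro digit_value_bounds assms)
  finally show False using assms by simp
qed

text \<open>A digit below \<open>b - 1\<close> at position \<open>k\<close> keeps the value at least
  \<open>1 / b ^ Suc k\<close> below 1, because all later digits together add at most one unit of
  that place.\<close>

lemma digit_value_large_run:
  assumes "2 \<le> b" "\<And>k. a k < b" "1 - digit_value b a < 1 / real b ^ l" "k < l"
  shows "a k = b - 1"
proof (rule ccontr)
  assume nz: "a k \<noteq> b - 1"
  have b: "real b > 0" using assms by auto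
  have ak: "Suc (a k) \<le> b - 1" using nz assms(2)[of k] by auto
  have "prefix_value b a (Suc k) + 2 \<le> b * Suc (prefix_value b a k)"
    using ak assms(1) by auto
  also have "\<dots> \<le> b ^ Suc k"
    using mult_le_mono2[of "Suc (prefix_value b a k)" "b ^ k" b] prefix_value_less[of a b k] assms
    by simp
  finally have "real (prefix_value b a (Suc k)) + 2 \<le> real b ^ Suc k"
    by (metis of_nat_add of_nat_le_iff of_nat_numeral of_nat_power)
  hence "(real (prefix_value b a (Suc k)) + 1) / real b ^ Suc k \<le> (real b ^ Suc k - 1) / real b ^ Suc k"
    using b by (intro divide_right_mono) auto
  also have "\<dots> = 1 - 1 / real b ^ Suc k" using b by (simp add: diff_divide_distrib)
  finally have "digit_value b a \<le> 1 - 1 / real b ^ Suc k"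
    using digit_value_bounds(2)[of b a "Suc k", OF assms(1,2)] by linarith
  moreover have "1 / real b ^ l \<le> 1 / real b ^ Suc k"
    using assms by (intro divide_left_mono power_increasing) auto
  ultimately show False using assms by linarith
qed

text \<open>Different prefixes put the two values into different intervals of length
  \<open>1 / b ^ N\<close> of the grid. If the values are close, the first one must be close to an
  end of its own interval: the right end if its prefix is the smaller one, the left end otherwise.
  Its following digits are then all \<open>b - 1\<close> or all 0.\<close>

lemma digit_value_close_run:
  assumes b: "2 \<le> b" and a: "\<And>k. a k < b" and a': "\<And>k. a' k < b"
    and close: "\<bar>digit_value b a - digit_value b a'\<bar> < 1 / real b ^ (N + l)"
    and ne: "\<exists>k<N. a k \<noteq> a' k"
  shows "\<exists>c<b. \<forall>k\<in>{N..<N + l}. a k = c"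
proof -
  let ?P = "prefix_value b a N" and ?P' = "prefix_value b a' N"
  let ?t = "digit_value b (\<lambda>k. a (k + N))" and ?t' = "digit_value b (\<lambda>k. a' (k + N))"
  have t: "0 \<le> ?t" "?t \<le> 1" "0 \<le> ?t'" "?t' \<le> 1"
    using assms by (auto intro!: digit_value_nonneg digit_value_le_1)
  have bpos: "real b ^ N > 0" using b by auto
  have "digit_value b a - digit_value b a' = (real ?P + ?t - (real ?P' + ?t')) / real b ^ N"
    by (subst digit_value_split[of b a N], use b a in \<open>simp_all\<close>)
      (subst digit_value_split[of b a' N], use b a' in \<open>simp_all add: diff_divide_distrib\<close>)
  hence cl: "\<bar>real ?P + ?t - (real ?P' + ?t')\<bar> < 1 / real b ^ l"
    using close bpos by (simp add: power_add field_simps)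
  have "?P \<noteq> ?P'" using ne prefix_value_eq_iff[of a b a' N] a a' by auto
  then consider "?P + 1 \<le> ?P'" | "?P' + 1 \<le> ?P" by linarith
  thus ?thesis
  proof cases
    case 1
    hence "real ?P + 1 \<le> real ?P'" by linarith
    hence "1 - ?t < 1 / real b ^ l" using cl t by linarith
    hence "a (k + N) = b - 1" if "k < l" for k
      using digit_value_large_run[of b "\<lambda>k. a (k + N)" l k] that assms by auto
    hence "a k = b - 1" if "k \<in> {N..<N + l}" for k
      using that by (metis add.commute atLeastLessThan_iff le_add_diff_inverse2 nat_add_left_cancel_less)
    thus ?thesis using b by (intro exI[of _ "b - 1"]) auto
  next
    case 2
    hence "real ?P' + 1 \<le> real ?P" by linarith
    hence "?t < 1 / real b ^ l" using cl t by linarith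
    hence "a (k + N) = 0" if "k < l" for k
      using digit_value_small_run[of b "\<lambda>k. a (k + N)" l k] that assms by auto
    hence "a k = 0" if "k \<in> {N..<N + l}" for k
      using that by (metis add.commute atLeastLessThan_iff le_add_diff_inverse2 nat_add_left_cancel_less)
    thus ?thesis using b by (intro exI[of _ 0]) auto
  qed
qed

lemma even_gap: "x \<noteq> y \<Longrightarrow> even x = even y \<Longrightarrow> x + 2 \<le> y \<or> y + 2 \<le> x" for x y :: nat
  by presburger

lemma digit_value_apart:
  assumes "2 \<le> b" "\<And>k. a k < b" "\<And>k. a' k < b"
    and "prefix_value b a N + 2 \<le> prefix_value b a' N"
  shows "1 / real b ^ N \<le> digit_value b a' - digit_value b a"
proof -
  have "real (prefix_value b a N) + 2 \<le> real (prefix_value b a' N)" using assms by linarith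
  hence "(real (prefix_value b a N) + 2) / real b ^ N \<le> real (prefix_value b a' N) / real b ^ N"
    by (intro divide_right_mono) auto
  thus ?thesis
    using digit_value_bounds(1)[of b a' N, OF assms(1,3)] digit_value_bounds(2)[of b a N, OF assms(1,2)]
    by (simp add: add_divide_distrib)
qed

text \<open>Points of adjacent grid intervals can be arbitrarily close or coincide. Equal parity of
  different prefixes excludes adjacency and leaves a whole interval between them.\<close>

lemma digit_value_apart_parity:
  assumes "2 \<le> b" "\<And>k. a k < b" "\<And>k. a' k < b"
    and ne: "prefix_value b a N \<noteq> prefix_value b a' N"
    and par: "even (prefix_value b a N) = even (prefix_value b a' N)"
  shows "1 / real b ^ N \<le> \<bar>digit_value b a - digit_value b a'\<bar>"
proof -
  have "prefix_value b a N + 2 \<le> prefix_value b a' N \<or> prefix_value b a' N + 2 \<le> prefix_value b a N"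
    using even_gap[OF ne par] .
  thus ?thesis
    using digit_value_apart[of b a a' N] digit_value_apart[of b a' a N] assms by auto
qed

lemma bounded_over_power_LIMSEQ:
  fixes f :: "nat \<Rightarrow> real"
  assumes "2 \<le> b" "\<And>k. \<bar>f k\<bar> \<le> C"
  shows "(\<lambda>k. f k / real b ^ k) \<longlonglongrightarrow> 0"
proof (rule Lim_null_comparison)
  show "\<forall>\<^sub>F k in sequentially. norm (f k / real b ^ k) \<le> C * (1 / real b) ^ k"
    using assms by (intro always_eventually allI) (auto simp: power_divide intro!: divide_right_mono)
  show "(\<lambda>k. C * (1 / real b) ^ k) \<longlonglongrightarrow> 0"
    using assms by (intro tendsto_mult_right_zero LIMSEQ_power_zero) auto
qed

section \<open>Estimates of the packing dimension\<close>

lemma packing_dim_mono: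
  assumes "E \<subseteq> E'"
  shows "packing_dim E \<le> packing_dim E'"
proof -
  have "packing_measure s E \<le> packing_measure s E'" for s
    unfolding packing_measure_def using assms by (intro INF_superset_mono) auto
  hence "packing_measure s E = 0" if "packing_measure s E' = 0" for s
    using that by (metis le_zero_eq)
  thus ?thesis unfolding packing_dim_def by (intro Inf_superset_mono) auto
qed

lemma packing_dim_le: "0 \<le> s \<Longrightarrow> packing_measure s E = 0 \<Longrightarrow> packing_dim E \<le> ereal s"
  unfolding packing_dim_def by (intro Inf_lower) auto

lemma packing_dim_geI:
  assumes "\<And>s. 0 \<le> s \<Longrightarrow> s < d \<Longrightarrow> packing_measure s E \<noteq> 0"
  shows "ereal d \<le> packing_dim E"
  unfolding packing_dim_def by (intro Inf_greatest) (use assms in force)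

text \<open>The balls are sorted by the level \<open>lvl r\<close>, the first \<open>N\<close> with
  \<open>c / b ^ N < r\<close>. A covering set of diameter at most \<open>c / b ^ N\<close> contains
  at most one centre of that level, so there are at most \<open>C * \<theta> ^ N\<close> such balls.
  Minimality of the level gives \<open>r \<le> c * b / b ^ N\<close>, so level \<open>N\<close>
  contributes at most a constant times \<open>(\<theta> * b powr (- s)) ^ N\<close>. Only levels
  above \<open>N1\<close> occur, and the geometric tail yields the last factor.\<close>

lemma packing_sum_le:
  fixes A :: "'a::metric_space set" and b c C \<theta> s :: real
  assumes b: "1 < b" and c: "0 < c" and C: "0 \<le> C" and \<theta>: "0 \<le> \<theta>" and s: "0 \<le> s"
    and q: "\<theta> * b powr (- s) < 1"
    and cov: "\<And>N. N0 \<le> N \<Longrightarrow> \<exists>P. finite P \<and> A \<subseteq> \<Union>P \<and> real (card P) \<le> C * \<theta> ^ N \<and>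
                (\<forall>U\<in>P. \<forall>x\<in>U. \<forall>y\<in>U. dist x y \<le> c / b ^ N)"
    and N1: "N0 \<le> N1" and F: "is_packing (c / b ^ N1) A F" and fin: "finite G" "G \<subseteq> F"
  shows "(\<Sum>(x, r)\<in>G. (2 * r) powr s) \<le>
    C * (2 * c * b) powr s * (1 / (1 - \<theta> * b powr (- s))) * (\<theta> * b powr (- s)) ^ N1"
proof -
  define q where "q = \<theta> * b powr (- s)"
  define K where "K = C * (2 * c * b) powr s"
  define lvl where "lvl r = (LEAST N. c / b ^ N < r)" for r :: real
  have q01: "0 \<le> q" "q < 1" using assms by (auto simp: q_def)
  have K0: "0 \<le> K" using C by (simp add: K_def)
  have ex: "\<exists>N. c / b ^ N < r" if "r > 0" for r
  proof -
    obtain N where "c / r < b ^ N" using real_arch_pow[OF b] by blast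
    thus ?thesis using that b by (intro exI[of _ N]) (simp add: field_simps)
  qed
  have lvl1: "c / b ^ lvl r < r" if "r > 0" for r
    unfolding lvl_def using ex[OF that] by (rule LeastI_ex)
  have lvl2: "N1 < lvl r" "r \<le> c * b / b ^ lvl r" if "r > 0" "r \<le> c / b ^ N1" for r
  proof -
    have lt: "c / b ^ lvl r < c / b ^ N1" using lvl1[of r] that by linarith
    show "N1 < lvl r"
    proof (rule ccontr)
      assume "\<not> N1 < lvl r"
      hence "c / b ^ N1 \<le> c / b ^ lvl r"
        using b c by (intro divide_left_mono power_increasing) auto
      thus False using lt by simp
    qed
    then obtain k where k: "lvl r = Suc k" by (cases "lvl r") auto
    have "\<not> c / b ^ k < r" using k not_less_Least[of k "\<lambda>N. c / b ^ N < r"] by (simp add: lvl_def)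
    thus "r \<le> c * b / b ^ lvl r" using b by (simp add: k)
  qed
  have Fr: "x \<in> A" "0 < r" "r \<le> c / b ^ N1" if "(x, r) \<in> G" for x r
    using F fin that unfolding is_packing_def by auto
  have disj: "cball x r \<inter> cball y t = {}" if "(x, r) \<in> G" "(y, t) \<in> G" "(x, r) \<noteq> (y, t)" for x r y t
  proof -
    have "disjoint_family_on (\<lambda>(x, r). cball x r) F" using F by (simp add: is_packing_def)
    from disjoint_family_onD[OF this, of "(x, r)" "(y, t)"] show ?thesis using that fin by auto
  qed
  have group: "(\<Sum>(x, r)\<in>{g\<in>G. lvl (snd g) = N}. (2 * r) powr s) \<le> K * q ^ N"
    if N: "N1 < N" for N
  proof -
    define H where "H = {g\<in>G. lvl (snd g) = N}"
    obtain P where P: "finite P" "A \<subseteq> \<Union>P" "real (card P) \<le> C * \<theta> ^ N"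
      "\<forall>U\<in>P. \<forall>x\<in>U. \<forall>y\<in>U. dist x y \<le> c / b ^ N"
      using cov[of N] N N1 by auto
    have "\<exists>U\<in>P. fst g \<in> U" if "g \<in> H" for g
      using P(2) Fr(1)[of "fst g" "snd g"] that by (auto simp: H_def)
    then obtain u where u: "\<And>g. g \<in> H \<Longrightarrow> u g \<in> P \<and> fst g \<in> u g" by metis
    \<comment> \<open>If two centres shared a covering set, the second would lie in the ball of the
      first, against disjointness.\<close>
    have "inj_on u H"
    proof (rule inj_onI, rule ccontr)
      fix g h assume gh: "g \<in> H" "h \<in> H" "u g = u h" "g \<noteq> h"
      obtain x r y t where [simp]: "g = (x, r)" "h = (y, t)" by (cases g, cases h)
      have "dist x y \<le> c / b ^ N" using P(4) u[OF gh(1)] u[OF gh(2)] gh(3) by (metis \<open>g = (x, r)\<close> \<open>h = (y, t)\<close> fst_conv)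
      also have "\<dots> < r"
      proof -
        have "(x, r) \<in> G" "lvl r = N" using gh(1) by (simp_all add: H_def)
        thus ?thesis using lvl1[of r] Fr(2)[of x r] by simp
      qed
      finally have "y \<in> cball x r" by simp
      moreover have "y \<in> cball y t" using Fr(2)[of y t] gh(2) by (auto simp: H_def)
      moreover have "cball x r \<inter> cball y t = {}"
        using gh by (intro disj) (simp_all add: H_def)
      ultimately show False by blast
    qed
    hence "card H \<le> card P" using u P(1) by (intro card_inj_on_le[of u]) auto
    hence card: "real (card H) \<le> C * \<theta> ^ N" using P(3) by linarith
    have "(\<Sum>(x, r)\<in>H. (2 * r) powr s) \<le> (\<Sum>(x, r)\<in>H. (2 * c * b / b ^ N) powr s)"
    proof (intro sum_mono, clarify)
      fix x r assume "(x, r) \<in> H"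
      thus "(2 * r) powr s \<le> (2 * c * b / b ^ N) powr s"
        using Fr[of x r] lvl2[of r] s by (intro powr_mono2) (auto simp: H_def)
    qed
    also have "\<dots> = real (card H) * (2 * c * b / b ^ N) powr s"
      by (simp add: case_prod_unfold)
    also have "\<dots> \<le> C * \<theta> ^ N * (2 * c * b / b ^ N) powr s"
      using card by (intro mult_right_mono) auto
    also have "(2 * c * b / b ^ N) powr s = (2 * c * b) powr s * (b powr (- s)) ^ N"
      using b c by (simp add: powr_divide powr_minus powr_powr field_simps flip: powr_realpow)
    also have "C * \<theta> ^ N * \<dots> = K * q ^ N" by (simp add: K_def q_def power_mult_distrib)
    finally show ?thesis unfolding H_def .
  qed
  define L where "L = (\<lambda>g. lvl (snd g)) ` G"
  have finL: "finite L" using fin by (simp add: L_def)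
  have Lgt: "N1 < N" if NL: "N \<in> L" for N
  proof -
    obtain g where "N = lvl (snd g)" "g \<in> G" using NL unfolding L_def by (rule imageE)
    thus ?thesis using lvl2(1)[of "snd g"] Fr(2,3)[of "fst g" "snd g"] by simp
  qed
  have "(\<Sum>(x, r)\<in>G. (2 * r) powr s) = (\<Sum>N\<in>L. \<Sum>(x, r)\<in>{g\<in>G. lvl (snd g) = N}. (2 * r) powr s)"
    unfolding L_def by (rule sum.image_gen[OF fin(1)])
  also have "\<dots> \<le> (\<Sum>N\<in>L. K * q ^ N)" by (intro sum_mono group Lgt)
  \<comment> \<open>All levels in \<open>L\<close> exceed \<open>N1\<close>, so subtracting
    \<open>N1\<close> is injective on \<open>L\<close> and \<open>q ^ N1\<close> can be factored out
    before the sum is compared with the full series.\<close>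
  also have "\<dots> = (\<Sum>N\<in>(\<lambda>k. k - N1) ` L. K * q ^ (N + N1))"
    by (subst sum.reindex) (use Lgt in \<open>auto simp: inj_on_def intro!: sum.cong dest!: Lgt\<close>)
  also have "\<dots> = K * q ^ N1 * (\<Sum>N\<in>(\<lambda>k. k - N1) ` L. q ^ N)"
    by (simp add: sum_distrib_left power_add mult_ac)
  also have "\<dots> \<le> K * q ^ N1 * (\<Sum>N. q ^ N)"
    using q01 K0 finL by (intro mult_left_mono sum_le_suminf summable_geometric) auto
  also have "\<dots> = K * (1 / (1 - q)) * q ^ N1" using q01 by (simp add: suminf_geometric)
  finally show ?thesis by (simp add: K_def q_def)
qed

lemma packing_premeasure_eq_0:
  fixes A :: "'a::metric_space set" and b c C \<theta> s :: real
  assumes b: "1 < b" and c: "0 < c" and C: "0 \<le> C" and \<theta>: "0 \<le> \<theta>" and s: "0 \<le> s"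
    and q: "\<theta> * b powr (- s) < 1"
    and cov: "\<And>N. N0 \<le> N \<Longrightarrow> \<exists>P. finite P \<and> A \<subseteq> \<Union>P \<and> real (card P) \<le> C * \<theta> ^ N \<and>
                (\<forall>U\<in>P. \<forall>x\<in>U. \<forall>y\<in>U. dist x y \<le> c / b ^ N)"
  shows "packing_premeasure s A = 0"
proof -
  define q where "q = \<theta> * b powr (- s)"
  define K where "K = C * (2 * c * b) powr s * (1 / (1 - q))"
  have le: "packing_premeasure s A \<le> ennreal (K * q ^ N1)" if N1: "N0 \<le> N1" for N1
  proof -
    have "packing_premeasure s A \<le>
        (SUP F\<in>{F. is_packing (c / b ^ N1) A F}. \<Sum>\<^sub>\<infinity>(x, r)\<in>F. ennreal ((2 * r) powr s))"
      unfolding packing_premeasure_def using b c by (intro INF_lower) auto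
    also have "\<dots> \<le> ennreal (K * q ^ N1)"
    proof (intro SUP_least infsum_le_finite_sums)
      fix F G assume F: "F \<in> {F. is_packing (c / b ^ N1) A F}" and G: "finite G" "G \<subseteq> F"
      have "(\<Sum>(x, r)\<in>G. ennreal ((2 * r) powr s)) = ennreal (\<Sum>(x, r)\<in>G. (2 * r) powr s)"
        by (simp add: case_prod_unfold sum_ennreal)
      also have "\<dots> \<le> ennreal (K * q ^ N1)"
        using packing_sum_le[OF b c C \<theta> s q cov N1 _ G] F by (intro ennreal_leI) (simp add: K_def q_def)
      finally show "(\<Sum>(x, r)\<in>G. ennreal ((2 * r) powr s)) \<le> ennreal (K * q ^ N1)" .
    qed (simp add: nonneg_summable_on_complete)
    finally show ?thesis .
  qed
  have "(\<lambda>N. K * q ^ N) \<longlonglongrightarrow> K * 0"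
    using q b \<theta> by (intro tendsto_mult LIMSEQ_power_zero tendsto_const) (auto simp: q_def)
  hence "(\<lambda>N. ennreal (K * q ^ N)) \<longlonglongrightarrow> ennreal 0" by (intro tendsto_ennrealI) simp
  hence "packing_premeasure s A \<le> ennreal 0"
    by (rule tendsto_lowerbound) (use le in \<open>auto simp: eventually_at_top_linorder\<close>)
  thus ?thesis by simp
qed

text \<open>Packings by balls of one common radius suffice. The distance of centres strictly exceeds
  \<open>2 * r\<close> because the balls are closed.\<close>

lemma packing_premeasure_eq_top:
  fixes A :: "'a::metric_space set"
  assumes "\<And>\<delta> C. 0 < \<delta> \<Longrightarrow> \<exists>P r. finite P \<and> P \<subseteq> A \<and> 0 < r \<and> r \<le> \<delta> \<and>
      (\<forall>x\<in>P. \<forall>y\<in>P. x \<noteq> y \<longrightarrow> 2 * r < dist x y) \<and> C \<le> real (card P) * (2 * r) powr s"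
  shows "packing_premeasure s A = \<top>"
proof -
  have "of_nat C \<le> (SUP F\<in>{F. is_packing \<delta> A F}. \<Sum>\<^sub>\<infinity>(x, r)\<in>F. ennreal ((2 * r) powr s))"
    if \<delta>: "0 < \<delta>" for \<delta> and C :: nat
  proof -
    obtain P r where P: "finite P" "P \<subseteq> A" "0 < r" "r \<le> \<delta>"
      "\<forall>x\<in>P. \<forall>y\<in>P. x \<noteq> y \<longrightarrow> 2 * r < dist x y" "real C \<le> real (card P) * (2 * r) powr s"
      using assms[OF \<delta>, of "real C"] by blast
    have pack: "is_packing \<delta> A (P \<times> {r})"
      unfolding is_packing_def disjoint_family_on_def
    proof (intro conjI ballI impI)
      show "countable (P \<times> {r})" using P(1) by (simp add: countable_finite)
      fix g h assume gh: "g \<in> P \<times> {r}" "h \<in> P \<times> {r}" "g \<noteq> h"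
      then obtain x y where [simp]: "g = (x, r)" "h = (y, r)" and xy: "x \<in> P" "y \<in> P" "x \<noteq> y"
        by auto
      have False if "z \<in> cball x r" "z \<in> cball y r" for z
      proof -
        have "dist x y \<le> dist x z + dist y z" by (rule dist_triangle2)
        also have "\<dots> \<le> 2 * r" using that by (simp)
        finally show False using P(5) xy by force
      qed
      thus "(case g of (x, r) \<Rightarrow> cball x r) \<inter> (case h of (x, r) \<Rightarrow> cball x r) = {}" by auto
    qed (use P in auto)
    have "of_nat C = ennreal (real C)" by (simp add: ennreal_of_nat_eq_real_of_nat)
    also have "\<dots> \<le> ennreal (real (card P) * (2 * r) powr s)" using P(6) by (rule ennreal_leI)
    also have "\<dots> = (\<Sum>(x, r)\<in>P \<times> {r}. ennreal ((2 * r) powr s))"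
    proof -
      have "(\<Sum>(x, r)\<in>P \<times> {r}. ennreal ((2 * r) powr s)) = (\<Sum>g\<in>P \<times> {r}. ennreal ((2 * r) powr s))"
        by (intro sum.cong) auto
      also have "\<dots> = ennreal (real (card P) * (2 * r) powr s)"
        by (simp add: card_cartesian_product ennreal_mult ennreal_of_nat_eq_real_of_nat del: sum.cartesian_product)
      finally show ?thesis ..
    qed
    also have "\<dots> = (\<Sum>\<^sub>\<infinity>(x, r)\<in>P \<times> {r}. ennreal ((2 * r) powr s))"
      using P(1) by (intro infsum_finite[symmetric]) simp
    also have "\<dots> \<le> (SUP F\<in>{F. is_packing \<delta> A F}. \<Sum>\<^sub>\<infinity>(x, r)\<in>F. ennreal ((2 * r) powr s))"
      using pack by (intro SUP_upper) auto
    finally show ?thesis .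
  qed
  hence "of_nat C \<le> packing_premeasure s A" for C
    unfolding packing_premeasure_def by (intro INF_greatest) auto
  thus ?thesis by (metis ennreal_Ex_less_of_nat linorder_not_le top.not_eq_extremum)
qed

lemma packing_measure_eq_0I:
  assumes "E \<subseteq> (\<Union>k::nat. A k)" "\<And>k. packing_premeasure s (A k) = 0"
  shows "packing_measure s E = 0"
proof -
  have "packing_measure s E \<le> (\<Sum>k. packing_premeasure s (A k))"
    unfolding packing_measure_def using assms(1) by (intro INF_lower) auto
  thus ?thesis using assms(2) by simp
qed

lemma packing_measure_neq_0I:
  assumes "\<And>A :: nat \<Rightarrow> 'a::metric_space set. E \<subseteq> (\<Union>k. A k) \<Longrightarrow> \<exists>k. packing_premeasure s (A k) = \<top>"
  shows "packing_measure s E \<noteq> 0"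
proof -
  have "(\<Sum>k. packing_premeasure s (A k)) = \<top>" if A: "E \<subseteq> (\<Union>k. A k)" for A
  proof -
    obtain k where "packing_premeasure s (A k) = \<top>" using assms[OF A] by blast
    moreover have "packing_premeasure s (A k) \<le> (\<Sum>k. packing_premeasure s (A k))"
      using sum_le_suminf[of "\<lambda>k. packing_premeasure s (A k)" "{k}"] by simp
    ultimately show ?thesis by (simp add: top_unique)
  qed
  hence "\<top> \<le> packing_measure s E" unfolding packing_measure_def by (intro INF_greatest) auto
  thus ?thesis by auto
qed

section \<open>Symbolic coding of the carpet\<close>

definition digit_seqs :: "(nat \<times> nat) set \<Rightarrow> (nat \<Rightarrow> nat \<times> nat) set" where
  "digit_seqs D = {\<omega>. \<forall>k. \<omega> k \<in> D}"

definition bm_level :: "nat \<Rightarrow> nat \<Rightarrow> nat \<Rightarrow> nat" where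
  "bm_level m n N = nat \<lceil>bm_sigma m n * real N\<rceil>"

definition coding :: "nat \<Rightarrow> nat \<Rightarrow> (nat \<Rightarrow> nat \<times> nat) \<Rightarrow> real \<times> real" where
  "coding m n \<omega> = (digit_value n (\<lambda>k. snd (\<omega> k)), digit_value m (\<lambda>k. fst (\<omega> k)))"

definition bm_cylinder ::
  "(nat \<times> nat) set \<Rightarrow> nat \<Rightarrow> nat \<Rightarrow> (nat \<Rightarrow> nat \<times> nat) \<Rightarrow> (nat \<Rightarrow> nat \<times> nat) set" where
  "bm_cylinder D M N \<omega> =
     {\<tau> \<in> digit_seqs D. (\<forall>k<N. fst (\<tau> k) = fst (\<omega> k)) \<and> (\<forall>k<M. snd (\<tau> k) = snd (\<omega> k))}"

text \<open>The position of an approximate square in the grid of mesh \<open>n\<^bsup>-\<lceil>\<sigma>N\<rceil>\<^esup> \<times> m\<^bsup>-N\<^esup>\<close>.\<close>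

definition cell_index :: "nat \<Rightarrow> nat \<Rightarrow> nat \<Rightarrow> (nat \<Rightarrow> nat \<times> nat) \<Rightarrow> nat \<times> nat" where
  "cell_index m n N \<omega> =
     (prefix_value n (\<lambda>k. snd (\<omega> k)) (bm_level m n N), prefix_value m (\<lambda>k. fst (\<omega> k)) N)"

text \<open>A point whose digits following level \<open>N\<close> show no constant run of length \<open>l\<close> stays away from the
  sides of its approximate square. In a single row or column there are no neighbouring squares
  to stay away from.\<close>

definition has_run :: "nat \<Rightarrow> nat \<Rightarrow> (nat \<times> nat) set \<Rightarrow> nat \<Rightarrow> nat \<Rightarrow> (nat \<Rightarrow> nat \<times> nat) \<Rightarrow> bool" where
  "has_run m n D N l \<omega> \<longleftrightarrow>
     ((\<exists>d\<in>D. \<exists>d'\<in>D. fst d \<noteq> fst d') \<and> (\<exists>c<n. \<forall>k\<in>{N..<N + l}. fst (\<omega> k) = c)) \<or>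
     ((\<exists>d\<in>D. \<exists>d'\<in>D. snd d \<noteq> snd d') \<and>
        (\<exists>c<n. \<forall>k\<in>{bm_level m n N..<bm_level m n N + l}. snd (\<omega> k) = c))"

lemma bm_map_eq: "bm_map m n d z = ((fst z + real (snd d)) / real n, (snd z + real (fst d)) / real m)"
  by (simp add: bm_map_def case_prod_unfold)

lemma dist_prod_le: "dist z w \<le> \<bar>fst z - fst w\<bar> + \<bar>snd z - snd w\<bar>" for z w :: "real \<times> real"
  unfolding dist_prod_def dist_real_def
  using sqrt_sum_squares_le_sum_abs[of "\<bar>fst z - fst w\<bar>" "\<bar>snd z - snd w\<bar>"] by simp

locale bm_digit_set =
  fixes m n :: nat and D :: "(nat \<times> nat) set"
  assumes digits: "bm_digits m n D"
begin

abbreviation "\<sigma> \<equiv> bm_sigma m n"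
abbreviation "lev \<equiv> bm_level m n"
abbreviation "seqs \<equiv> digit_seqs D"
abbreviation "cod \<equiv> coding m n"
abbreviation "cyl \<equiv> bm_cylinder D"
abbreviation "idx \<equiv> cell_index m n"
abbreviation "run \<equiv> has_run m n D"

lemma m2: "2 \<le> m" and mn: "m < n" and n2: "2 \<le> n" and cardD: "2 \<le> card D"
  using digits by (auto simp: bm_digits_def)

lemma D_less: "d \<in> D \<Longrightarrow> fst d < m" "d \<in> D \<Longrightarrow> snd d < n"
  using digits by (auto simp: bm_digits_def)

lemma finD: "finite D"
  using digits finite_subset[of D "{0..<m} \<times> {0..<n}"] by (auto simp: bm_digits_def)

lemma D_ne: "D \<noteq> {}" using cardD by auto

lemma seqsD: "\<omega> \<in> seqs \<Longrightarrow> \<omega> k \<in> D" by (simp add: digit_seqs_def)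

lemma seqs_less: "\<omega> \<in> seqs \<Longrightarrow> fst (\<omega> k) < m" "\<omega> \<in> seqs \<Longrightarrow> snd (\<omega> k) < n"
  using D_less seqsD by auto

lemma seqs_Suc: "\<omega> \<in> seqs \<Longrightarrow> (\<lambda>k. \<omega> (Suc k)) \<in> seqs" by (simp add: digit_seqs_def)

lemma ln_mn: "0 < ln (real m)" "ln (real m) < ln (real n)" "0 < ln (real n)"
  using m2 mn by auto

lemma sigma_bounds: "0 < \<sigma>" "\<sigma> < 1"
  using ln_mn by (auto simp: bm_sigma_def)

lemma sigma_ln: "\<sigma> * ln (real n) = ln (real m)"
  using ln_mn by (simp add: bm_sigma_def)

lemma lev_bounds: "\<sigma> * real N \<le> real (lev N)" "real (lev N) < \<sigma> * real N + 1"
proof -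
  have "0 \<le> \<sigma> * real N" using sigma_bounds by simp
  thus "\<sigma> * real N \<le> real (lev N)" "real (lev N) < \<sigma> * real N + 1"
    unfolding bm_level_def by linarith+
qed

lemma lev_le: "lev N \<le> N"
proof -
  have "\<sigma> * real N \<le> 1 * real N" using sigma_bounds by (intro mult_right_mono) auto
  thus ?thesis unfolding bm_level_def by linarith
qed

lemma lev_mono: "N \<le> N' \<Longrightarrow> lev N \<le> lev N'"
  using sigma_bounds unfolding bm_level_def by (intro nat_mono ceiling_mono mult_left_mono) auto

lemma lev_add_le: "lev (N + K) \<le> lev N + K"
proof -
  have "\<sigma> * real K \<le> 1 * real K" using sigma_bounds by (intro mult_right_mono) auto
  hence "real (lev (N + K)) < real (lev N) + real K + 1"
    using lev_bounds[of N] lev_bounds[of "N + K"] by (simp add: algebra_simps)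
  thus ?thesis by linarith
qed

text \<open>This guarantees that the \<open>l\<close> columns following \<open>lev N\<close> are
  already determined by a square of level \<open>N + K\<close>.\<close>

lemma lev_add_ge: "real l \<le> \<sigma> * real K \<Longrightarrow> lev N + l \<le> lev (N + K)"
proof -
  assume "real l \<le> \<sigma> * real K"
  moreover have "\<sigma> * real N > real (lev N) - 1" using lev_bounds[of N] by linarith
  ultimately have "\<sigma> * real (N + K) > real (lev N) + real l - 1" by (simp add: algebra_simps)
  hence "real (lev (N + K)) > real (lev N) + real l - 1" using lev_bounds[of "N + K"] by linarith
  thus ?thesis by linarith
qed

text \<open>Approximate squares deserve their name: the width \<open>1 / n ^ lev N\<close> is at
  most the height \<open>1 / m ^ N\<close> and smaller by at most a factor \<open>n\<close>, which
  is the price of the ceiling in \<open>lev\<close>.\<close>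

lemma m_power_le: "real m ^ N \<le> real n ^ lev N" and n_power_lev_le: "real n ^ lev N \<le> real n * real m ^ N"
proof -
  have eq: "real m ^ N = exp (\<sigma> * real N * ln (real n))"
    using m2 sigma_ln by (simp add: exp_of_nat_mult[symmetric] mult_ac flip: exp_ln)
      (metis exp_ln exp_of_nat_mult mult.assoc mult.commute of_nat_0_less_iff pos2 less_le_trans)
  have eq2: "real n ^ lev N = exp (real (lev N) * ln (real n))"
    using n2 by (simp add: exp_of_nat_mult)
  show "real m ^ N \<le> real n ^ lev N"
    unfolding eq eq2 using lev_bounds[of N] ln_mn by (simp add: mult_right_mono)
  have "real n ^ lev N \<le> exp ((1 + \<sigma> * real N) * ln (real n))"
    unfolding eq2 using lev_bounds[of N] ln_mn by (simp add: mult_right_mono)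
  also have "\<dots> = real n * real m ^ N"
    unfolding eq using n2 by (simp add: distrib_right exp_add)
  finally show "real n ^ lev N \<le> real n * real m ^ N" .
qed

lemma bm_comp_eq:
  "bm_comp m n \<omega> k z =
    ((real (prefix_value n (\<lambda>k. snd (\<omega> k)) k) + fst z) / real n ^ k,
     (real (prefix_value m (\<lambda>k. fst (\<omega> k)) k) + snd z) / real m ^ k)"
  using m2 n2 by (induction k arbitrary: z) (auto simp: bm_map_eq field_simps)

text \<open>The starting point may vary with \<open>k\<close> because \<open>carpet_eq\<close>
  applies this to the successive preimages of a point of the carpet.\<close>

lemma bm_comp_LIMSEQ:
  assumes "\<omega> \<in> seqs" "\<And>k. norm (z k) \<le> C"
  shows "(\<lambda>k. bm_comp m n \<omega> k (z k)) \<longlonglongrightarrow> cod \<omega>"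
proof -
  have b: "\<bar>fst (z k)\<bar> \<le> C" "\<bar>snd (z k)\<bar> \<le> C" for k
    using assms(2)[of k] norm_fst_le[of "fst (z k)" "snd (z k)"] norm_snd_le[of "snd (z k)" "fst (z k)"] by auto
  have "(\<lambda>k. real (prefix_value n (\<lambda>k. snd (\<omega> k)) k) / real n ^ k + fst (z k) / real n ^ k)
      \<longlonglongrightarrow> digit_value n (\<lambda>k. snd (\<omega> k)) + 0"
    using assms b n2 seqs_less by (intro tendsto_add digit_value_LIMSEQ bounded_over_power_LIMSEQ[where C = C]) auto
  moreover have "(\<lambda>k. real (prefix_value m (\<lambda>k. fst (\<omega> k)) k) / real m ^ k + snd (z k) / real m ^ k)
      \<longlonglongrightarrow> digit_value m (\<lambda>k. fst (\<omega> k)) + 0"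
    using assms b m2 seqs_less by (intro tendsto_add digit_value_LIMSEQ bounded_over_power_LIMSEQ[where C = C]) auto
  ultimately show ?thesis
    unfolding bm_comp_eq coding_def add_divide_distrib by (intro tendsto_Pair) auto
qed

lemma is_expansion_iff: "is_expansion m n D \<omega> x \<longleftrightarrow> \<omega> \<in> seqs \<and> x = cod \<omega>"
proof -
  have "(\<lambda>k. bm_comp m n \<omega> k (0, 0)) \<longlonglongrightarrow> cod \<omega>" if "\<omega> \<in> seqs"
    using bm_comp_LIMSEQ[OF that, of "\<lambda>_. (0, 0)" 0] by simp
  thus ?thesis unfolding is_expansion_def digit_seqs_def using LIMSEQ_unique by auto
qed

lemma coding_Suc: "\<omega> \<in> seqs \<Longrightarrow> cod \<omega> = bm_map m n (\<omega> 0) (cod (\<lambda>k. \<omega> (Suc k)))"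
  unfolding coding_def bm_map_eq
  using digit_value_Suc[of m "\<lambda>k. fst (\<omega> k)"] digit_value_Suc[of n "\<lambda>k. snd (\<omega> k)"] m2 n2 seqs_less
  by (auto simp: add.commute)

lemma coding_bounds:
  assumes "\<omega> \<in> seqs"
  shows "0 \<le> fst (cod \<omega>)" "fst (cod \<omega>) \<le> 1" "0 \<le> snd (cod \<omega>)" "snd (cod \<omega>) \<le> 1"
  unfolding coding_def using assms m2 n2 seqs_less
  by (auto intro!: digit_value_nonneg digit_value_le_1)

text \<open>Choosing preimages in the set equation again and again writes a point as
  \<open>bm_comp m n \<omega> k\<close> of some point of \<Lambda>, for every \<open>k\<close>; as
  \<Lambda> is bounded, the limit is \<open>cod \<omega>\<close>. Conversely, the images of one
  point of \<Lambda> under \<open>bm_comp m n \<omega> k\<close> stay in \<Lambda> and converge to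
  \<open>cod \<omega>\<close>, and \<Lambda> is closed.\<close>

lemma carpet_eq:
  assumes "is_bm_carpet m n D \<Lambda>"
  shows "\<Lambda> = cod ` seqs"
proof (intro equalityI subsetI)
  have \<Lambda>: "\<Lambda> \<noteq> {}" "compact \<Lambda>" "\<Lambda> = (\<Union>d\<in>D. bm_map m n d ` \<Lambda>)"
    using assms by (simp_all add: is_bm_carpet_def)
  obtain C where C: "\<And>z. z \<in> \<Lambda> \<Longrightarrow> norm z \<le> C"
    using compact_imp_bounded[OF \<Lambda>(2)] by (auto simp: bounded_iff)
  {
    fix x assume x: "x \<in> \<Lambda>"
    have "\<forall>z\<in>\<Lambda>. \<exists>d z'. d \<in> D \<and> z' \<in> \<Lambda> \<and> z = bm_map m n d z'" using \<Lambda>(3) by blast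
    then obtain d g where dg: "\<And>z. z \<in> \<Lambda> \<Longrightarrow> d z \<in> D \<and> g z \<in> \<Lambda> \<and> z = bm_map m n (d z) (g z)" by metis
    define \<omega> where "\<omega> k = d ((g ^^ k) x)" for k
    have g: "(g ^^ k) x \<in> \<Lambda>" for k by (induction k) (use x dg in auto)
    have \<omega>: "\<omega> \<in> seqs" using dg g by (auto simp: digit_seqs_def \<omega>_def)
    have "x = bm_comp m n \<omega> k ((g ^^ k) x)" for k
      by (induction k) (use dg g in \<open>simp_all add: \<omega>_def flip: dg[THEN conjunct2, THEN conjunct2]\<close>)
    moreover have "(\<lambda>k. bm_comp m n \<omega> k ((g ^^ k) x)) \<longlonglongrightarrow> cod \<omega>"
      using \<omega> C[OF g] by (rule bm_comp_LIMSEQ)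
    ultimately have "(\<lambda>k. x) \<longlonglongrightarrow> cod \<omega>" by simp
    hence "x = cod \<omega>" using LIMSEQ_unique tendsto_const by blast
    thus "x \<in> cod ` seqs" using \<omega> by blast
  }
  {
    fix x assume "x \<in> cod ` seqs"
    then obtain \<omega> where \<omega>: "\<omega> \<in> seqs" "x = cod \<omega>" by blast
    obtain z where z: "z \<in> \<Lambda>" using \<Lambda>(1) by blast
    have "bm_comp m n \<omega> k z \<in> \<Lambda>" if "z \<in> \<Lambda>" for k z
      using that
    proof (induction k arbitrary: z)
      case (Suc k)
      have "bm_map m n (\<omega> k) z \<in> \<Lambda>" using \<Lambda>(3) Suc.prems seqsD[OF \<omega>(1)] by blast
      thus ?case using Suc.IH by simp
    qed simp
    hence "bm_comp m n \<omega> k z \<in> \<Lambda>" for k using z .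
    moreover have "(\<lambda>k. bm_comp m n \<omega> k z) \<longlonglongrightarrow> x"
      unfolding \<omega>(2) using \<omega>(1) order_refl by (rule bm_comp_LIMSEQ)
    ultimately show "x \<in> \<Lambda>"
      by (rule closed_sequentially[OF compact_imp_closed[OF \<Lambda>(2)]])
  }
qed

lemma approx_square_eq:
  assumes "is_bm_carpet m n D \<Lambda>"
  shows "approx_square m n D \<Lambda> \<omega> N = cod ` cyl (lev N) N \<omega>"
  unfolding approx_square_def is_expansion_iff carpet_eq[OF assms] bm_cylinder_def bm_level_def
  by auto

lemma cyl_dist_le:
  assumes "\<tau> \<in> cyl (lev N) N \<omega>" "\<omega> \<in> seqs"
  shows "dist (cod \<omega>) (cod \<tau>) \<le> 2 / real m ^ N"
proof -
  have \<tau>: "\<tau> \<in> seqs" using assms by (simp add: bm_cylinder_def)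
  have "\<bar>fst (cod \<omega>) - fst (cod \<tau>)\<bar> \<le> 1 / real n ^ lev N"
    unfolding coding_def using assms \<tau> n2 seqs_less by (auto intro!: digit_value_agree simp: bm_cylinder_def)
  also have "\<dots> \<le> 1 / real m ^ N"
    using m_power_le[of N] m2 n2 by (intro divide_left_mono) auto
  finally have 1: "\<bar>fst (cod \<omega>) - fst (cod \<tau>)\<bar> \<le> 1 / real m ^ N" .
  have 2: "\<bar>snd (cod \<omega>) - snd (cod \<tau>)\<bar> \<le> 1 / real m ^ N"
    unfolding coding_def using assms \<tau> m2 seqs_less by (auto intro!: digit_value_agree simp: bm_cylinder_def)
  show ?thesis using dist_prod_le[of "cod \<omega>" "cod \<tau>"] 1 2 by simp
qed

text \<open>If a digit that fixes the square differed, \<open>digit_value_close_run\<close> would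
  yield a constant run in \<omega> right after level \<open>N\<close> (rows) or \<open>lev N\<close>
  (columns). The differing digits also show that \<open>D\<close> has two rows or two columns, as
  \<open>run\<close> demands. Of the two additional factors \<open>n\<close> in the radius one pays
  for \<open>n_power_lev_le\<close>, the other makes the inequality strict.\<close>

lemma close_in_cyl:
  assumes \<omega>: "\<omega> \<in> seqs" and \<tau>: "\<tau> \<in> seqs" and nr: "\<not> run N l \<omega>"
    and d: "dist (cod \<omega>) (cod \<tau>) \<le> 1 / (real m ^ N * real n ^ (l + 2))"
  shows "\<tau> \<in> cyl (lev N) N \<omega>"
proof -
  have pos: "real m ^ N > 0" "real n > 1" using m2 n2 by auto
  have ylt: "1 / (real m ^ N * real n ^ (l + 2)) < 1 / real m ^ (N + l)"
  proof -
    have "real m ^ l \<le> real n ^ l" using mn by (intro power_mono) auto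
    also have "\<dots> < real n ^ (l + 2)" using pos by (intro power_strict_increasing) auto
    finally show ?thesis using pos m2 by (simp add: power_add divide_strict_left_mono)
  qed
  have xlt: "1 / (real m ^ N * real n ^ (l + 2)) < 1 / real n ^ (lev N + l)"
  proof -
    have "real n ^ (lev N + l) \<le> real n * real m ^ N * real n ^ l"
      unfolding power_add by (intro mult_right_mono n_power_lev_le) auto
    also have "\<dots> = real m ^ N * real n ^ (l + 1)" by simp
    also have "\<dots> < real m ^ N * real n ^ (l + 2)"
      using pos by (intro mult_strict_left_mono power_strict_increasing) auto
    finally show ?thesis using pos by (intro divide_strict_left_mono) auto
  qed
  have "\<forall>k<N. fst (\<tau> k) = fst (\<omega> k)"
  proof (rule ccontr)
    assume "\<not> ?thesis"
    then obtain k where k: "k < N" "fst (\<omega> k) \<noteq> fst (\<tau> k)" by auto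
    have "\<bar>snd (cod \<omega>) - snd (cod \<tau>)\<bar> \<le> dist (cod \<omega>) (cod \<tau>)"
      using dist_snd_le[of "cod \<omega>" "cod \<tau>"] by (simp add: dist_real_def)
    hence "\<exists>c<m. \<forall>k\<in>{N..<N + l}. fst (\<omega> k) = c"
      using k d ylt \<omega> \<tau> m2 seqs_less unfolding coding_def
      by (intro digit_value_close_run[where a' = "\<lambda>k. fst (\<tau> k)"]) auto
    moreover have "\<exists>d\<in>D. \<exists>d'\<in>D. fst d \<noteq> fst d'"
      using k(2) seqsD[OF \<omega>, of k] seqsD[OF \<tau>, of k] by blast
    ultimately show False using nr mn unfolding has_run_def by (meson less_trans)
  qed
  moreover have "\<forall>k<lev N. snd (\<tau> k) = snd (\<omega> k)"
  proof (rule ccontr)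
    assume "\<not> ?thesis"
    then obtain k where k: "k < lev N" "snd (\<omega> k) \<noteq> snd (\<tau> k)" by auto
    have "\<bar>fst (cod \<omega>) - fst (cod \<tau>)\<bar> \<le> dist (cod \<omega>) (cod \<tau>)"
      using dist_fst_le[of "cod \<omega>" "cod \<tau>"] by (simp add: dist_real_def)
    hence "\<exists>c<n. \<forall>k\<in>{lev N..<lev N + l}. snd (\<omega> k) = c"
      using k d xlt \<omega> \<tau> n2 seqs_less unfolding coding_def
      by (intro digit_value_close_run[where a' = "\<lambda>k. snd (\<tau> k)"]) auto
    moreover have "\<exists>d\<in>D. \<exists>d'\<in>D. snd d \<noteq> snd d'"
      using k(2) seqsD[OF \<omega>, of k] seqsD[OF \<tau>, of k] by blast
    ultimately show False using nr unfolding has_run_def by blast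
  qed
  ultimately show ?thesis using \<tau> by (simp add: bm_cylinder_def)
qed

lemma idx_eq_iff:
  assumes "\<omega> \<in> seqs" "\<tau> \<in> seqs"
  shows "idx N \<tau> = idx N \<omega> \<longleftrightarrow> \<tau> \<in> cyl (lev N) N \<omega>"
  unfolding cell_index_def bm_cylinder_def
  using prefix_value_eq_iff[of "\<lambda>k. fst (\<tau> k)" m "\<lambda>k. fst (\<omega> k)" N]
    prefix_value_eq_iff[of "\<lambda>k. snd (\<tau> k)" n "\<lambda>k. snd (\<omega> k)" "lev N"] assms seqs_less
  by auto

lemma finite_idx: "finite (idx N ` seqs)"
proof (rule finite_subset)
  show "idx N ` seqs \<subseteq> {..<n ^ lev N} \<times> {..<m ^ N}"
    unfolding cell_index_def using seqs_less by (auto intro!: prefix_value_less)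
qed auto

text \<open>This provides the separated centres of a packing: once the parities agree, different
  cells are not neighbours in the direction in which they differ.\<close>

lemma cells_apart:
  assumes "\<omega> \<in> seqs" "\<tau> \<in> seqs" "idx N \<omega> \<noteq> idx N \<tau>"
    and "even (fst (idx N \<omega>)) = even (fst (idx N \<tau>))" "even (snd (idx N \<omega>)) = even (snd (idx N \<tau>))"
  shows "1 / (real n * real m ^ N) \<le> dist (cod \<omega>) (cod \<tau>)"
proof -
  have d: "\<bar>fst (cod \<omega>) - fst (cod \<tau>)\<bar> \<le> dist (cod \<omega>) (cod \<tau>)"
    "\<bar>snd (cod \<omega>) - snd (cod \<tau>)\<bar> \<le> dist (cod \<omega>) (cod \<tau>)"
    using dist_fst_le[of "cod \<omega>" "cod \<tau>"] dist_snd_le[of "cod \<omega>" "cod \<tau>"] by (simp_all add: dist_real_def)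
  consider "fst (idx N \<omega>) \<noteq> fst (idx N \<tau>)" | "snd (idx N \<omega>) \<noteq> snd (idx N \<tau>)"
    using assms(3) by (auto simp: prod_eq_iff)
  thus ?thesis
  proof cases
    case 1
    hence "1 / real n ^ lev N \<le> \<bar>fst (cod \<omega>) - fst (cod \<tau>)\<bar>"
      unfolding coding_def using assms n2 seqs_less
      by (auto intro!: digit_value_apart_parity simp: cell_index_def)
    moreover have "1 / (real n * real m ^ N) \<le> 1 / real n ^ lev N"
      using n_power_lev_le[of N] n2 m2 by (intro divide_left_mono) auto
    ultimately show ?thesis using d by linarith
  next
    case 2
    hence "1 / real m ^ N \<le> \<bar>snd (cod \<omega>) - snd (cod \<tau>)\<bar>"
      unfolding coding_def using assms m2 seqs_less
      by (auto intro!: digit_value_apart_parity simp: cell_index_def)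
    moreover have "1 / (real n * real m ^ N) \<le> 1 / real m ^ N"
      using n2 m2 by (intro divide_left_mono) auto
    ultimately show ?thesis using d by linarith
  qed
qed

end

section \<open>The Bernoulli measure of approximate squares\<close>

text \<open>The contribution of position \<open>k\<close> to the logarithm of the measure of an
  approximate square of level \<open>N\<close>. Before \<open>lev N\<close> the whole digit is
  prescribed, afterwards only its row.\<close>

definition log_weight ::
  "nat \<Rightarrow> nat \<Rightarrow> (nat \<times> nat) set \<Rightarrow> (nat \<times> nat \<Rightarrow> real) \<Rightarrow> nat \<Rightarrow> nat \<Rightarrow> nat \<times> nat \<Rightarrow> real" where
  "log_weight m n D p N k d =
     (if k < bm_level m n N then ln (p d) else ln (row_prob D p (fst d)))"

locale bernoulli_carpet = bm_digit_set +
  fixes \<Lambda> :: "(real \<times> real) set" and p :: "nat \<times> nat \<Rightarrow> real" and \<mu> :: "(real \<times> real) measure"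
  assumes carpet: "is_bm_carpet m n D \<Lambda>"
    and prob_vector: "pos_prob_vector D p"
    and bernoulli: "is_bernoulli_measure m n D p \<mu>"
begin

abbreviation "T \<equiv> bm_map m n"
abbreviation "q \<equiv> row_prob D p"
abbreviation "\<psi> \<equiv> log_weight m n D p"

definition S :: "nat \<Rightarrow> (nat \<Rightarrow> nat \<times> nat) \<Rightarrow> real" where
  "S N \<omega> = (\<Sum>k<N. \<psi> N k (\<omega> k))"

lemma p_pos: "d \<in> D \<Longrightarrow> 0 < p d" and p_sum: "(\<Sum>d\<in>D. p d) = 1"
  using prob_vector by (auto simp: pos_prob_vector_def)

lemma sets_\<mu>: "sets \<mu> = sets borel" and prob_\<mu>: "prob_space \<mu>"
  using bernoulli by (simp_all add: is_bernoulli_measure_def)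

lemma space_\<mu>: "space \<mu> = UNIV"
  using sets_eq_imp_space_eq[OF sets_\<mu>] by simp

sublocale prob_space \<mu> by (rule prob_\<mu>)

lemma T_continuous: "continuous_on UNIV (T d)"
  unfolding bm_map_eq[abs_def] by (intro continuous_intros) (use m2 n2 in auto)

lemma T_vimage: "B \<in> sets borel \<Longrightarrow> T d -` B \<in> sets borel"
proof -
  assume "B \<in> sets borel"
  moreover have "T d \<in> borel_measurable borel" by (rule borel_measurable_continuous_onI[OF T_continuous])
  ultimately have "T d -` B \<inter> space borel \<in> sets borel" by (intro measurable_sets)
  thus ?thesis by simp
qed

lemma inj_T: "inj (T d)"
  using m2 n2 by (auto simp: inj_def bm_map_eq)

lemma measure_inv:
  assumes "B \<in> sets borel"
  shows "measure \<mu> B = (\<Sum>d\<in>D. p d * measure \<mu> (T d -` B))"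
proof -
  have "ennreal (measure \<mu> B) = (\<Sum>d\<in>D. ennreal (p d) * ennreal (measure \<mu> (T d -` B)))"
    using bernoulli assms by (simp add: is_bernoulli_measure_def emeasure_eq_measure)
  also have "\<dots> = (\<Sum>d\<in>D. ennreal (p d * measure \<mu> (T d -` B)))"
    by (intro sum.cong refl) (simp add: ennreal_mult p_pos less_imp_le)
  also have "\<dots> = ennreal (\<Sum>d\<in>D. p d * measure \<mu> (T d -` B))"
    by (intro sum_ennreal) (simp add: p_pos less_imp_le)
  finally show ?thesis
    by (subst (asm) ennreal_inj) (auto intro!: sum_nonneg simp: p_pos less_imp_le)
qed

lemma \<Lambda>_props: "\<Lambda> \<noteq> {}" "compact \<Lambda>" "closed \<Lambda>" "\<Lambda> = (\<Union>d\<in>D. T d ` \<Lambda>)"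
  using carpet compact_imp_closed by (auto simp: is_bm_carpet_def)

lemma \<Lambda>_eq: "\<Lambda> = cod ` seqs" by (rule carpet_eq[OF carpet])

lemma \<Lambda>_box: "z \<in> \<Lambda> \<Longrightarrow> 0 \<le> fst z \<and> fst z \<le> 1 \<and> 0 \<le> snd z \<and> snd z \<le> 1"
  unfolding \<Lambda>_eq using coding_bounds by auto

lemma T_in_\<Lambda>: "d \<in> D \<Longrightarrow> z \<in> \<Lambda> \<Longrightarrow> T d z \<in> \<Lambda>"
  using \<Lambda>_props(4) by blast

section \<open>Support of the Bernoulli measure and null overlaps\<close>

lemma T_contracts: "dist (T d z) (T d w) \<le> dist z w / real m"
proof -
  have "dist (T d z) (T d w) = sqrt (((fst z - fst w) / real n)\<^sup>2 + ((snd z - snd w) / real m)\<^sup>2)"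
    by (simp add: bm_map_eq dist_prod_def dist_real_def diff_divide_distrib[symmetric] power_divide)
  also have "\<dots> \<le> sqrt (((fst z - fst w) / real m)\<^sup>2 + ((snd z - snd w) / real m)\<^sup>2)"
  proof (intro real_sqrt_le_mono add_right_mono)
    have "\<bar>(fst z - fst w) / real n\<bar> \<le> \<bar>(fst z - fst w) / real m\<bar>"
      using m2 mn by (auto simp: abs_div intro!: divide_left_mono)
    thus "((fst z - fst w) / real n)\<^sup>2 \<le> ((fst z - fst w) / real m)\<^sup>2"
      by (simp only: abs_le_square_iff)
  qed
  also have "\<dots> = sqrt (((fst z - fst w)\<^sup>2 + (snd z - snd w)\<^sup>2) / (real m)\<^sup>2)"
    by (simp add: power_divide add_divide_distrib)
  also have "\<dots> = dist z w / real m"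
    by (simp add: real_sqrt_divide dist_prod_def dist_real_def)
  finally show ?thesis .
qed

text \<open>The support is derived from the invariance alone. Every map contracts by the factor
  \<open>m\<close> and preserves \<Lambda>, so it sends the
  \<open>m * \<epsilon>\<close>-neighbourhood of \<Lambda> into the \<epsilon>-neighbourhood; by
  invariance the larger neighbourhood has no more mass than the smaller one. The neighbourhoods of
  radius \<open>m ^ k * \<epsilon>\<close> exhaust the plane, so each \<epsilon>-neighbourhood has
  mass 1.\<close>

lemma AE_\<Lambda>: "AE z in \<mu>. z \<in> \<Lambda>"
proof -
  define B where "B \<epsilon> = {z. infdist z \<Lambda> \<le> \<epsilon>}" for \<epsilon>
  have meas: "B \<epsilon> \<in> sets borel" for \<epsilon>
    unfolding B_def by (intro borel_closed closed_Collect_le continuous_intros)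
  have step: "measure \<mu> (B (real m * \<epsilon>)) \<le> measure \<mu> (B \<epsilon>)" for \<epsilon>
  proof -
    have sub: "B (real m * \<epsilon>) \<subseteq> T d -` B \<epsilon>" if "d \<in> D" for d
    proof
      fix z assume z: "z \<in> B (real m * \<epsilon>)"
      obtain y where y: "y \<in> \<Lambda>" "infdist z \<Lambda> = dist z y"
        using infdist_attains_inf[OF \<Lambda>_props(3,1)] by blast
      have "infdist (T d z) \<Lambda> \<le> dist (T d z) (T d y)"
        using y \<open>d \<in> D\<close> by (intro infdist_le T_in_\<Lambda>)
      also have "\<dots> \<le> dist z y / real m" by (rule T_contracts)
      also have "\<dots> \<le> \<epsilon>" using z y m2 by (simp add: B_def field_simps)
      finally show "z \<in> T d -` B \<epsilon>" by (simp add: B_def)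
    qed
    have "measure \<mu> (B (real m * \<epsilon>)) = (\<Sum>d\<in>D. p d * measure \<mu> (B (real m * \<epsilon>)))"
      using p_sum by (simp flip: sum_distrib_right)
    also have "\<dots> \<le> (\<Sum>d\<in>D. p d * measure \<mu> (T d -` B \<epsilon>))"
      using sub meas T_vimage p_pos
      by (intro sum_mono mult_left_mono finite_measure_mono) (auto simp: sets_\<mu> less_imp_le)
    also have "\<dots> = measure \<mu> (B \<epsilon>)" using measure_inv[OF meas] by simp
    finally show ?thesis .
  qed
  have "measure \<mu> (B \<epsilon>) = 1" if \<epsilon>: "\<epsilon> > 0" for \<epsilon>
  proof -
    have mono: "measure \<mu> (B (real m ^ k * \<epsilon>)) \<le> measure \<mu> (B \<epsilon>)" for k
    proof (induction k)
      case (Suc k)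
      have "measure \<mu> (B (real m * (real m ^ k * \<epsilon>))) \<le> measure \<mu> (B (real m ^ k * \<epsilon>))" by (rule step)
      with Suc show ?case by (simp add: mult.assoc)
    qed simp
    have "(\<lambda>k. measure \<mu> (B (real m ^ k * \<epsilon>))) \<longlonglongrightarrow> measure \<mu> (\<Union>k. B (real m ^ k * \<epsilon>))"
    proof (rule finite_Lim_measure_incseq)
      show "incseq (\<lambda>k. B (real m ^ k * \<epsilon>))"
      proof (rule incseq_SucI)
        fix k have "real m ^ k * \<epsilon> \<le> real m ^ Suc k * \<epsilon>"
          using m2 \<epsilon> by (intro mult_right_mono power_increasing) auto
        thus "B (real m ^ k * \<epsilon>) \<subseteq> B (real m ^ Suc k * \<epsilon>)" by (auto simp: B_def)
      qed
    qed (use meas sets_\<mu> in auto)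
    moreover have "(\<Union>k. B (real m ^ k * \<epsilon>)) = space \<mu>"
    proof -
      have "\<exists>k. infdist z \<Lambda> \<le> real m ^ k * \<epsilon>" for z
      proof -
        obtain k where "infdist z \<Lambda> / \<epsilon> < real m ^ k"
          using real_arch_pow[of "real m" "infdist z \<Lambda> / \<epsilon>"] m2 by auto
        thus ?thesis using \<epsilon> by (intro exI[of _ k]) (simp add: field_simps)
      qed
      thus ?thesis by (auto simp: B_def space_\<mu>)
    qed
    ultimately have "(\<lambda>k. measure \<mu> (B (real m ^ k * \<epsilon>))) \<longlonglongrightarrow> 1" using prob_space by simp
    hence "1 \<le> measure \<mu> (B \<epsilon>)" using mono by (intro LIMSEQ_le_const2) auto
    thus ?thesis by (simp add: antisym)
  qed
  hence "AE z in \<mu>. z \<in> B (1 / real (Suc k))" for k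
    by (intro AE_prob_1) auto
  hence "AE z in \<mu>. \<forall>k. z \<in> B (1 / real (Suc k))" by (simp add: AE_all_countable)
  thus ?thesis
  proof (rule AE_mp, intro AE_I2 impI)
    fix z assume z: "\<forall>k. z \<in> B (1 / real (Suc k))"
    have "infdist z \<Lambda> \<le> 0"
    proof (rule LIMSEQ_le_const[OF LIMSEQ_inverse_real_of_nat])
      show "\<exists>N. \<forall>k\<ge>N. infdist z \<Lambda> \<le> inverse (real (Suc k))"
        using z by (auto simp: B_def inverse_eq_divide)
    qed
    hence "infdist z \<Lambda> = 0" using infdist_nonneg[of z \<Lambda>] by simp
    thus "z \<in> \<Lambda>" using in_closed_iff_infdist_zero[OF \<Lambda>_props(3,1)] by blast
  qed
qed

lemma measure_null:
  assumes "B \<in> sets borel" "B \<inter> \<Lambda> = {}"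
  shows "measure \<mu> B = 0"
proof -
  have "AE z in \<mu>. z \<notin> B" using AE_\<Lambda> by (rule AE_mp) (use assms in auto)
  thus ?thesis using assms by (simp add: prob_eq_0 sets_\<mu>)
qed

lemma measure_Int_\<Lambda>:
  assumes "B \<in> sets borel"
  shows "measure \<mu> (B \<inter> \<Lambda>) = measure \<mu> B"
proof (rule finite_measure_eq_AE)
  show "AE x in \<mu>. (x \<in> B \<inter> \<Lambda>) = (x \<in> B)" using AE_\<Lambda> by eventually_elim auto
qed (use assms borel_closed[OF \<Lambda>_props(3)] sets_\<mu> in auto)

lemma measure_\<Lambda>: "measure \<mu> \<Lambda> = 1"
  using measure_Int_\<Lambda>[of UNIV] prob_space by (simp add: space_\<mu>)

text \<open>Invariance gives
  \<open>measure \<mu> L \<le> (1 - p d\<^sub>0) * measure \<mu> L\<close>, because the preimage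
  under the map of \<open>d\<^sub>0\<close> is null and no other preimage has more mass than
  \<open>L\<close>.\<close>

lemma measure_line_eq_0:
  assumes L: "L \<in> sets borel"
    and D: "\<And>d. d \<in> D \<Longrightarrow> T d -` L = L \<or> T d -` L \<inter> \<Lambda> = {}"
    and d0: "d\<^sub>0 \<in> D" "T d\<^sub>0 -` L \<inter> \<Lambda> = {}"
  shows "measure \<mu> L = 0"
proof -
  have "measure \<mu> L = (\<Sum>d\<in>D. p d * measure \<mu> (T d -` L))" by (rule measure_inv[OF L])
  also have "\<dots> = (\<Sum>d\<in>D - {d\<^sub>0}. p d * measure \<mu> (T d -` L))"
    using d0 finD measure_null[OF T_vimage[OF L] d0(2)] by (subst sum.remove[of _ d\<^sub>0]) auto
  also have "\<dots> \<le> (\<Sum>d\<in>D - {d\<^sub>0}. p d * measure \<mu> L)"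
  proof (intro sum_mono mult_left_mono)
    fix d assume "d \<in> D - {d\<^sub>0}"
    thus "measure \<mu> (T d -` L) \<le> measure \<mu> L"
      using D[of d] measure_null[OF T_vimage[OF L]] by fastforce
  qed (use p_pos in \<open>auto simp: less_imp_le\<close>)
  also have "\<dots> = (1 - p d\<^sub>0) * measure \<mu> L"
    using p_sum d0 finD by (subst (asm) sum.remove[of _ d\<^sub>0]) (auto simp flip: sum_distrib_right)
  finally have "p d\<^sub>0 * measure \<mu> L \<le> 0" by (simp add: algebra_simps)
  thus ?thesis using p_pos[OF d0(1)] measure_nonneg[of \<mu> L] by (simp add: mult_le_0_iff)
qed

text \<open>These lines carry the horizontal sides of the unit square. The preimage of such a line
  is itself for digits of the extreme row \<open>e\<close>; for any other row it is a line outside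
  the unit square. A second row must exist: if all digits lay in row 0, the line at height 0 would
  have full measure.\<close>

lemma measure_horizontal:
  assumes "d1 \<in> D" "d2 \<in> D" "fst d1 \<noteq> fst d2" "c \<in> {0, 1}"
  shows "measure \<mu> {z. snd z = c} = 0"
proof -
  have mem: "z \<in> T d -` {z. snd z = c} \<longleftrightarrow> snd z = c * real m - real (fst d)" for d z
    using m2 by (auto simp: bm_map_eq field_simps)
  define e where "e = (if c = 0 then 0 else m - 1)"
  have empty: "T d -` {z. snd z = c} \<inter> \<Lambda> = {}" if "d \<in> D" "fst d \<noteq> e" for d
  proof -
    have "c * real m - real (fst d) < 0 \<or> c * real m - real (fst d) > 1"
      using that D_less[of d] assms(4) by (auto simp: e_def split: if_splits)
    moreover have "False" if "c * real m - real (fst d) < 0 \<or> c * real m - real (fst d) > 1"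
        "z \<in> T d -` {z. snd z = c}" "z \<in> \<Lambda>" for z
      using that mem[of z d] \<Lambda>_box[of z] by auto
    ultimately show ?thesis by blast
  qed
  have same: "T d -` {z. snd z = c} = {z. snd z = c}" if "d \<in> D" "fst d = e" for d
    using mem that assms(4) m2 by (auto simp: e_def of_nat_diff)
  obtain d where d: "d \<in> D" "fst d \<noteq> e" using assms by metis
  show ?thesis
  proof (rule measure_line_eq_0[OF _ _ d(1) empty[OF d]])
    show "{z :: real \<times> real. snd z = c} \<in> sets borel"
      by (intro borel_closed closed_Collect_eq continuous_intros)
  qed (use empty same in blast)
qed

lemma measure_vertical:
  assumes "d1 \<in> D" "d2 \<in> D" "snd d1 \<noteq> snd d2" "c \<in> {0, 1}"
  shows "measure \<mu> {z. fst z = c} = 0"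
proof -
  have mem: "z \<in> T d -` {z. fst z = c} \<longleftrightarrow> fst z = c * real n - real (snd d)" for d z
    using n2 by (auto simp: bm_map_eq field_simps)
  define e where "e = (if c = 0 then 0 else n - 1)"
  have empty: "T d -` {z. fst z = c} \<inter> \<Lambda> = {}" if "d \<in> D" "snd d \<noteq> e" for d
  proof -
    have "c * real n - real (snd d) < 0 \<or> c * real n - real (snd d) > 1"
      using that D_less[of d] assms(4) by (auto simp: e_def split: if_splits)
    moreover have "False" if "c * real n - real (snd d) < 0 \<or> c * real n - real (snd d) > 1"
        "z \<in> T d -` {z. fst z = c}" "z \<in> \<Lambda>" for z
      using that mem[of z d] \<Lambda>_box[of z] by auto
    ultimately show ?thesis by blast
  qed
  have same: "T d -` {z. fst z = c} = {z. fst z = c}" if "d \<in> D" "snd d = e" for d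
    using mem that assms(4) n2 by (auto simp: e_def of_nat_diff)
  obtain d where d: "d \<in> D" "snd d \<noteq> e" using assms by metis
  show ?thesis
  proof (rule measure_line_eq_0[OF _ _ d(1) empty[OF d]])
    show "{z :: real \<times> real. fst z = c} \<in> sets borel"
      by (intro borel_closed closed_Collect_eq continuous_intros)
  qed (use empty same in blast)
qed

lemma closed_T_image: "closed K \<Longrightarrow> closed (T d ` K)"
proof -
  assume K: "closed K"
  have "T d ` K = (\<lambda>w. (real n * fst w - real (snd d), real m * snd w - real (fst d))) -` K"
    (is "_ = ?g -` K")
  proof (intro equalityI subsetI)
    fix w assume "w \<in> ?g -` K"
    moreover have "w = T d (?g w)" using m2 n2 by (simp add: bm_map_eq prod_eq_iff)
    ultimately show "w \<in> T d ` K" by blast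
  qed (use m2 n2 in \<open>auto simp: bm_map_eq\<close>)
  also have "closed \<dots>" using K by (intro closed_vimage continuous_intros)
  finally show ?thesis .
qed

text \<open>If \<open>T d z = T d' w\<close>, the coordinates of \<open>z\<close> and
  \<open>w\<close> differ by the integer differences of the digits. In a direction in which the
  digits differ, both coordinates lie in [0, 1], so \<open>z\<close> is on a side of the unit
  square. That side is null because \<open>D\<close> has two rows, or two columns.\<close>

lemma measure_overlap:
  assumes d: "d \<in> D" "d' \<in> D" "d \<noteq> d'"
  shows "measure \<mu> (T d -` (T d' ` \<Lambda>)) = 0"
proof -
  let ?B = "T d -` (T d' ` \<Lambda>)"
  have meas: "?B \<in> sets borel"
    by (intro T_vimage borel_closed closed_T_image \<Lambda>_props)
  have diff: "fst w - fst z = real (snd d) - real (snd d')" "snd w - snd z = real (fst d) - real (fst d')"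
    if eq: "T d z = T d' w" for z w
    using eq m2 n2 by (auto simp: bm_map_eq)
  have int01: "y = 0 \<or> y = 1"
    if "0 \<le> y" "y \<le> 1" "0 \<le> y'" "y' \<le> 1" "y' - y = real a - real b" "a \<noteq> b" for y y' :: real and a b :: nat
  proof -
    have "real a - real b \<ge> 1 \<or> real a - real b \<le> -1" using that(6) by linarith
    thus ?thesis using that by linarith
  qed
  consider "fst d \<noteq> fst d'" | "snd d \<noteq> snd d'" using d(3) by (auto simp: prod_eq_iff)
  thus ?thesis
  proof cases
    case 1
    have sub: "?B \<inter> \<Lambda> \<subseteq> {z. snd z = 0} \<union> {z. snd z = 1}"
    proof
      fix z assume z: "z \<in> ?B \<inter> \<Lambda>"
      then obtain w where w: "w \<in> \<Lambda>" "T d z = T d' w" by auto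
      have "snd z = 0 \<or> snd z = 1"
        using int01[of "snd z" "snd w"] diff(2)[OF w(2)] \<Lambda>_box[OF w(1)] \<Lambda>_box[of z] z 1 by blast
      thus "z \<in> {z. snd z = 0} \<union> {z. snd z = 1}" by simp
    qed
    have cl: "{z :: real \<times> real. snd z = c} \<in> sets borel" for c
      by (intro borel_closed closed_Collect_eq continuous_intros)
    have "measure \<mu> ?B = measure \<mu> (?B \<inter> \<Lambda>)" using measure_Int_\<Lambda>[OF meas] by simp
    also have "\<dots> \<le> measure \<mu> ({z. snd z = 0} \<union> {z. snd z = 1})"
      using sub cl by (intro finite_measure_mono) (auto simp: sets_\<mu>)
    also have "\<dots> \<le> measure \<mu> {z. snd z = 0} + measure \<mu> {z. snd z = 1}"
      using cl by (intro measure_Un_le) (auto simp: sets_\<mu>)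
    also have "\<dots> = 0" using measure_horizontal[OF d(1,2) 1] by simp
    finally show ?thesis by (simp add: measure_le_0_iff)
  next
    case 2
    have sub: "?B \<inter> \<Lambda> \<subseteq> {z. fst z = 0} \<union> {z. fst z = 1}"
    proof
      fix z assume z: "z \<in> ?B \<inter> \<Lambda>"
      then obtain w where w: "w \<in> \<Lambda>" "T d z = T d' w" by auto
      have "fst z = 0 \<or> fst z = 1"
        using int01[of "fst z" "fst w"] diff(1)[OF w(2)] \<Lambda>_box[OF w(1)] \<Lambda>_box[of z] z 2 by blast
      thus "z \<in> {z. fst z = 0} \<union> {z. fst z = 1}" by simp
    qed
    have cl: "{z :: real \<times> real. fst z = c} \<in> sets borel" for c
      by (intro borel_closed closed_Collect_eq continuous_intros)
    have "measure \<mu> ?B = measure \<mu> (?B \<inter> \<Lambda>)" using measure_Int_\<Lambda>[OF meas] by simp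
    also have "\<dots> \<le> measure \<mu> ({z. fst z = 0} \<union> {z. fst z = 1})"
      using sub cl by (intro finite_measure_mono) (auto simp: sets_\<mu>)
    also have "\<dots> \<le> measure \<mu> {z. fst z = 0} + measure \<mu> {z. fst z = 1}"
      using cl by (intro measure_Un_le) (auto simp: sets_\<mu>)
    also have "\<dots> = 0" using measure_vertical[OF d(1,2) 2] by simp
    finally show ?thesis by (simp add: measure_le_0_iff)
  qed
qed

text \<open>Up to a null set of overlaps, the preimage of the union under the map of
  \<open>d\<close> is \<open>K\<close> if \<open>d\<close> belongs to \<open>R\<close> and empty
  otherwise.\<close>

lemma measure_UN_T:
  assumes R: "R \<subseteq> D" and K: "closed K" "K \<subseteq> \<Lambda>"
  shows "measure \<mu> (\<Union>d\<in>R. T d ` K) = (\<Sum>d\<in>R. p d) * measure \<mu> K"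
proof -
  have finR: "finite R" using R finD finite_subset by blast
  let ?U = "\<Union>d\<in>R. T d ` K"
  have cl: "closed ?U" using finR K by (intro closed_UN) (auto intro!: closed_T_image)
  have val: "measure \<mu> (T d -` ?U) = (if d \<in> R then measure \<mu> K else 0)" if d: "d \<in> D" for d
  proof -
    have null: "AE z in \<mu>. z \<notin> T d -` (T d' ` \<Lambda>)" if "d' \<in> R" "d' \<noteq> d" for d'
    proof -
      have "T d -` (T d' ` \<Lambda>) \<in> events"
        unfolding sets_\<mu> by (intro T_vimage borel_closed closed_T_image \<Lambda>_props)
      thus ?thesis using measure_overlap[of d d'] d that R by (subst prob_eq_0[symmetric]) auto
    qed
    have "AE z in \<mu>. \<forall>d'\<in>R - {d}. z \<notin> T d -` (T d' ` \<Lambda>)"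
      using finR null by (intro AE_finite_allI) auto
    hence ae: "AE z in \<mu>. z \<in> T d -` ?U \<longleftrightarrow> z \<in> (if d \<in> R then K else {})"
    proof eventually_elim
      case (elim z)
      have inK: "z \<in> K" if "T d z = T d w" "w \<in> K" for w
        using that injD[OF inj_T] by blast
      have "d' = d" if "d' \<in> R" "T d z = T d' w" "w \<in> K" for d' w
        using elim K(2) that by blast
      thus ?case using inK by auto
    qed
    have "measure \<mu> (T d -` ?U) = measure \<mu> (if d \<in> R then K else {})"
      by (rule finite_measure_eq_AE[OF ae]) (use cl K T_vimage sets_\<mu> borel_closed in auto)
    thus ?thesis by simp
  qed
  have "measure \<mu> ?U = (\<Sum>d\<in>D. p d * measure \<mu> (T d -` ?U))"
    using cl by (intro measure_inv borel_closed)
  also have "\<dots> = (\<Sum>d\<in>D. if d \<in> R then p d * measure \<mu> K else 0)"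
    using val by (intro sum.cong) auto
  also have "\<dots> = (\<Sum>d\<in>R. p d * measure \<mu> K)"
    using R finD by (simp add: sum.inter_restrict[symmetric] Int_absorb1)
  finally show ?thesis by (simp add: sum_distrib_right)
qed

section \<open>Measure of approximate squares and of balls\<close>

lemma row_prob_eq: "q i = (\<Sum>d | d \<in> D \<and> fst d = i. p d)"
  unfolding row_prob_def
  by (rule sum.reindex_bij_witness[where i = snd and j = "Pair i"]) auto

text \<open>For \<open>M = 0\<close> the column of the first digit is free, and truncated
  subtraction keeps \<open>M - 1\<close> equal to 0.\<close>

lemma coding_cyl_Suc:
  assumes "\<omega> \<in> seqs"
  shows "cod ` cyl M (Suc N) \<omega> =
    (\<Union>d\<in>{d\<in>D. fst d = fst (\<omega> 0) \<and> (0 < M \<longrightarrow> snd d = snd (\<omega> 0))}. T d ` cod ` cyl (M - 1) N (\<lambda>k. \<omega> (Suc k)))"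
    (is "?L = ?R")
proof (intro equalityI subsetI)
  fix z assume "z \<in> ?L"
  then obtain \<tau> where \<tau>: "\<tau> \<in> cyl M (Suc N) \<omega>" "z = cod \<tau>" by blast
  have s: "\<tau> \<in> seqs" using \<tau> by (simp add: bm_cylinder_def)
  have "(\<lambda>k. \<tau> (Suc k)) \<in> cyl (M - 1) N (\<lambda>k. \<omega> (Suc k))"
    using \<tau>(1) by (auto simp: bm_cylinder_def seqs_Suc)
  moreover have "\<tau> 0 \<in> {d\<in>D. fst d = fst (\<omega> 0) \<and> (0 < M \<longrightarrow> snd d = snd (\<omega> 0))}"
    using \<tau>(1) seqsD[OF s] by (auto simp: bm_cylinder_def)
  moreover have "z = T (\<tau> 0) (cod (\<lambda>k. \<tau> (Suc k)))" using coding_Suc[OF s] \<tau>(2) by simp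
  ultimately show "z \<in> ?R" by blast
next
  fix z assume "z \<in> ?R"
  then obtain d \<tau> where d: "d \<in> D" "fst d = fst (\<omega> 0)" "0 < M \<longrightarrow> snd d = snd (\<omega> 0)"
    and \<tau>: "\<tau> \<in> cyl (M - 1) N (\<lambda>k. \<omega> (Suc k))" "z = T d (cod \<tau>)" by blast
  let ?\<tau> = "case_nat d \<tau>"
  have s: "?\<tau> \<in> seqs" using \<tau>(1) d(1) by (auto simp: bm_cylinder_def digit_seqs_def split: nat.split)
  have "?\<tau> \<in> cyl M (Suc N) \<omega>"
    using s \<tau>(1) d by (auto simp: bm_cylinder_def split: nat.split)
  moreover have "z = cod ?\<tau>" using coding_Suc[OF s] \<tau>(2) by simp
  ultimately show "z \<in> ?L" by blast
qed

text \<open>Removing the first digit turns \<open>(M, N)\<close> into \<open>(M - 1, N - 1)\<close>,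
  which need not be of the form \<open>(lev N', N')\<close>; hence the general \<open>M\<close>.
  Closedness is part of the induction because \<open>measure_UN_T\<close> requires it.\<close>

lemma coding_cyl_measure:
  assumes "\<omega> \<in> seqs" "M \<le> N"
  shows "closed (cod ` cyl M N \<omega>) \<and>
    measure \<mu> (cod ` cyl M N \<omega>) = (\<Prod>k<N. if k < M then p (\<omega> k) else q (fst (\<omega> k)))"
  using assms
proof (induction N arbitrary: M \<omega>)
  case 0
  have "cyl M 0 \<omega> = seqs" using 0 by (auto simp: bm_cylinder_def)
  thus ?case using \<Lambda>_props(3) measure_\<Lambda> \<Lambda>_eq by simp
next
  case (Suc N)
  let ?R = "{d\<in>D. fst d = fst (\<omega> 0) \<and> (0 < M \<longrightarrow> snd d = snd (\<omega> 0))}"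
  let ?K = "cod ` cyl (M - 1) N (\<lambda>k. \<omega> (Suc k))"
  have IH: "closed ?K" "measure \<mu> ?K = (\<Prod>k<N. if k < M - 1 then p (\<omega> (Suc k)) else q (fst (\<omega> (Suc k))))"
    using Suc.IH[OF seqs_Suc[OF Suc.prems(1)], of "M - 1"] Suc.prems(2) by auto
  have finR: "finite ?R" using finD by simp
  have sub: "?K \<subseteq> \<Lambda>" unfolding \<Lambda>_eq by (auto simp: bm_cylinder_def)
  have "(\<Sum>d\<in>?R. p d) = (if 0 < M then p (\<omega> 0) else q (fst (\<omega> 0)))"
  proof (cases "0 < M")
    case True
    hence "?R = {\<omega> 0}" using seqsD[OF Suc.prems(1)] by (auto simp: prod_eq_iff)
    thus ?thesis using True by simp
  qed (simp add: row_prob_eq)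
  hence "measure \<mu> (\<Union>d\<in>?R. T d ` ?K) = (if 0 < M then p (\<omega> 0) else q (fst (\<omega> 0))) * measure \<mu> ?K"
    using measure_UN_T[of ?R ?K] IH(1) sub by auto
  also have "\<dots> = (\<Prod>k<Suc N. if k < M then p (\<omega> k) else q (fst (\<omega> k)))"
    unfolding IH(2) prod.lessThan_Suc_shift by (simp add: less_diff_conv)
  finally have meas: "measure \<mu> (\<Union>d\<in>?R. T d ` ?K) = \<dots>" .
  have "closed (\<Union>d\<in>?R. T d ` ?K)" using finR IH(1) by (intro closed_UN) (auto intro!: closed_T_image)
  thus ?case using meas coding_cyl_Suc[OF Suc.prems(1), of M N] by simp
qed

lemma q_pos: "d \<in> D \<Longrightarrow> 0 < q (fst d)"
  unfolding row_prob_eq using finD p_pos by (intro sum_pos2[of _ d]) (auto simp: less_imp_le)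

lemma measure_cyl:
  assumes "\<omega> \<in> seqs"
  shows "measure \<mu> (cod ` cyl (lev N) N \<omega>) = exp (S N \<omega>)"
proof -
  have "exp (S N \<omega>) = (\<Prod>k<N. exp (\<psi> N k (\<omega> k)))" by (simp add: S_def exp_sum)
  also have "\<dots> = (\<Prod>k<N. if k < lev N then p (\<omega> k) else q (fst (\<omega> k)))"
    using p_pos q_pos seqsD[OF assms] by (intro prod.cong) (auto simp: log_weight_def)
  finally show ?thesis using coding_cyl_measure[OF assms lev_le[of N]] by simp
qed

lemma has_symb_local_dim_iff:
  assumes "\<omega> \<in> seqs"
  shows "has_symb_local_dim m n D \<Lambda> \<mu> \<omega> \<alpha> \<longleftrightarrow> (\<lambda>N. S N \<omega> / (- real N * ln (real m))) \<longlonglongrightarrow> \<alpha>"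
  unfolding has_symb_local_dim_def approx_square_eq[OF carpet] measure_cyl[OF assms] by simp

lemma measure_cball_ge:
  assumes "\<omega> \<in> seqs" "2 / real m ^ N \<le> r"
  shows "exp (S N \<omega>) \<le> measure \<mu> (cball (cod \<omega>) r)"
proof -
  have "cod ` cyl (lev N) N \<omega> \<subseteq> cball (cod \<omega>) r"
    using cyl_dist_le[of _ N \<omega>] assms by fastforce
  thus ?thesis unfolding measure_cyl[OF assms(1), symmetric]
    by (intro finite_measure_mono) (auto simp: sets_\<mu>)
qed

lemma measure_cball_le:
  assumes "\<omega> \<in> seqs" "\<not> run N l \<omega>" "r \<le> 1 / (real m ^ N * real n ^ (l + 2))"
  shows "measure \<mu> (cball (cod \<omega>) r) \<le> exp (S N \<omega>)"
proof -
  have "cball (cod \<omega>) r \<inter> \<Lambda> \<subseteq> cod ` cyl (lev N) N \<omega>"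
  proof
    fix z assume z: "z \<in> cball (cod \<omega>) r \<inter> \<Lambda>"
    then obtain \<tau> where "\<tau> \<in> seqs" "z = cod \<tau>" using \<Lambda>_eq by blast
    thus "z \<in> cod ` cyl (lev N) N \<omega>"
      using close_in_cyl[OF assms(1) _ assms(2)] z assms(3) by auto
  qed
  moreover have "cod ` cyl (lev N) N \<omega> \<in> events"
    using coding_cyl_measure[OF assms(1) lev_le[of N]] by (simp add: sets_\<mu> borel_closed)
  ultimately have "measure \<mu> (cball (cod \<omega>) r \<inter> \<Lambda>) \<le> measure \<mu> (cod ` cyl (lev N) N \<omega>)"
    by (intro finite_measure_mono)
  thus ?thesis unfolding measure_cyl[OF assms(1)] by (subst (asm) measure_Int_\<Lambda>) auto
qed

definition weight_bound :: real where
  "weight_bound = 1 + (\<Sum>d\<in>D. \<bar>ln (p d)\<bar> + \<bar>ln (q (fst d))\<bar>)"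

lemma weight_bound_pos: "0 < weight_bound"
  unfolding weight_bound_def by (intro add_pos_nonneg sum_nonneg) auto

lemma abs_log_weight_le: "d \<in> D \<Longrightarrow> \<bar>\<psi> N k d\<bar> \<le> weight_bound"
proof -
  assume d: "d \<in> D"
  have "\<bar>ln (p d)\<bar> + \<bar>ln (q (fst d))\<bar> \<le> (\<Sum>d\<in>D. \<bar>ln (p d)\<bar> + \<bar>ln (q (fst d))\<bar>)"
    using d finD by (intro member_le_sum) auto
  thus ?thesis by (auto simp: weight_bound_def log_weight_def)
qed

text \<open>The factor 3 has two sources. At most \<open>K\<close> old positions pass from
  \<open>ln q\<close> to \<open>ln p\<close> when \<open>lev\<close> grows, each changing by at most
  \<open>2 * weight_bound\<close>, and \<open>K\<close> new positions contribute at most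
  \<open>weight_bound\<close> each.\<close>

lemma S_diff_le:
  assumes \<omega>: "\<omega> \<in> seqs"
  shows "\<bar>S (N + K) \<omega> - S N \<omega>\<bar> \<le> 3 * weight_bound * real K"
proof -
  have wb: "\<bar>\<psi> N k (\<omega> k)\<bar> \<le> weight_bound" for N k using abs_log_weight_le seqsD[OF \<omega>] by blast
  have "S (N + K) \<omega> = (\<Sum>k<N. \<psi> (N + K) k (\<omega> k)) + (\<Sum>k\<in>{N..<N+K}. \<psi> (N + K) k (\<omega> k))"
    unfolding S_def by (subst sum.union_disjoint[symmetric]) (auto intro!: sum.cong)
  hence eq: "S (N + K) \<omega> - S N \<omega> =
     (\<Sum>k<N. \<psi> (N + K) k (\<omega> k) - \<psi> N k (\<omega> k)) + (\<Sum>k\<in>{N..<N+K}. \<psi> (N + K) k (\<omega> k))"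
    by (simp add: S_def sum_subtractf)
  have "\<bar>\<Sum>k<N. \<psi> (N + K) k (\<omega> k) - \<psi> N k (\<omega> k)\<bar> \<le>
      (\<Sum>k<N. \<bar>\<psi> (N + K) k (\<omega> k) - \<psi> N k (\<omega> k)\<bar>)" by (rule sum_abs)
  also have "\<dots> \<le> (\<Sum>k<N. if k \<in> {lev N..<lev (N + K)} then 2 * weight_bound else 0)"
  proof (intro sum_mono)
    fix k
    have "\<psi> (N + K) k (\<omega> k) = \<psi> N k (\<omega> k)" if "k \<notin> {lev N..<lev (N + K)}"
      using that lev_mono[of N "N + K"] by (auto simp: log_weight_def)
    thus "\<bar>\<psi> (N + K) k (\<omega> k) - \<psi> N k (\<omega> k)\<bar> \<le>
        (if k \<in> {lev N..<lev (N + K)} then 2 * weight_bound else 0)"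
      using wb[of "N + K" k] wb[of N k] by auto
  qed
  also have "\<dots> = real (card ({..<N} \<inter> {lev N..<lev (N + K)})) * (2 * weight_bound)"
    by (subst sum.inter_restrict[symmetric]) auto
  also have "\<dots> \<le> real K * (2 * weight_bound)"
  proof (intro mult_right_mono)
    have "card ({..<N} \<inter> {lev N..<lev (N + K)}) \<le> card {lev N..<lev (N + K)}"
      by (intro card_mono) auto
    thus "real (card ({..<N} \<inter> {lev N..<lev (N + K)})) \<le> real K" using lev_add_le[of N K] by simp
  qed (use weight_bound_pos in auto)
  finally have 1: "\<bar>\<Sum>k<N. \<psi> (N + K) k (\<omega> k) - \<psi> N k (\<omega> k)\<bar> \<le> real K * (2 * weight_bound)" .
  have "\<bar>\<Sum>k\<in>{N..<N+K}. \<psi> (N + K) k (\<omega> k)\<bar> \<le> (\<Sum>k\<in>{N..<N+K}. \<bar>\<psi> (N + K) k (\<omega> k)\<bar>)" by (rule sum_abs)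
  also have "\<dots> \<le> (\<Sum>k\<in>{N..<N+K}. weight_bound)" by (intro sum_mono wb)
  finally have 2: "\<bar>\<Sum>k\<in>{N..<N+K}. \<psi> (N + K) k (\<omega> k)\<bar> \<le> real K * weight_bound" by simp
  show ?thesis unfolding eq using 1 2 by (simp add: abs_le_iff algebra_simps)
qed

end

section \<open>Products of discrete distributions\<close>

definition seq_measure :: "(nat \<Rightarrow> 'a pmf) \<Rightarrow> (nat \<Rightarrow> 'a) measure" where
  "seq_measure d = PiM UNIV (\<lambda>k. measure_pmf (d k))"

lemma prob_space_seq_measure: "prob_space (seq_measure d)"
  unfolding seq_measure_def by (intro prob_space_PiM prob_space_measure_pmf)

lemma space_seq_measure [simp]: "space (seq_measure d) = UNIV"
  by (auto simp: seq_measure_def space_PiM PiE_def)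

lemma measurable_seq_coordinate [measurable]:
  "(\<lambda>\<omega>. \<omega> k) \<in> measurable (seq_measure d) (count_space UNIV)"
proof -
  have "(\<lambda>\<omega>. \<omega> k) \<in> measurable (seq_measure d) (measure_pmf (d k))"
    unfolding seq_measure_def by (rule measurable_component_singleton) simp
  thus ?thesis by (simp cong: measurable_cong_sets)
qed

lemma measurable_seq_coordinate_compose [measurable]:
  "(\<lambda>\<omega>. f (\<omega> k)) \<in> measurable (seq_measure d) (count_space UNIV)"
  by (rule measurable_compose[OF measurable_seq_coordinate]) simp

lemma borel_measurable_seq_coordinate [measurable]:
  "(\<lambda>\<omega>. f (\<omega> k)) \<in> borel_measurable (seq_measure d)"
  by (rule measurable_compose[OF measurable_seq_coordinate]) simp

lemma sets_seq_box:
  "countable J \<Longrightarrow> {\<omega>. \<forall>k\<in>J. \<omega> k \<in> A k} \<in> sets (seq_measure d)"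
proof -
  assume J: "countable J"
  have [measurable]: "{\<omega>. \<omega> k \<in> A k} \<in> sets (seq_measure d)" for k
    using measurable_sets[OF measurable_seq_coordinate[of k d], of "A k"] by (simp add: vimage_def)
  have "{\<omega>. \<forall>k\<in>J. \<omega> k \<in> A k} = {\<omega> \<in> space (seq_measure d). \<forall>k\<in>J. \<omega> \<in> {\<omega>. \<omega> k \<in> A k}}" by auto
  also have "\<dots> \<in> sets (seq_measure d)" using J by (intro sets.sets_Collect_countable_All') auto
  finally show ?thesis .
qed

lemma measure_seq_box:
  assumes "finite J"
  shows "measure (seq_measure d) {\<omega>. \<forall>k\<in>J. \<omega> k \<in> A k} = (\<Prod>k\<in>J. measure (measure_pmf (d k)) (A k))"
proof -
  interpret P: product_prob_space "\<lambda>k. measure_pmf (d k)" UNIV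
    by (rule product_prob_spaceI) (rule prob_space_measure_pmf)
  have "emeasure (seq_measure d) {\<omega>. \<forall>k\<in>J. \<omega> k \<in> A k} = (\<Prod>k\<in>J. emeasure (measure_pmf (d k)) (A k))"
    using P.emeasure_PiM_Collect[of J A] assms space_seq_measure[of d] by (simp add: seq_measure_def)
  also have "\<dots> = ennreal (\<Prod>k\<in>J. measure (measure_pmf (d k)) (A k))"
    by (simp add: measure_pmf.emeasure_eq_measure prod_ennreal)
  finally show ?thesis
    by (simp add: measure_def prod_nonneg)
qed

lemma AE_seq_measure: "(\<And>x. x \<in> set_pmf (d k) \<Longrightarrow> P x) \<Longrightarrow> AE \<omega> in seq_measure d. P (\<omega> k)"
  unfolding seq_measure_def
  by (intro AE_PiM_component prob_space_measure_pmf) (auto simp: AE_measure_pmf_iff)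

lemma distr_seq_measure: "distr (seq_measure d) (count_space UNIV) (\<lambda>\<omega>. \<omega> k) = measure_pmf (d k)"
proof -
  have "distr (seq_measure d) (measure_pmf (d k)) (\<lambda>\<omega>. \<omega> k) = measure_pmf (d k)"
    unfolding seq_measure_def by (intro distr_PiM_component prob_space_measure_pmf) auto
  thus ?thesis by (metis distr_cong sets_measure_pmf_count_space)
qed

lemma expectation_seq_measure:
  fixes f :: "'a \<Rightarrow> real"
  shows "(\<integral>\<omega>. f (\<omega> k) \<partial>seq_measure d) = measure_pmf.expectation (d k) f"
  by (subst distr_seq_measure[symmetric], subst integral_distr) auto

lemma indep_vars_seq_measure:
  fixes f :: "nat \<Rightarrow> 'a \<Rightarrow> real"
  shows "prob_space.indep_vars (seq_measure d) (\<lambda>_. borel) (\<lambda>k \<omega>. f k (\<omega> k)) J"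
proof -
  interpret prob_space "seq_measure d" by (rule prob_space_seq_measure)
  have "indep_vars (\<lambda>_. count_space UNIV) (\<lambda>k \<omega>. \<omega> k) UNIV"
  proof (subst indep_vars_iff_distr_eq_PiM)
    have s: "sets (PiM UNIV (\<lambda>_ :: nat. count_space (UNIV :: 'a set))) = sets (seq_measure d)"
      unfolding seq_measure_def by (intro sets_PiM_cong) auto
    have "distr (seq_measure d) (PiM UNIV (\<lambda>_. count_space UNIV)) (\<lambda>\<omega>. \<omega>) =
        distr (seq_measure d) (seq_measure d) (\<lambda>\<omega>. \<omega>)"
      by (rule distr_cong) (use s in auto)
    thus "distr (seq_measure d) (PiM UNIV (\<lambda>_. count_space UNIV)) (\<lambda>\<omega>. \<lambda>k\<in>UNIV. \<omega> k) =
        PiM UNIV (\<lambda>k. distr (seq_measure d) (count_space UNIV) (\<lambda>\<omega>. \<omega> k))"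
      unfolding distr_seq_measure by (simp add: restrict_UNIV distr_id seq_measure_def)
  qed auto
  hence "indep_vars (\<lambda>_. borel) (\<lambda>k. f k \<circ> (\<lambda>\<omega>. \<omega> k)) UNIV"
    by (rule indep_vars_compose) auto
  hence "indep_vars (\<lambda>_. borel) (\<lambda>k. f k \<circ> (\<lambda>\<omega>. \<omega> k)) J"
    by (rule indep_vars_subset) auto
  thus ?thesis by (simp add: comp_def)
qed

lemma seq_measure_concentration:
  fixes f :: "nat \<Rightarrow> 'a \<Rightarrow> real"
  assumes N: "0 < N" and C: "0 < C" and \<epsilon>: "0 \<le> \<epsilon>"
    and bd: "\<And>k x. x \<in> set_pmf (d k) \<Longrightarrow> \<bar>f k x\<bar> \<le> C"
  shows "measure (seq_measure d)
      {\<omega>. \<epsilon> \<le> \<bar>(\<Sum>k<N. f k (\<omega> k)) - (\<Sum>k<N. measure_pmf.expectation (d k) (f k))\<bar>}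
    \<le> 2 * exp (- \<epsilon>\<^sup>2 / (2 * C\<^sup>2 * real N))"
proof -
  interpret prob_space "seq_measure d" by (rule prob_space_seq_measure)
  interpret Hoeffding_ineq "seq_measure d" "{..<N}" "\<lambda>k \<omega>. f k (\<omega> k)" "\<lambda>_. - C" "\<lambda>_. C"
    "\<Sum>k<N. expectation (\<lambda>\<omega>. f k (\<omega> k))"
  proof unfold_locales
    show "indep_vars (\<lambda>_. borel) (\<lambda>k \<omega>. f k (\<omega> k)) {..<N}" by (rule indep_vars_seq_measure)
    show "AE \<omega> in seq_measure d. f k (\<omega> k) \<in> {- C..C}" for k
      using bd by (intro AE_seq_measure) (auto simp: abs_le_iff dest: minus_le_iff[THEN iffD1])
  qed auto
  \<comment> \<open>Each summand takes values in an interval of length \<open>2 * C\<close>; this is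
    Hoeffding's exponent in simplified form.\<close>
  have "- 2 * \<epsilon>\<^sup>2 / (real N * (C + C)\<^sup>2) = - \<epsilon>\<^sup>2 / (2 * C\<^sup>2 * real N)"
    using C N by (simp add: field_simps power2_eq_square)
  thus ?thesis
    using Hoeffding_ineq_abs_ge[OF \<epsilon>] N C by (simp add: expectation_seq_measure mult_ac)
qed

section \<open>Random digit sequences\<close>

context bm_digit_set
begin

definition "L0 = card D"
definition "L1 = card (occupied_rows D)"

text \<open>\<open>weight True\<close> maximises the number of choices of a full digit, \<open>weight False\<close> that of a row.\<close>

definition weight :: "bool \<Rightarrow> nat \<times> nat \<Rightarrow> real" where
  "weight b d = (if b then 1 / real L0 else 1 / (real (row_count D (fst d)) * real L1))"

definition digit_pmf :: "bool \<Rightarrow> (nat \<times> nat) pmf" where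
  "digit_pmf b = embed_pmf (\<lambda>d. if d \<in> D then weight b d else 0)"

definition \<nu> :: "(nat \<Rightarrow> bool) \<Rightarrow> (nat \<Rightarrow> nat \<times> nat) measure" where
  "\<nu> t = seq_measure (\<lambda>k. digit_pmf (t k))"

lemma row_eq: "{j. (i, j) \<in> D} = snd ` {d \<in> D. fst d = i}" by force

lemma row_count_eq: "row_count D i = card {d \<in> D. fst d = i}"
  unfolding row_count_def row_eq by (intro card_image) (auto simp: inj_on_def prod_eq_iff)

lemma row_count_pos_iff: "row_count D i \<noteq> 0 \<longleftrightarrow> i \<in> fst ` D"
  unfolding row_count_eq using finD by (auto simp: image_iff) (metis fst_conv)

lemma occupied_rows_eq: "occupied_rows D = fst ` D"
  unfolding occupied_rows_def row_count_pos_iff by simp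

lemma L1_bounds: "0 < L1" "L1 \<le> L0" and L0_ge: "2 \<le> L0"
  unfolding L0_def L1_def occupied_rows_eq using finD D_ne cardD
  by (auto simp: card_gt_0_iff intro: card_image_le)

lemma row_count_bounds: "d \<in> D \<Longrightarrow> 0 < row_count D (fst d)" "row_count D i \<le> L0"
  using row_count_pos_iff[of "fst d"] finD
  by (simp, simp add: L0_def row_count_eq card_mono)

lemma sum_digits_by_row: "(\<Sum>d\<in>D. f d) = (\<Sum>i\<in>occupied_rows D. \<Sum>d | d \<in> D \<and> fst d = i. f d)"
  unfolding occupied_rows_eq using finD by (rule sum.image_gen)

lemma weight_nonneg: "0 \<le> weight b d" by (simp add: weight_def)

lemma sum_weight_row:
  "i \<in> occupied_rows D \<Longrightarrow> (\<Sum>d | d \<in> D \<and> fst d = i. weight b d) =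
    (if b then real (row_count D i) / real L0 else 1 / real L1)"
proof -
  assume "i \<in> occupied_rows D"
  hence pos: "row_count D i \<noteq> 0" by (simp add: occupied_rows_def)
  have "(\<Sum>d | d \<in> D \<and> fst d = i. weight b d) =
      (\<Sum>d | d \<in> D \<and> fst d = i. if b then 1 / real L0 else 1 / (real (row_count D i) * real L1))"
    by (intro sum.cong) (auto simp: weight_def)
  also have "\<dots> = real (row_count D i) * (if b then 1 / real L0 else 1 / (real (row_count D i) * real L1))"
    by (simp add: row_count_eq)
  finally show ?thesis using pos by (simp split: if_splits)
qed

lemma sum_weight: "(\<Sum>d\<in>D. weight b d) = 1"
proof (cases b)
  case True
  thus ?thesis using L0_ge by (simp add: weight_def L0_def)
next
  case False
  thus ?thesis using L1_bounds by (simp add: sum_digits_by_row sum_weight_row L1_def)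
qed

lemma pmf_digit: "pmf (digit_pmf b) d = (if d \<in> D then weight b d else 0)"
  unfolding digit_pmf_def
proof (rule pmf_embed_pmf)
  have "(\<integral>\<^sup>+ x. ennreal (if x \<in> D then weight b x else 0) \<partial>count_space UNIV) =
      (\<integral>\<^sup>+ x. ennreal (weight b x) \<partial>count_space D)"
    by (subst nn_integral_count_space_indicator) (auto intro!: nn_integral_cong split: split_indicator)
  also have "\<dots> = 1"
    using finD sum_weight by (simp add: nn_integral_count_space_finite weight_nonneg)
  finally show "(\<integral>\<^sup>+ x. ennreal (if x \<in> D then weight b x else 0) \<partial>count_space UNIV) = 1" .
qed (simp add: weight_nonneg)

lemma set_pmf_digit: "set_pmf (digit_pmf b) \<subseteq> D"
  by (auto simp: set_pmf_iff pmf_digit split: if_splits)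

lemma measure_digit: "measure (measure_pmf (digit_pmf b)) A = (\<Sum>d\<in>D \<inter> A. weight b d)"
proof -
  have "measure (measure_pmf (digit_pmf b)) A = measure (measure_pmf (digit_pmf b)) (D \<inter> A)"
    using set_pmf_digit by (intro measure_eq_AE) (auto simp: AE_measure_pmf_iff)
  also have "\<dots> = (\<Sum>d\<in>D \<inter> A. weight b d)"
    using finD by (subst measure_measure_pmf_finite) (auto simp: pmf_digit intro!: sum.cong)
  finally show ?thesis .
qed

lemma expectation_digit:
  fixes f :: "nat \<times> nat \<Rightarrow> real"
  shows "measure_pmf.expectation (digit_pmf b) f = (\<Sum>d\<in>D. weight b d * f d)"
  by (subst integral_measure_pmf[OF finD]) (use set_pmf_digit in \<open>auto simp: pmf_digit intro!: sum.cong\<close>)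

section \<open>Random sequences and the cells that they hit\<close>

lemma prob_space_\<nu>: "prob_space (\<nu> t)"
  unfolding \<nu>_def by (rule prob_space_seq_measure)

lemma space_\<nu> [simp]: "space (\<nu> t) = UNIV" by (simp add: \<nu>_def)

lemma AE_seqs: "AE \<omega> in \<nu> t. \<omega> \<in> seqs"
proof -
  have "AE \<omega> in \<nu> t. \<omega> k \<in> D" for k
    unfolding \<nu>_def using set_pmf_digit by (intro AE_seq_measure) auto
  thus ?thesis by (simp add: digit_seqs_def AE_all_countable)
qed

text \<open>Unlike \<open>cyl\<close> this restricts finitely many coordinates only, so it is a
  product box whose probability is a finite product. The two differ by sequences with a later digit
  outside \<open>D\<close>, which form a null set.\<close>

definition cell_box :: "nat \<Rightarrow> (nat \<Rightarrow> nat \<times> nat) \<Rightarrow> (nat \<Rightarrow> nat \<times> nat) set" where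
  "cell_box N \<omega> = {\<tau>. \<forall>k\<in>{..<N}. \<tau> k \<in> (if k < lev N then {\<omega> k} else {d \<in> D. fst d = fst (\<omega> k)})}"

lemma sets_cell_box: "cell_box N \<omega> \<in> sets (\<nu> t)"
  unfolding cell_box_def \<nu>_def by (rule sets_seq_box) simp

lemma measure_cell_box:
  assumes "\<omega> \<in> seqs"
  shows "measure (\<nu> t) (cell_box N \<omega>) =
    (\<Prod>k<N. if k < lev N then weight (t k) (\<omega> k)
            else (if t k then real (row_count D (fst (\<omega> k))) / real L0 else 1 / real L1))"
  unfolding cell_box_def \<nu>_def
proof (subst measure_seq_box; (intro prod.cong refl)?)
  fix k
  have "fst (\<omega> k) \<in> occupied_rows D" using seqsD[OF assms] by (auto simp: occupied_rows_eq)
  moreover have "D \<inter> {d \<in> D. fst d = fst (\<omega> k)} = {d. d \<in> D \<and> fst d = fst (\<omega> k)}" by auto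
  moreover have "D \<inter> {\<omega> k} = {\<omega> k}" using seqsD[OF assms] by auto
  ultimately show "measure (measure_pmf (digit_pmf (t k))) (if k < lev N then {\<omega> k} else {d \<in> D. fst d = fst (\<omega> k)}) =
      (if k < lev N then weight (t k) (\<omega> k)
            else (if t k then real (row_count D (fst (\<omega> k))) / real L0 else 1 / real L1))"
    using sum_weight_row[of "fst (\<omega> k)" "t k"] by (simp add: measure_digit)
qed simp

lemma cyl_subset_cell_box: "\<tau> \<in> cyl (lev N) N \<omega> \<Longrightarrow> \<tau> \<in> cell_box N \<omega>"
  by (auto simp: cell_box_def bm_cylinder_def seqsD prod_eq_iff)

lemma cell_box_idx: "\<tau> \<in> cell_box N \<omega> \<Longrightarrow> idx N \<tau> = idx N \<omega>"
proof -
  assume \<tau>: "\<tau> \<in> cell_box N \<omega>"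
  have pv: "(\<forall>i<k. a i = a' i) \<longrightarrow> prefix_value b a k = prefix_value b a' k" for b k and a a' :: "nat \<Rightarrow> nat"
    by (induction k) auto
  have mem: "\<tau> k \<in> (if k < lev N then {\<omega> k} else {d \<in> D. fst d = fst (\<omega> k)})" if "k < N" for k
    using \<tau> that unfolding cell_box_def by blast
  have "fst (\<tau> k) = fst (\<omega> k)" if "k < N" for k
    using mem[OF that] by (simp split: if_splits)
  moreover have "snd (\<tau> k) = snd (\<omega> k)" if "k < lev N" for k
    using mem[of k] that lev_le[of N] by simp
  ultimately show ?thesis unfolding cell_index_def
    using pv[of N "\<lambda>k. fst (\<tau> k)" "\<lambda>k. fst (\<omega> k)" m]
      pv[of "lev N" "\<lambda>k. snd (\<tau> k)" "\<lambda>k. snd (\<omega> k)" n] by simp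
qed

text \<open>All approximate squares of level \<open>N\<close> have the same measure if the first \<open>lev N\<close> digits are
  chosen uniformly and the following rows are chosen uniformly, so counting squares amounts to
  computing probabilities.\<close>

lemma card_cells_le:
  assumes X: "X \<subseteq> seqs" and Ev: "Ev \<in> sets (\<nu> (\<lambda>k. k < lev N))"
    and cl: "\<And>\<omega>. \<omega> \<in> X \<Longrightarrow> cell_box N \<omega> \<subseteq> Ev"
  shows "real (card (idx N ` X)) \<le>
    real L0 ^ lev N * real L1 ^ (N - lev N) * measure (\<nu> (\<lambda>k. k < lev N)) Ev"
proof -
  let ?M = "\<nu> (\<lambda>k. k < lev N)"
  interpret prob_space ?M by (rule prob_space_\<nu>)
  have val: "measure ?M (cell_box N \<omega>) = 1 / (real L0 ^ lev N * real L1 ^ (N - lev N))" if "\<omega> \<in> seqs" for \<omega>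
  proof -
    have "measure ?M (cell_box N \<omega>) = (\<Prod>k<N. if k < lev N then 1 / real L0 else 1 / real L1)"
      unfolding measure_cell_box[OF that] by (intro prod.cong) (auto simp: weight_def)
    also have "\<dots> = (\<Prod>k\<in>{..<lev N}. 1 / real L0) * (\<Prod>k\<in>{lev N..<N}. 1 / real L1)"
    proof -
      have "{..<N} \<inter> {k. k < lev N} = {..<lev N}" "{..<N} \<inter> - {k. k < lev N} = {lev N..<N}"
        using lev_le[of N] by auto
      thus ?thesis by (subst prod.If_cases) simp_all
    qed
    finally show ?thesis by (simp add: power_divide)
  qed
  have fin: "finite (idx N ` X)" using finite_idx X by (meson finite_subset image_mono)
  define rep where "rep c = (SOME \<omega>. \<omega> \<in> X \<and> idx N \<omega> = c)" for c
  have rep: "rep c \<in> X" "idx N (rep c) = c" if "c \<in> idx N ` X" for c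
  proof -
    have "\<exists>\<omega>. \<omega> \<in> X \<and> idx N \<omega> = c" using that by (metis imageE)
    from someI_ex[OF this] show "rep c \<in> X" "idx N (rep c) = c" by (auto simp: rep_def)
  qed
  have "real (card (idx N ` X)) * (1 / (real L0 ^ lev N * real L1 ^ (N - lev N))) =
      (\<Sum>c\<in>idx N ` X. measure ?M (cell_box N (rep c)))"
    using val[OF subsetD[OF X rep(1)]] by simp
  also have "\<dots> = measure ?M (\<Union>c\<in>idx N ` X. cell_box N (rep c))"
  proof (rule finite_measure_finite_Union[symmetric, OF fin])
    show "disjoint_family_on (\<lambda>c. cell_box N (rep c)) (idx N ` X)"
      unfolding disjoint_family_on_def using cell_box_idx rep by (metis disjoint_iff)
  qed (use sets_cell_box in auto)
  also have "\<dots> \<le> measure ?M Ev"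
    using rep cl Ev by (intro finite_measure_mono) blast+
  finally show ?thesis using L0_ge L1_bounds by (simp add: field_simps)
qed

text \<open>The cells of \<open>X\<close> cover \<open>G\<close>, so the probability of
  \<open>G\<close> forces \<open>X\<close> to meet many cells if no single cell is too likely.
  Nothing about the measurability of \<open>X\<close> is assumed.\<close>

lemma measure_cells_le:
  assumes X: "X \<subseteq> seqs" and V: "\<And>\<omega>. \<omega> \<in> seqs \<Longrightarrow> measure (\<nu> t) (cell_box N \<omega>) \<le> V"
    and G: "G \<in> sets (\<nu> t)" "G \<subseteq> seqs" "\<And>\<omega>. \<omega> \<in> G \<Longrightarrow> idx N \<omega> \<in> idx N ` X"
  shows "measure (\<nu> t) G \<le> real (card (idx N ` X)) * V"
proof -
  interpret prob_space "\<nu> t" by (rule prob_space_\<nu>)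
  have fin: "finite (idx N ` X)" using finite_idx X by (meson finite_subset image_mono)
  define rep where "rep c = (SOME \<omega>. \<omega> \<in> X \<and> idx N \<omega> = c)" for c
  have rep: "rep c \<in> X" "idx N (rep c) = c" if "c \<in> idx N ` X" for c
  proof -
    have "\<exists>\<omega>. \<omega> \<in> X \<and> idx N \<omega> = c" using that by (metis imageE)
    from someI_ex[OF this] show "rep c \<in> X" "idx N (rep c) = c" by (auto simp: rep_def)
  qed
  have "G \<subseteq> (\<Union>c\<in>idx N ` X. cell_box N (rep c))"
  proof
    fix \<omega> assume \<omega>: "\<omega> \<in> G"
    let ?c = "idx N \<omega>"
    have c: "?c \<in> idx N ` X" using G(3) \<omega> .
    have "\<omega> \<in> cyl (lev N) N (rep ?c)"
      using idx_eq_iff[of "rep ?c" \<omega> N] rep[OF c] X G(2) \<omega> by auto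
    thus "\<omega> \<in> (\<Union>c\<in>idx N ` X. cell_box N (rep c))" using c cyl_subset_cell_box by blast
  qed
  hence "measure (\<nu> t) G \<le> measure (\<nu> t) (\<Union>c\<in>idx N ` X. cell_box N (rep c))"
    using fin sets_cell_box by (intro finite_measure_mono sets.finite_UN)
  also have "\<dots> \<le> (\<Sum>c\<in>idx N ` X. measure (\<nu> t) (cell_box N (rep c)))"
    using fin sets_cell_box by (intro finite_measure_subadditive_finite) auto
  also have "\<dots> \<le> (\<Sum>c\<in>idx N ` X. V)" using V rep X by (intro sum_mono) blast
  finally show ?thesis by simp
qed

section \<open>Probability of constant runs\<close>

definition \<kappa> :: real where "\<kappa> = 1 - 1 / (real L0)\<^sup>2"

lemma \<kappa>_bounds: "0 < \<kappa>" "\<kappa> < 1"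
proof -
  have "1 < (real L0)\<^sup>2" using L0_ge by (intro one_less_power) auto
  thus "0 < \<kappa>" "\<kappa> < 1" using L0_ge by (auto simp: \<kappa>_def)
qed

lemma weight_ge: "d \<in> D \<Longrightarrow> 1 / (real L0)\<^sup>2 \<le> weight b d"
proof -
  assume d: "d \<in> D"
  have "real (row_count D (fst d)) * real L1 \<le> real L0 * real L0"
    using row_count_bounds(2)[of "fst d"] L1_bounds by (intro mult_mono) auto
  moreover have "real L0 \<le> real L0 * real L0" using L0_ge by (simp add: mult_le_cancel_left1)
  ultimately show ?thesis
    using row_count_bounds(1)[OF d] L1_bounds L0_ge
    by (auto simp: weight_def power2_eq_square intro!: divide_left_mono)
qed

text \<open>A digit that avoids the value \<open>c\<close> carries weight at least
  \<open>1 / L0\<^sup>2\<close> under both laws, and \<kappa> is 1 minus this bound. The lemma is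
  used for \<open>f = fst\<close> and \<open>f = snd\<close>.\<close>

lemma measure_digit_le:
  assumes "d \<in> D" "f d \<noteq> c"
  shows "measure (measure_pmf (digit_pmf b)) {d. f d = c} \<le> \<kappa>"
proof -
  have "measure (measure_pmf (digit_pmf b)) {d. f d = c} \<le> (\<Sum>d\<in>D - {d}. weight b d)"
    unfolding measure_digit using finD assms by (intro sum_mono2) (auto simp: weight_nonneg)
  also have "\<dots> = 1 - weight b d"
    using finD assms sum_weight[of b] by (simp add: sum_diff1)
  finally show ?thesis using weight_ge[OF assms(1), of b] by (simp add: \<kappa>_def)
qed

lemma measure_constant_run_le:
  assumes ne: "\<exists>d\<in>D. \<exists>d'\<in>D. f d \<noteq> f d'"
  shows "measure (\<nu> t) {\<omega>. \<exists>c<n. \<forall>k\<in>{a..<a + l}. f (\<omega> k) = c} \<le> real n * \<kappa> ^ l" (is ?le)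
    and "{\<omega>. \<exists>c<n. \<forall>k\<in>{a..<a + l}. f (\<omega> k) = c} \<in> sets (\<nu> t)" (is ?sets)
proof -
  interpret prob_space "\<nu> t" by (rule prob_space_\<nu>)
  have eq: "{\<omega>. \<exists>c<n. \<forall>k\<in>{a..<a + l}. f (\<omega> k) = c} =
      (\<Union>c<n. {\<omega>. \<forall>k\<in>{a..<a + l}. \<omega> k \<in> {d. f d = c}})" by auto
  have box: "{\<omega>. \<forall>k\<in>{a..<a + l}. \<omega> k \<in> {d. f d = c}} \<in> sets (\<nu> t)" for c
    unfolding \<nu>_def by (intro sets_seq_box) auto
  show ?sets unfolding eq using box by (intro sets.finite_UN) auto
  have "measure (\<nu> t) {\<omega>. \<forall>k\<in>{a..<a + l}. \<omega> k \<in> {d. f d = c}} \<le> \<kappa> ^ l" for c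
  proof -
    obtain d where d: "d \<in> D" "f d \<noteq> c" using ne by metis
    have "measure (\<nu> t) {\<omega>. \<forall>k\<in>{a..<a + l}. \<omega> k \<in> {d. f d = c}} =
        (\<Prod>k\<in>{a..<a + l}. measure (measure_pmf (digit_pmf (t k))) {d. f d = c})"
      unfolding \<nu>_def by (intro measure_seq_box) auto
    also have "\<dots> \<le> (\<Prod>k\<in>{a..<a + l}. \<kappa>)"
      using measure_digit_le[of d f c] d by (intro prod_mono) auto
    finally show ?thesis by simp
  qed
  hence "(\<Sum>c<n. measure (\<nu> t) {\<omega>. \<forall>k\<in>{a..<a + l}. \<omega> k \<in> {d. f d = c}}) \<le> (\<Sum>c<n. \<kappa> ^ l)"
    by (intro sum_mono)
  moreover have "measure (\<nu> t) (\<Union>c<n. {\<omega>. \<forall>k\<in>{a..<a + l}. \<omega> k \<in> {d. f d = c}}) \<le>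
      (\<Sum>c<n. measure (\<nu> t) {\<omega>. \<forall>k\<in>{a..<a + l}. \<omega> k \<in> {d. f d = c}})"
    using box by (intro finite_measure_subadditive_finite) auto
  ultimately show ?le unfolding eq by simp
qed

lemma measure_run_le: "measure (\<nu> t) {\<omega>. run N l \<omega>} \<le> 2 * real n * \<kappa> ^ l" (is ?le)
  and sets_run: "{\<omega>. run N l \<omega>} \<in> sets (\<nu> t)" (is ?sets)
proof -
  interpret prob_space "\<nu> t" by (rule prob_space_\<nu>)
  define R where "R f a = {\<omega>. (\<exists>d\<in>D. \<exists>d'\<in>D. f d \<noteq> f d') \<and> (\<exists>c<n. \<forall>k\<in>{a..<a + l}. f (\<omega> k) = c)}"
    for f :: "nat \<times> nat \<Rightarrow> nat" and a
  have R: "R f a \<in> sets (\<nu> t) \<and> measure (\<nu> t) (R f a) \<le> real n * \<kappa> ^ l" for f a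
  proof (cases "\<exists>d\<in>D. \<exists>d'\<in>D. f d \<noteq> f d'")
    case True
    hence "R f a = {\<omega>. \<exists>c<n. \<forall>k\<in>{a..<a + l}. f (\<omega> k) = c}" unfolding R_def by blast
    thus ?thesis using measure_constant_run_le[where t = t and a = a and l = l, OF True] by metis
  next
    case False
    hence "R f a = {}" unfolding R_def by blast
    thus ?thesis using \<kappa>_bounds by simp
  qed
  have eq: "{\<omega>. run N l \<omega>} = R fst N \<union> R snd (lev N)" unfolding has_run_def R_def by auto
  show ?sets unfolding eq using R by (intro sets.Un) auto
  have "measure (\<nu> t) (R fst N) \<le> real n * \<kappa> ^ l" using R by blast
  moreover have "measure (\<nu> t) (R snd (lev N)) \<le> real n * \<kappa> ^ l" using R by blast
  moreover have "measure (\<nu> t) (R fst N \<union> R snd (lev N)) \<le> measure (\<nu> t) (R fst N) + measure (\<nu> t) (R snd (lev N))"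
    using R by (intro measure_Un_le) auto
  ultimately show ?le unfolding eq by linarith
qed

end

section \<open>Dimension bounds by counting approximate squares\<close>

text \<open>The pigeonhole principle on the four parity classes costs a factor 4 and leaves cells to
  which \<open>cells_apart\<close> applies.\<close>

lemma parity_class:
  fixes I :: "(nat \<times> nat) set"
  assumes "finite I"
  shows "\<exists>J\<subseteq>I. card I \<le> 4 * card J \<and>
    (\<forall>c\<in>J. \<forall>c'\<in>J. even (fst c) = even (fst c') \<and> even (snd c) = even (snd c'))"
proof -
  define J where "J b = {c \<in> I. (even (fst c), even (snd c)) = b}" for b
  obtain b where b: "\<And>b'. card (J b') \<le> card (J b)"
  proof -
    have "Max (range (\<lambda>b. card (J b))) \<in> range (\<lambda>b. card (J b))" by (intro Max_in) auto
    then obtain b where "card (J b) = Max (range (\<lambda>b. card (J b)))" by (metis imageE)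
    thus ?thesis using that[of b] by simp
  qed
  have "card I \<le> card (\<Union>b\<in>UNIV. J b)"
    using assms by (intro card_mono) (auto simp: J_def)
  also have "\<dots> \<le> (\<Sum>b\<in>UNIV. card (J b))" by (intro card_UN_le) simp
  also have "\<dots> \<le> of_nat (card (UNIV :: (bool \<times> bool) set)) * card (J b)"
    by (rule sum_bounded_above) (rule b)
  also have "card (UNIV :: (bool \<times> bool) set) = 4" by (simp add: card_UNIV_bool)
  finally have "card I \<le> 4 * card (J b)" by simp
  thus ?thesis by (intro exI[of _ "J b"]) (auto simp: J_def)
qed

context bm_digit_set
begin

text \<open>McMullen's formula for the box dimension: the exponential growth rate of the number of
  approximate squares, relative to their size. \<open>packing_dim_all\<close> shows that it is also
  the packing dimension of the carpet.\<close>

definition dim\<^sub>0 :: real where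
  "dim\<^sub>0 = (\<sigma> * ln (real L0) + (1 - \<sigma>) * ln (real L1)) / ln (real m)"

lemma dim\<^sub>0_ln: "dim\<^sub>0 * ln (real m) = \<sigma> * ln (real L0) + (1 - \<sigma>) * ln (real L1)"
  using ln_mn by (simp add: dim\<^sub>0_def)

lemma dim\<^sub>0_pos: "0 < dim\<^sub>0"
  unfolding dim\<^sub>0_def using ln_mn sigma_bounds L0_ge L1_bounds
  by (intro divide_pos_pos add_pos_nonneg mult_pos_pos) auto

lemma cell_number_eq:
  "real L0 ^ lev N * real L1 ^ (N - lev N) = exp (real N * ln (real L1) + real (lev N) * (ln (real L0) - ln (real L1)))"
proof -
  have "real L0 ^ lev N * real L1 ^ (N - lev N) =
      exp (real (lev N) * ln (real L0)) * exp (real (N - lev N) * ln (real L1))"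
    using L0_ge L1_bounds by (simp add: exp_of_nat_mult)
  also have "\<dots> = exp (real N * ln (real L1) + real (lev N) * (ln (real L0) - ln (real L1)))"
    using lev_le[of N] by (simp add: of_nat_diff algebra_simps flip: exp_add)
  finally show ?thesis .
qed

lemma ln_L1_le_L0: "0 \<le> ln (real L1)" "ln (real L1) \<le> ln (real L0)"
  using L1_bounds by auto

text \<open>The ceiling in \<open>lev\<close> can exchange at most one row for a full digit, which
  costs a factor of at most \<open>L0\<close>.\<close>

lemma cell_number_le: "real L0 ^ lev N * real L1 ^ (N - lev N) \<le> real L0 * exp (real N * (dim\<^sub>0 * ln (real m)))"
proof -
  have "real (lev N) * (ln (real L0) - ln (real L1)) \<le> (\<sigma> * real N + 1) * (ln (real L0) - ln (real L1))"
    using lev_bounds[of N] ln_L1_le_L0 by (intro mult_right_mono) auto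
  hence "real N * ln (real L1) + real (lev N) * (ln (real L0) - ln (real L1)) \<le>
      ln (real L0) + real N * (dim\<^sub>0 * ln (real m))"
    unfolding dim\<^sub>0_ln using ln_L1_le_L0 by (simp add: algebra_simps)
  hence "real L0 ^ lev N * real L1 ^ (N - lev N) \<le> exp (ln (real L0) + real N * (dim\<^sub>0 * ln (real m)))"
    unfolding cell_number_eq by simp
  thus ?thesis using L0_ge by (simp add: exp_add)
qed

lemma cell_number_ge: "exp (real N * (dim\<^sub>0 * ln (real m))) \<le> real L0 ^ lev N * real L1 ^ (N - lev N)"
proof -
  have "\<sigma> * real N * (ln (real L0) - ln (real L1)) \<le> real (lev N) * (ln (real L0) - ln (real L1))"
    using lev_bounds[of N] ln_L1_le_L0 by (intro mult_right_mono) auto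
  thus ?thesis unfolding cell_number_eq dim\<^sub>0_ln by (simp add: algebra_simps)
qed

text \<open>Each piece has upper box dimension at most \<open>d\<close>. The constants
  \<open>C\<close> and \<open>N0\<close> may depend on the piece, since packing measure allows
  countable covers. The passage to \<open>d + \<epsilon>\<close> makes the ratio in
  \<open>packing_premeasure_eq_0\<close> strictly less than 1.\<close>

lemma packing_dim_coding_le:
  assumes E: "E \<subseteq> (\<Union>k::nat. cod ` Y k)" and Y: "\<And>k. Y k \<subseteq> seqs" and d: "0 \<le> d"
    and count: "\<And>k. \<exists>C N0. \<forall>N\<ge>N0. real (card (idx N ` Y k)) \<le> C * exp (real N * (d * ln (real m)))"
  shows "packing_dim E \<le> ereal d"
proof (rule ereal_le_epsilon2)
  fix \<epsilon> :: real assume \<epsilon>: "0 < \<epsilon>"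
  define s where "s = d + \<epsilon>"
  have "packing_premeasure s (cod ` Y k) = 0" for k
  proof -
    obtain C N0 where C: "\<And>N. N \<ge> N0 \<Longrightarrow> real (card (idx N ` Y k)) \<le> C * exp (real N * (d * ln (real m)))"
      using count[of k] by blast
    show ?thesis
    proof (rule packing_premeasure_eq_0[where b = "real m" and c = 2 and C = "max C 0"
          and \<theta> = "exp (d * ln (real m))" and ?N0.0 = N0])
      have "exp (d * ln (real m)) * real m powr (- s) = exp (- \<epsilon> * ln (real m))"
        using m2 by (simp add: powr_def s_def algebra_simps flip: exp_add)
      also have "\<dots> < 1" using \<epsilon> ln_mn by simp
      finally show "exp (d * ln (real m)) * real m powr (- s) < 1" .
      fix N assume N: "N0 \<le> N"
      define P where "P = (\<lambda>c. cod ` {\<omega> \<in> Y k. idx N \<omega> = c}) ` (idx N ` Y k)"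
      have fin: "finite (idx N ` Y k)" using finite_idx Y by (meson finite_subset image_mono)
      have "real (card P) \<le> real (card (idx N ` Y k))" unfolding P_def using card_image_le[OF fin] by simp
      also have "\<dots> \<le> C * exp (real N * (d * ln (real m)))" by (rule C[OF N])
      also have "\<dots> \<le> max C 0 * exp (d * ln (real m)) ^ N"
        by (simp add: exp_of_nat_mult[symmetric] mult_right_mono)
      finally have card: "real (card P) \<le> max C 0 * exp (d * ln (real m)) ^ N" .
      have diam: "dist x y \<le> 2 / real m ^ N" if U: "U \<in> P" "x \<in> U" "y \<in> U" for U x y
      proof -
        obtain \<omega> \<tau> where w: "\<omega> \<in> Y k" "\<tau> \<in> Y k" "idx N \<tau> = idx N \<omega>" "x = cod \<omega>" "y = cod \<tau>"
          using U by (auto simp: P_def)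
        have "\<omega> \<in> seqs" "\<tau> \<in> seqs" using w Y by auto
        thus ?thesis using w idx_eq_iff cyl_dist_le by blast
      qed
      show "\<exists>P. finite P \<and> cod ` Y k \<subseteq> \<Union>P \<and> real (card P) \<le> max C 0 * exp (d * ln (real m)) ^ N \<and>
          (\<forall>U\<in>P. \<forall>x\<in>U. \<forall>y\<in>U. dist x y \<le> 2 / real m ^ N)"
      proof (intro exI[of _ P] conjI ballI)
        show "finite P" using fin by (simp add: P_def)
        show "cod ` Y k \<subseteq> \<Union>P" unfolding P_def by blast
      qed (use card diam in auto)
    qed (use m2 d \<epsilon> in \<open>auto simp: s_def\<close>)
  qed
  hence "packing_measure s E = 0" using E by (intro packing_measure_eq_0I)
  hence "packing_dim E \<le> ereal s" using d \<epsilon> by (intro packing_dim_le) (auto simp: s_def)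
  thus "packing_dim E \<le> ereal d + ereal \<epsilon>" by (simp add: s_def)
qed

lemma packing_dim_all_le: "packing_dim (cod ` seqs) \<le> ereal dim\<^sub>0"
proof (rule packing_dim_coding_le[where Y = "\<lambda>_. seqs"])
  fix k :: nat
  have "real (card (idx N ` seqs)) \<le> real L0 * exp (real N * (dim\<^sub>0 * ln (real m)))" for N
  proof -
    interpret prob_space "\<nu> (\<lambda>k. k < lev N)" by (rule prob_space_\<nu>)
    have "real (card (idx N ` seqs)) \<le> real L0 ^ lev N * real L1 ^ (N - lev N) * measure (\<nu> (\<lambda>k. k < lev N)) UNIV"
      using sets.top[of "\<nu> (\<lambda>k. k < lev N)"] by (intro card_cells_le) auto
    also have "\<dots> \<le> real L0 * exp (real N * (dim\<^sub>0 * ln (real m)))"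
      using cell_number_le[of N] prob_space by simp
    finally show ?thesis .
  qed
  thus "\<exists>C N0. \<forall>N\<ge>N0. real (card (idx N ` seqs)) \<le> C * exp (real N * (dim\<^sub>0 * ln (real m)))" by blast
qed (use dim\<^sub>0_pos in auto)

text \<open>The digits between \<open>lev N\<close> and \<open>N\<close> have uniform rows for every \<open>N = j!\<close>, and all others are
  uniform. Since \<open>(j - 1)!\<close> is negligible with respect to \<open>j!\<close>, at the levels \<open>j!\<close> the random
  sequence is as spread out as possible.\<close>

definition block_type :: "nat \<Rightarrow> bool" where
  "block_type k \<longleftrightarrow> \<not> (\<exists>j. lev (fact j) \<le> k \<and> k < fact j)"

lemma block_type_True: "fact i \<le> k \<Longrightarrow> k < lev (fact (Suc i)) \<Longrightarrow> block_type k"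
  unfolding block_type_def
proof
  assume k: "fact i \<le> k" "k < lev (fact (Suc i))" "\<exists>j. lev (fact j) \<le> k \<and> k < fact j"
  then obtain j where j: "lev (fact j) \<le> k" "k < fact j" by blast
  show False
  proof (cases "j \<le> i")
    case True
    hence "fact j \<le> (fact i :: nat)" by (rule fact_mono_nat)
    thus False using j k by linarith
  next
    case False
    hence "fact (Suc i) \<le> (fact j :: nat)" by (intro fact_mono_nat) simp
    hence "lev (fact (Suc i)) \<le> lev (fact j)" by (rule lev_mono)
    thus False using j k by linarith
  qed
qed

text \<open>At level \<open>(i + 1)!\<close> the positions from \<open>i!\<close> to
  \<open>lev\<close> carry uniform digits and the later ones uniform rows, just as in the optimal
  law for this level. The first \<open>i!\<close> factors are bounded by 1, written as
  \<open>L0 * (1 / L0)\<close>; this loses \<open>L0 ^ i!\<close>, which is negligible against the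
  main term because \<open>(i + 1)!\<close> is \<open>i + 1\<close> times \<open>i!\<close>.\<close>

lemma measure_block_cell_le:
  assumes "\<omega> \<in> seqs"
  shows "measure (\<nu> block_type) (cell_box (fact (Suc i)) \<omega>) \<le>
    exp (fact i * ln (real L0) - fact (Suc i) * (dim\<^sub>0 * ln (real m)))"
proof -
  define N :: nat where "N = fact (Suc i)"
  have L: "real L0 \<ge> 1" "real L1 \<ge> 1" using L0_ge L1_bounds by auto
  have "measure (\<nu> block_type) (cell_box N \<omega>) \<le>
      (\<Prod>k<N. if k < lev N then (if k < fact i then 1 else 1 / real L0) else 1 / real L1)"
    unfolding measure_cell_box[OF assms]
  proof (intro prod_mono conjI)
    fix k assume k: "k \<in> {..<N}"
    have w1: "weight b (\<omega> k) \<le> 1" for b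
    proof -
      have "weight b (\<omega> k) \<le> (\<Sum>d\<in>D. weight b d)"
        using seqsD[OF assms] finD by (intro member_le_sum) (auto simp: weight_nonneg)
      thus ?thesis by (simp add: sum_weight)
    qed
    show "(if k < lev N then weight (block_type k) (\<omega> k)
          else if block_type k then real (row_count D (fst (\<omega> k))) / real L0 else 1 / real L1)
        \<le> (if k < lev N then (if k < fact i then 1 else 1 / real L0) else 1 / real L1)"
    proof (cases "k < lev N")
      case True
      thus ?thesis using w1 block_type_True[of i k] by (auto simp: weight_def N_def)
    next
      case False
      hence "\<not> block_type k" using k by (auto simp: block_type_def N_def intro!: exI[of _ "Suc i"])
      thus ?thesis using False by simp
    qed
  qed (auto simp: weight_nonneg)
  also have "\<dots> \<le> (\<Prod>k<N. (if k < fact i then real L0 else 1) * (if k < lev N then 1 / real L0 else 1 / real L1))"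
    using L by (intro prod_mono) (auto simp: field_simps)
  also have "\<dots> = (\<Prod>k<N. if k < fact i then real L0 else 1) *
      (\<Prod>k<N. if k < lev N then 1 / real L0 else 1 / real L1)" by (rule prod.distrib)
  also have "(\<Prod>k<N. if k < lev N then 1 / real L0 else 1 / real L1) =
      1 / (real L0 ^ lev N * real L1 ^ (N - lev N))"
  proof -
    have "{..<N} \<inter> {k. k < lev N} = {..<lev N}" "{..<N} \<inter> - {k. k < lev N} = {lev N..<N}"
      using lev_le[of N] by auto
    thus ?thesis by (subst prod.If_cases) (simp_all add: power_divide)
  qed
  also have "(\<Prod>k<N. if k < fact i then real L0 else 1) = real L0 ^ fact i"
  proof -
    have "fact i \<le> N" unfolding N_def by (intro fact_mono_nat) simp
    hence "{..<N} \<inter> {k. k < fact i} = {..<fact i}" by auto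
    thus ?thesis by (subst prod.If_cases) simp_all
  qed
  also have "real L0 ^ fact i = exp (fact i * ln (real L0))"
    using L by (metis exp_ln exp_of_nat_mult less_le_trans of_nat_fact zero_less_one)
  also have "exp (fact i * ln (real L0)) * (1 / (real L0 ^ lev N * real L1 ^ (N - lev N))) \<le>
      exp (fact i * ln (real L0)) * (1 / exp (real N * (dim\<^sub>0 * ln (real m))))"
    using cell_number_ge[of N] L by (intro mult_left_mono divide_left_mono mult_pos_pos) auto
  also have "\<dots> = exp (fact i * ln (real L0) - fact (Suc i) * (dim\<^sub>0 * ln (real m)))"
    by (simp add: N_def exp_diff algebra_simps)
  finally show ?thesis by (simp only: N_def)
qed

text \<open>With \<open>a = (dim\<^sub>0 - s) * ln m\<close> and a radius comparable to
  \<open>1 / m ^ (i + 1)!\<close>, the packing sum is at least a constant times the exponential of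
  \<open>i! * ((i + 1) * a - ln L0)\<close>, which is unbounded.\<close>

lemma packing_premeasure_coding_eq_top:
  assumes X: "X \<subseteq> seqs" "cod ` X \<subseteq> A" and s: "0 \<le> s" "s < dim\<^sub>0" and c: "0 < c"
    and card: "\<And>i. c \<le> real (card (idx (fact (Suc i)) ` X)) *
      exp (fact i * ln (real L0) - fact (Suc i) * (dim\<^sub>0 * ln (real m)))"
  shows "packing_premeasure s A = \<top>"
proof (rule packing_premeasure_eq_top)
  fix \<delta> C :: real assume \<delta>: "0 < \<delta>"
  define a where "a = (dim\<^sub>0 - s) * ln (real m)"
  have a: "0 < a" using s ln_mn by (simp add: a_def)
  define c' where "c' = c / 4 * (2 * real n) powr (- s)"
  have c': "0 < c'" using c n2 by (simp add: c'_def)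
  \<comment> \<open>The three lower bounds for \<open>i\<close> give, in this order, a packing sum
    of at least \<open>C\<close>, a radius of at most \<delta>, and an exponent of at least
    \<open>i!\<close>.\<close>
  obtain i where i: "max (max (C / c') (1 / \<delta>)) ((1 + ln (real L0)) / a) < real i"
    using reals_Archimedean2 by blast
  define N :: nat where "N = fact (Suc i)"
  \<comment> \<open>Then \<open>2 * r\<close> is half of the separation
    \<open>1 / (n * m ^ N)\<close> from \<open>cells_apart\<close>, hence strictly below it.\<close>
  define r where "r = 1 / (4 * real n * real m ^ N)"
  have mN: "0 < real m ^ N" using m2 by simp
  have iN: "i \<le> N" unfolding N_def using fact_ge_self[of "Suc i"] by linarith
  have r: "0 < r" using n2 mN by (simp add: r_def)
  have r\<delta>: "r \<le> \<delta>"
  proof -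
    have "real i \<le> real m ^ N"
    proof -
      have "N < m ^ N" using m2 by (intro power_gt_expt) simp
      hence "real i < real (m ^ N)" using iN by linarith
      thus ?thesis by simp
    qed
    hence "1 / \<delta> \<le> real m ^ N" using i by linarith
    hence "1 / real m ^ N \<le> \<delta>" using \<delta> mN by (simp add: field_simps)
    moreover have "r \<le> 1 / real m ^ N"
    proof -
      have "real m ^ N \<le> 4 * real n * real m ^ N" 
        using mult_right_mono[of 1 "4 * real n" "real m ^ N"] n2 mN by simp
      thus ?thesis unfolding r_def using mN n2 by (intro divide_left_mono) auto
    qed
    ultimately show ?thesis by linarith
  qed
  have fin: "finite (idx N ` X)" using finite_idx X(1) by (meson finite_subset image_mono)
  from parity_class[OF fin] obtain J where J: "J \<subseteq> idx N ` X" "card (idx N ` X) \<le> 4 * card J"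
    "\<And>c c'. c \<in> J \<Longrightarrow> c' \<in> J \<Longrightarrow> even (fst c) = even (fst c') \<and> even (snd c) = even (snd c')" by blast
  have finJ: "finite J" using J(1) fin finite_subset by blast
  define rep where "rep c = (SOME \<omega>. \<omega> \<in> X \<and> idx N \<omega> = c)" for c
  have rep: "rep c \<in> X" "idx N (rep c) = c" if "c \<in> J" for c
  proof -
    have "\<exists>\<omega>. \<omega> \<in> X \<and> idx N \<omega> = c" using that J(1) by (metis imageE subsetD)
    from someI_ex[OF this] show "rep c \<in> X" "idx N (rep c) = c" by (auto simp: rep_def)
  qed
  have apart: "2 * r < dist (cod (rep c)) (cod (rep c'))" if "c \<in> J" "c' \<in> J" "c \<noteq> c'" for c c'
  proof -
    have "1 / (real n * real m ^ N) \<le> dist (cod (rep c)) (cod (rep c'))"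
      using rep[OF that(1)] rep[OF that(2)] J(3)[OF that(1,2)] that(3) X(1) by (intro cells_apart) auto
    moreover have "2 * r < 1 / (real n * real m ^ N)" using n2 mN by (simp add: r_def field_simps)
    ultimately show ?thesis by linarith
  qed
  define P where "P = (\<lambda>c. cod (rep c)) ` J"
  have "inj_on (\<lambda>c. cod (rep c)) J"
  proof (rule inj_onI, rule ccontr)
    fix c c' assume "c \<in> J" "c' \<in> J" "cod (rep c) = cod (rep c')" "c \<noteq> c'"
    thus False using apart[of c c'] r by simp
  qed
  hence cardP: "card P = card J" unfolding P_def by (rule card_image)
  have "C \<le> c' * real i"
    using i c' by (simp add: field_simps)
  also have "\<dots> \<le> c' * exp (fact i * (real (Suc i) * a - ln (real L0)))"
  proof (intro mult_left_mono)
    have "1 + ln (real L0) \<le> real i * a" using i a by (simp add: field_simps)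
    also have "\<dots> \<le> real (Suc i) * a" using a by (intro mult_right_mono) auto
    finally have "1 \<le> real (Suc i) * a - ln (real L0)" by simp
    hence "fact i * 1 \<le> fact i * (real (Suc i) * a - ln (real L0))" by (intro mult_left_mono) auto
    moreover have "real i \<le> fact i" using fact_ge_self[of i] by (metis of_nat_fact of_nat_le_iff)
    ultimately have "real i \<le> fact i * (real (Suc i) * a - ln (real L0))" by linarith
    also have "\<dots> \<le> exp (fact i * (real (Suc i) * a - ln (real L0)))"
      using exp_ge_add_one_self[of "fact i * (real (Suc i) * a - ln (real L0))"] by linarith
    finally show "real i \<le> exp (fact i * (real (Suc i) * a - ln (real L0)))" .
  qed (use c' in simp)
  also have "\<dots> = c / 4 * exp (real N * (dim\<^sub>0 * ln (real m)) - fact i * ln (real L0)) * (2 * r) powr s"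
  proof -
    have "(2 * r) powr s = (2 * real n * real m ^ N) powr (- s)"
      using n2 mN by (simp add: r_def powr_minus powr_divide field_simps)
    also have "\<dots> = (2 * real n) powr (- s) * (real m ^ N) powr (- s)"
      using n2 mN by (simp add: powr_mult)
    also have "(real m ^ N) powr (- s) = exp (- s * real N * ln (real m))"
      using m2 by (simp add: powr_def ln_realpow)
    finally have e1: "(2 * r) powr s = (2 * real n) powr (- s) * exp (- s * real N * ln (real m))" .
    have e2: "fact i * (real (Suc i) * a - ln (real L0)) =
        real N * (dim\<^sub>0 * ln (real m)) - fact i * ln (real L0) + (- s * real N * ln (real m))"
      unfolding N_def a_def by (simp add: algebra_simps)
    show ?thesis unfolding e1 e2 c'_def exp_add by simp
  qed
  also have "\<dots> \<le> real (card P) * (2 * r) powr s"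
  proof (intro mult_right_mono)
    have "c \<le> real (card (idx N ` X)) * exp (fact i * ln (real L0) - real N * (dim\<^sub>0 * ln (real m)))"
      using card[of i] unfolding N_def of_nat_fact .
    also have "\<dots> \<le> 4 * real (card P) * exp (fact i * ln (real L0) - real N * (dim\<^sub>0 * ln (real m)))"
      using J(2) cardP by (intro mult_right_mono) auto
    finally show "c / 4 * exp (real N * (dim\<^sub>0 * ln (real m)) - fact i * ln (real L0)) \<le> real (card P)"
      by (simp add: exp_diff field_simps)
  qed simp
  finally have "C \<le> real (card P) * (2 * r) powr s" .
  moreover have "\<forall>x\<in>P. \<forall>y\<in>P. x \<noteq> y \<longrightarrow> 2 * r < dist x y"
  proof (intro ballI impI)
    fix x y assume "x \<in> P" "y \<in> P" "x \<noteq> y"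
    then obtain c c' where "c \<in> J" "x = cod (rep c)" "c' \<in> J" "y = cod (rep c')"
      unfolding P_def by (elim imageE) blast
    thus "2 * r < dist x y" using apart[of c c'] \<open>x \<noteq> y\<close> by blast
  qed
  moreover have "finite P" using finJ by (simp add: P_def)
  moreover have "P \<subseteq> A" unfolding P_def using rep(1) X(2) by blast
  ultimately show "\<exists>P r. finite P \<and> P \<subseteq> A \<and> 0 < r \<and> r \<le> \<delta> \<and>
      (\<forall>x\<in>P. \<forall>y\<in>P. x \<noteq> y \<longrightarrow> 2 * r < dist x y) \<and> C \<le> real (card P) * (2 * r) powr s"
    using r r\<delta> by blast
qed

lemma measurable_idx [measurable]: "idx N \<in> measurable (\<nu> t) (count_space UNIV)"
proof -
  have pv: "(\<lambda>\<omega>. prefix_value b (\<lambda>k. f (\<omega> k)) K) \<in> measurable (\<nu> t) (count_space UNIV)" for b f K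
  proof (induction K)
    case (Suc K)
    have "(\<lambda>\<omega>. b * x + f (\<omega> K)) \<in> measurable (\<nu> t) (count_space UNIV)" for x
      unfolding \<nu>_def by (rule measurable_seq_coordinate_compose)
    from measurable_compose_countable[OF this Suc] show ?case by simp
  qed simp
  have "(\<lambda>\<omega>. (x, prefix_value m (\<lambda>k. fst (\<omega> k)) N)) \<in> measurable (\<nu> t) (count_space UNIV)" for x :: nat
    by (rule measurable_compose[OF pv]) simp
  from measurable_compose_countable[OF this pv[of n snd "lev N"]] show ?thesis
    unfolding cell_index_def[abs_def] .
qed

lemma sets_seqs: "seqs \<in> sets (\<nu> t)"
  using sets_seq_box[of UNIV "\<lambda>_. D"] by (simp add: digit_seqs_def \<nu>_def)

text \<open>The covering sets \<open>A k\<close> are arbitrary, so the set \<open>X k\<close> of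
  sequences coded into \<open>A k\<close> may fail to be measurable. It is enlarged to the
  measurable set \<open>G k\<close> of sequences that share a cell with \<open>X k\<close> at every
  level \<open>(i + 1)!\<close>. These sets cover almost every sequence, so some \<open>G k\<close>
  has positive probability, and by \<open>measure_cells_le\<close> the corresponding
  \<open>X k\<close> meets as many cells as needed at all these levels simultaneously.\<close>

lemma packing_dim_ge:
  assumes "AE \<omega> in \<nu> block_type. cod \<omega> \<in> E"
  shows "ereal dim\<^sub>0 \<le> packing_dim E"
proof (rule packing_dim_geI, rule packing_measure_neq_0I)
  fix s and A :: "nat \<Rightarrow> (real \<times> real) set"
  assume s: "0 \<le> s" "s < dim\<^sub>0" and A: "E \<subseteq> (\<Union>k. A k)"
  interpret prob_space "\<nu> block_type" by (rule prob_space_\<nu>)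
  define X where "X k = {\<omega> \<in> seqs. cod \<omega> \<in> A k}" for k
  define G where "G k = {\<omega> \<in> seqs. \<forall>i. idx (fact (Suc i)) \<omega> \<in> idx (fact (Suc i)) ` X k}" for k
  have meas: "G k \<in> sets (\<nu> block_type)" for k
  proof -
    have v: "idx N -` I \<in> sets (\<nu> block_type)" for N I
      using measurable_sets[OF measurable_idx, of I] by simp
    have "G k = seqs \<inter> (\<Inter>i. idx (fact (Suc i)) -` (idx (fact (Suc i)) ` X k))"
      by (auto simp: G_def)
    also have "\<dots> \<in> sets (\<nu> block_type)"
      using sets.top[of "\<nu> block_type"] by (intro sets.Int sets_seqs sets.countable_INT'' v) simp_all
    finally show ?thesis .
  qed
  have "\<exists>k. measure (\<nu> block_type) (G k) \<noteq> 0"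
  proof (rule ccontr)
    assume "\<not> ?thesis"
    hence "AE \<omega> in \<nu> block_type. \<omega> \<notin> G k" for k using meas by (simp add: prob_eq_0)
    hence "AE \<omega> in \<nu> block_type. \<forall>k. \<omega> \<notin> G k" by (simp add: AE_all_countable)
    hence "AE \<omega> in \<nu> block_type. False"
      using AE_seqs assms
    proof eventually_elim
      case (elim \<omega>)
      then obtain k where "cod \<omega> \<in> A k" using A by blast
      hence "\<omega> \<in> X k" using elim by (simp add: X_def)
      hence "\<omega> \<in> G k" using elim by (auto simp: G_def)
      thus False using elim by blast
    qed
    thus False by simp
  qed
  then obtain k where k: "measure (\<nu> block_type) (G k) \<noteq> 0" by blast
  have "packing_premeasure s (A k) = \<top>"
  proof (rule packing_premeasure_coding_eq_top[OF _ _ s])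
    show "0 < measure (\<nu> block_type) (G k)" using k by (simp add: zero_less_measure_iff)
    show "measure (\<nu> block_type) (G k) \<le> real (card (idx (fact (Suc i)) ` X k)) *
        exp (fact i * ln (real L0) - fact (Suc i) * (dim\<^sub>0 * ln (real m)))" for i
    proof (rule measure_cells_le[OF _ measure_block_cell_le meas])
      show "X k \<subseteq> seqs" "G k \<subseteq> seqs" by (auto simp: X_def G_def)
      show "idx (fact (Suc i)) \<omega> \<in> idx (fact (Suc i)) ` X k" if "\<omega> \<in> G k" for \<omega>
        using that unfolding G_def by blast
    qed
  qed (auto simp: X_def)
  thus "\<exists>k. packing_premeasure s (A k) = \<top>" by blast
qed

lemma packing_dim_all: "packing_dim (cod ` seqs) = ereal dim\<^sub>0"
proof (rule antisym[OF packing_dim_all_le packing_dim_ge])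
  show "AE \<omega> in \<nu> block_type. cod \<omega> \<in> cod ` seqs" using AE_seqs by eventually_elim auto
qed

end

section \<open>Large deviations and the dimension drop\<close>

context bernoulli_carpet
begin

text \<open>Expectations of \<open>ln p\<close> and, below, of \<open>ln q\<close> for one random
  digit. With \<open>b\<close> ranging over both laws they are the four sums of the theorem.\<close>

definition mean_p :: "bool \<Rightarrow> real" where "mean_p b = (\<Sum>d\<in>D. weight b d * ln (p d))"
definition mean_q :: "bool \<Rightarrow> real" where "mean_q b = (\<Sum>d\<in>D. weight b d * ln (q (fst d)))"

definition mean_S :: "(nat \<Rightarrow> bool) \<Rightarrow> nat \<Rightarrow> real" where
  "mean_S t N = (\<Sum>k<N. if k < lev N then mean_p (t k) else mean_q (t k))"

lemma mean_q_eq: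
  "mean_q b = (\<Sum>i\<in>occupied_rows D. (if b then real (row_count D i) / real (card D)
     else 1 / real (card (occupied_rows D))) * ln (q i))"
proof -
  have "(\<Sum>d | d \<in> D \<and> fst d = i. weight b d * ln (q (fst d))) =
      (\<Sum>d | d \<in> D \<and> fst d = i. weight b d) * ln (q i)" for i
    by (simp add: sum_distrib_right)
  thus ?thesis
    unfolding mean_q_def sum_digits_by_row
    by (intro sum.cong) (auto simp: sum_weight_row L0_def L1_def)
qed

lemma mean_p_eq:
  "mean_p b = (\<Sum>(i, j)\<in>D. 1 / (if b then real (card D)
     else real (row_count D i) * real (card (occupied_rows D))) * ln (p (i, j)))"
  unfolding mean_p_def by (intro sum.cong) (auto simp: weight_def L0_def L1_def)

lemma mean_S_eq:
  assumes "\<And>k. k < lev N \<Longrightarrow> mean_p (t k) = B" "\<And>k. lev N \<le> k \<Longrightarrow> k < N \<Longrightarrow> mean_q (t k) = A"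
  shows "mean_S t N = real (lev N) * B + (real N - real (lev N)) * A"
proof -
  have "mean_S t N = (\<Sum>k<N. if k < lev N then B else A)"
    unfolding mean_S_def by (intro sum.cong) (auto simp: assms)
  also have "\<dots> = (\<Sum>k\<in>{..<lev N}. B) + (\<Sum>k\<in>{lev N..<N}. A)"
  proof -
    have "{..<N} \<inter> {k. k < lev N} = {..<lev N}" "{..<N} \<inter> - {k. k < lev N} = {lev N..<N}"
      using lev_le[of N] by auto
    thus ?thesis by (subst sum.If_cases) simp_all
  qed
  also have "\<dots> = real (lev N) * B + (real N - real (lev N)) * A"
    using lev_le[of N] by (simp add: of_nat_diff)
  finally show ?thesis .
qed

lemma mean_S_approx:
  assumes "\<And>k. k < lev N \<Longrightarrow> mean_p (t k) = B" "\<And>k. lev N \<le> k \<Longrightarrow> k < N \<Longrightarrow> mean_q (t k) = A"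
  shows "\<bar>mean_S t N - real N * (\<sigma> * B + (1 - \<sigma>) * A)\<bar> \<le> \<bar>B - A\<bar>"
proof -
  have "mean_S t N - real N * (\<sigma> * B + (1 - \<sigma>) * A) = (real (lev N) - \<sigma> * real N) * (B - A)"
  proof -
    have "mean_S t N = real (lev N) * B + (real N - real (lev N)) * A"
      by (rule mean_S_eq) (use assms in auto)
    thus ?thesis by (simp add: algebra_simps)
  qed
  moreover have "\<bar>real (lev N) - \<sigma> * real N\<bar> \<le> 1" using lev_bounds[of N] by linarith
  ultimately show ?thesis
    by (simp add: abs_mult mult_left_le_one_le)
qed

lemma sets_S_event: "{\<omega>. P (S N \<omega>)} \<in> sets (\<nu> t)" if "Measurable.pred borel P"
proof -
  have "S N \<in> borel_measurable (\<nu> t)"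
    unfolding S_def[abs_def] \<nu>_def by measurable
  hence "Measurable.pred (\<nu> t) (\<lambda>\<omega>. P (S N \<omega>))"
    by (rule measurable_compose) (rule that)
  thus ?thesis by (simp add: pred_def)
qed

lemma S_large_deviation:
  assumes "0 < N" "0 \<le> \<eta>"
  shows "measure (\<nu> t) {\<omega>. \<eta> * real N \<le> \<bar>S N \<omega> - mean_S t N\<bar>} \<le>
    2 * exp (- (\<eta>\<^sup>2 / (2 * weight_bound\<^sup>2)) * real N)"
proof -
  have mean: "mean_S t N = (\<Sum>k<N. measure_pmf.expectation (digit_pmf (t k)) (\<psi> N k))"
    unfolding mean_S_def expectation_digit
    by (intro sum.cong) (auto simp: log_weight_def mean_p_def mean_q_def)
  have "measure (\<nu> t) {\<omega>. \<eta> * real N \<le> \<bar>S N \<omega> - mean_S t N\<bar>} \<le>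
      2 * exp (- (\<eta> * real N)\<^sup>2 / (2 * weight_bound\<^sup>2 * real N))"
    unfolding \<nu>_def S_def mean
  proof (rule seq_measure_concentration[OF assms(1) weight_bound_pos])
    show "\<bar>\<psi> N k d\<bar> \<le> weight_bound" if "d \<in> set_pmf (digit_pmf (t k))" for k d
      using that abs_log_weight_le set_pmf_digit by blast
  qed (use assms in simp)
  also have "- (\<eta> * real N)\<^sup>2 / (2 * weight_bound\<^sup>2 * real N) = - (\<eta>\<^sup>2 / (2 * weight_bound\<^sup>2)) * real N"
    using assms weight_bound_pos by (simp add: power2_eq_square field_simps)
  finally show ?thesis .
qed

text \<open>A point with local dimension \<open>\<alpha>\<close>, real or symbolic, satisfies this condition for all large \<open>J\<close>,
  and it only involves the approximate square of level \<open>J\<close>.\<close>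

definition bad_event :: "real \<Rightarrow> real \<Rightarrow> real \<Rightarrow> nat \<Rightarrow> (nat \<Rightarrow> nat \<times> nat) \<Rightarrow> bool" where
  "bad_event \<alpha> \<delta> \<epsilon> J \<omega> \<longleftrightarrow>
     run (J - n * (nat \<lfloor>\<delta> * real J\<rfloor> + 3)) (nat \<lfloor>\<delta> * real J\<rfloor>) \<omega> \<or>
     \<bar>S J \<omega> + \<alpha> * (real J * ln (real m))\<bar> \<le> \<epsilon> * real J"

text \<open>A factor \<open>n\<close> in the radius of a ball is worth at most \<open>n\<close>
  levels. This crude conversion determines the shift in \<open>bad_event\<close>.\<close>

lemma n_le_m_power: "real n ^ k \<le> real m ^ (n * k)"
proof -
  have "n \<le> 2 ^ n" using less_exp[of n] by simp
  also have "\<dots> \<le> m ^ n" using m2 by (intro power_mono) auto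
  finally have "n ^ k \<le> m ^ (n * k)" by (simp add: power_mult power_mono)
  thus ?thesis by (metis of_nat_le_iff of_nat_power)
qed

lemma sigma_n_ge_1: "1 \<le> \<sigma> * real n"
proof -
  have "ln (real n) \<le> ln (real m ^ n)"
    using n_le_m_power[of 1] n2 by (subst ln_le_cancel_iff) (use m2 in auto)
  hence "ln (real n) \<le> real n * ln (real m)" using m2 by (simp add: ln_realpow)
  thus ?thesis using ln_mn by (simp add: bm_sigma_def field_simps)
qed

lemma eventually_shift_le:
  assumes "0 < \<delta>" "\<delta> * real n \<le> 1 / 2"
  shows "\<forall>\<^sub>F J in sequentially. n * (nat \<lfloor>\<delta> * real J\<rfloor> + 3) \<le> J"
  using eventually_ge_at_top[of "6 * n"]
proof eventually_elim
  case (elim J)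
  have "real (nat \<lfloor>\<delta> * real J\<rfloor>) \<le> \<delta> * real J" using assms by simp
  hence "real (n * (nat \<lfloor>\<delta> * real J\<rfloor> + 3)) \<le> real n * (\<delta> * real J + 3)"
    by (simp add: mult_left_mono)
  also have "\<dots> = (\<delta> * real n) * real J + 3 * real n" by (simp add: algebra_simps)
  also have "\<dots> \<le> 1 / 2 * real J + 3 * real n" using assms by (intro add_right_mono mult_right_mono) auto
  also have "\<dots> \<le> real J"
  proof -
    have "real (6 * n) \<le> real J" using elim by (simp only: of_nat_le_iff)
    thus ?thesis by simp
  qed
  finally show ?case by (simp only: of_nat_le_iff)
qed

text \<open>With \<open>N = J - n * (l + 3)\<close>, the radius \<open>r J\<close> is the one
  allowed by \<open>measure_cball_le\<close> at level \<open>N\<close>. By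
  \<open>n_le_m_power\<close> the ball also contains the square of level \<open>J\<close>; the third
  factor \<open>n\<close> absorbs the 2 in \<open>cyl_dist_le\<close>. So without a run the
  logarithm of the measure of the ball lies between \<open>S J\<close> and \<open>S N\<close>, and
  these differ by a multiple of the shift, which is proportional to \<delta> up to a
  constant.\<close>

lemma eventually_bad_event_real:
  assumes \<omega>: "\<omega> \<in> seqs" and dim: "has_local_dim \<mu> (cod \<omega>) \<alpha>" and \<epsilon>: "0 < \<epsilon>"
    and \<delta>: "0 < \<delta>" "\<delta> * real n \<le> 1 / 2"
      "real n * (3 * weight_bound + \<bar>\<alpha>\<bar> * ln (real m)) * \<delta> \<le> \<epsilon> / 3"
  shows "\<forall>\<^sub>F J in sequentially. bad_event \<alpha> \<delta> \<epsilon> J \<omega>"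
proof -
  define Z where "Z = real n * (3 * weight_bound + \<bar>\<alpha>\<bar> * ln (real m))"
  define l where "l J = nat \<lfloor>\<delta> * real J\<rfloor>" for J :: nat
  define N where "N J = J - n * (l J + 3)" for J
  define r where "r J = 1 / (real m ^ N J * real n ^ (l J + 2))" for J
  define \<epsilon>' where "\<epsilon>' = \<epsilon> / (3 * ln (real m))"
  have \<epsilon>': "0 < \<epsilon>'" using \<epsilon> ln_mn by (simp add: \<epsilon>'_def)
  have l_le: "real (l J) \<le> \<delta> * real J" for J using \<delta> by (simp add: l_def)
  have l_ge: "\<delta> * real J < real (l J) + 1" for J using \<delta> unfolding l_def by linarith
  have rpos: "0 < r J" for J using m2 n2 by (simp add: r_def)
  have "filterlim r (at_right 0) sequentially"
  proof (rule tendsto_imp_filterlim_at_right)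
    show "r \<longlonglongrightarrow> 0"
    proof (rule tendsto_sandwich[of "\<lambda>_. 0" _ _ "\<lambda>J. 1 / \<delta> * (1 / real J)"])
      show "(\<lambda>J. 1 / \<delta> * (1 / real J)) \<longlonglongrightarrow> 0"
        by (intro tendsto_mult_right_zero lim_1_over_n)
      show "\<forall>\<^sub>F J in sequentially. r J \<le> 1 / \<delta> * (1 / real J)"
        using eventually_gt_at_top[of 0]
      proof eventually_elim
        case (elim J)
        have "l J + 2 < n ^ (l J + 2)" using n2 by (intro power_gt_expt) simp
        hence "real (l J + 2) < real (n ^ (l J + 2))" by (simp only: of_nat_less_iff)
        hence "\<delta> * real J \<le> real n ^ (l J + 2)" using l_ge[of J] by simp
        also have "\<dots> \<le> real m ^ N J * real n ^ (l J + 2)"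
          using mult_right_mono[of 1 "real m ^ N J" "real n ^ (l J + 2)"] m2 by simp
        finally have "r J \<le> 1 / (\<delta> * real J)"
          unfolding r_def using elim \<delta> m2 n2 by (intro divide_left_mono mult_pos_pos) auto
        thus ?case by simp
      qed
    qed (use rpos in \<open>auto simp: less_imp_le\<close>)
  qed (use rpos in auto)
  with dim have lim: "(\<lambda>J. ln (measure \<mu> (cball (cod \<omega>) (r J))) / ln (r J)) \<longlonglongrightarrow> \<alpha>"
    unfolding has_local_dim_def by (rule filterlim_compose)
  hence ev: "\<forall>\<^sub>F J in sequentially. dist (ln (measure \<mu> (cball (cod \<omega>) (r J))) / ln (r J)) \<alpha> < \<epsilon>'"
    using \<epsilon>' by (rule tendstoD)
  \<comment> \<open>The budget \<open>\<epsilon> * J\<close> is divided into thirds: the error of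
    the limit, the part of the shift proportional to \<delta>, and the constant part
    \<open>3 * Z\<close>, which is at most \<open>\<epsilon> / 3 * J\<close> from here on.\<close>
  have Jlarge: "\<forall>\<^sub>F J in sequentially. 9 * Z / \<epsilon> \<le> real J"
    using filterlim_real_sequentially by (simp add: filterlim_at_top)
  show ?thesis
    using ev Jlarge eventually_shift_le[OF \<delta>(1,2)] eventually_gt_at_top[of 0]
  proof eventually_elim
    case (elim J)
    have J: "J = N J + n * (l J + 3)" using elim(3) by (simp add: N_def l_def)
    show ?case
    proof (cases "run (N J) (l J) \<omega>")
      case True
      thus ?thesis by (simp add: bad_event_def N_def l_def)
    next
      case False
      define y where "y = ln (measure \<mu> (cball (cod \<omega>) (r J)))"
      have r2: "2 / real m ^ J \<le> r J"
      proof -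
        have "2 * (real m ^ N J * real n ^ (l J + 2)) \<le> real m ^ N J * real n ^ (l J + 3)"
          using mult_right_mono[of 2 "real n" "real m ^ N J * real n ^ (l J + 2)"] n2
          by (simp add: eval_nat_numeral mult_ac)
        also have "\<dots> \<le> real m ^ N J * real m ^ (n * (l J + 3))"
          by (intro mult_left_mono n_le_m_power) simp
        also have "\<dots> = real m ^ J" by (subst (3) J) (simp add: power_add)
        finally show ?thesis unfolding r_def using m2 n2 by (simp add: field_simps)
      qed
      have y1: "S J \<omega> \<le> y"
        unfolding y_def using measure_cball_ge[OF \<omega> r2] by (metis exp_gt_zero less_le_trans ln_exp ln_mono)
      have y2: "y \<le> S (N J) \<omega>"
      proof -
        have "0 < measure \<mu> (cball (cod \<omega>) (r J))"
          using measure_cball_ge[OF \<omega> r2] by (rule less_le_trans[OF exp_gt_zero])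
        moreover have "measure \<mu> (cball (cod \<omega>) (r J)) \<le> exp (S (N J) \<omega>)"
          using measure_cball_le[OF \<omega> False] by (simp add: r_def)
        ultimately show ?thesis unfolding y_def by (metis ln_exp ln_mono)
      qed
      have "\<bar>S J \<omega> - S (N J) \<omega>\<bar> \<le> 3 * weight_bound * real (n * (l J + 3))"
        using S_diff_le[OF \<omega>, of "N J" "n * (l J + 3)"] J by simp
      hence 1: "\<bar>S J \<omega> - y\<bar> \<le> 3 * weight_bound * real (n * (l J + 3))" using y1 y2 by linarith
      have lnr: "ln (r J) = - (real (N J) * ln (real m) + real (l J + 2) * ln (real n))"
        using m2 n2 by (simp add: r_def ln_div ln_mult ln_realpow algebra_simps)
      have "0 \<le> real (N J) * ln (real m)" "0 < real (l J + 2) * ln (real n)" using ln_mn by simp_all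
      hence lnr_neg: "ln (r J) < 0" unfolding lnr by linarith
      have lnr2: "- (real J * ln (real m)) \<le> ln (r J)"
      proof -
        have "1 / real m ^ J \<le> r J" using r2 m2 by (intro order.trans[OF _ r2] divide_right_mono) auto
        hence "ln (1 / real m ^ J) \<le> ln (r J)" using m2 by (intro ln_mono) auto
        thus ?thesis using m2 by (simp add: ln_div ln_realpow)
      qed
      have "\<bar>y / ln (r J) - \<alpha>\<bar> < \<epsilon>'" using elim(1) by (simp add: y_def dist_real_def)
      hence "\<bar>y / ln (r J) - \<alpha>\<bar> * \<bar>ln (r J)\<bar> \<le> \<epsilon>' * \<bar>ln (r J)\<bar>" by (intro mult_right_mono) auto
      moreover have "\<bar>y / ln (r J) - \<alpha>\<bar> * \<bar>ln (r J)\<bar> = \<bar>y - \<alpha> * ln (r J)\<bar>"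
      proof -
        have "(y / ln (r J) - \<alpha>) * ln (r J) = y - \<alpha> * ln (r J)"
          using lnr_neg by (simp add: left_diff_distrib)
        thus ?thesis by (simp only: abs_mult[symmetric])
      qed
      moreover have "\<epsilon>' * \<bar>ln (r J)\<bar> \<le> \<epsilon>' * (real J * ln (real m))"
        using lnr2 lnr_neg \<epsilon>' by (intro mult_left_mono) auto
      moreover have "\<epsilon>' * (real J * ln (real m)) = \<epsilon> / 3 * real J"
        using ln_mn by (simp add: \<epsilon>'_def)
      ultimately have 2: "\<bar>y - \<alpha> * ln (r J)\<bar> \<le> \<epsilon> / 3 * real J" by linarith
      have "\<bar>ln (r J) + real J * ln (real m)\<bar> \<le> real (n * (l J + 3)) * ln (real m)"
      proof -
        have "real J = real (N J) + real (n * (l J + 3))" by (subst J) (simp only: of_nat_add)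
        hence "real J * ln (real m) = real (N J) * ln (real m) + real (n * (l J + 3)) * ln (real m)"
          by (simp only: distrib_right)
        moreover have "0 \<le> real (l J + 2) * ln (real n)" using ln_mn by simp
        ultimately show ?thesis using lnr2 unfolding lnr by linarith
      qed
      hence "\<bar>\<alpha>\<bar> * \<bar>ln (r J) + real J * ln (real m)\<bar> \<le> \<bar>\<alpha>\<bar> * (real (n * (l J + 3)) * ln (real m))"
        by (intro mult_left_mono) auto
      moreover have "\<bar>\<alpha> * ln (r J) + \<alpha> * (real J * ln (real m))\<bar> = \<bar>\<alpha>\<bar> * \<bar>ln (r J) + real J * ln (real m)\<bar>"
        by (simp add: abs_mult[symmetric] distrib_left)
      ultimately have 3: "\<bar>\<alpha> * ln (r J) + \<alpha> * (real J * ln (real m))\<bar> \<le>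
          \<bar>\<alpha>\<bar> * (real (n * (l J + 3)) * ln (real m))" by linarith
      have "\<bar>S J \<omega> + \<alpha> * (real J * ln (real m))\<bar> \<le> \<epsilon> / 3 * real J +
          (3 * weight_bound * real (n * (l J + 3)) + \<bar>\<alpha>\<bar> * (real (n * (l J + 3)) * ln (real m)))"
        using 1 2 3 by linarith
      also have "3 * weight_bound * real (n * (l J + 3)) + \<bar>\<alpha>\<bar> * (real (n * (l J + 3)) * ln (real m)) =
          Z * (real (l J) + 3)" by (simp add: Z_def algebra_simps)
      also have "\<epsilon> / 3 * real J + Z * (real (l J) + 3) \<le> \<epsilon> / 3 * real J + Z * (\<delta> * real J + 3)"
        using l_le[of J] weight_bound_pos ln_mn by (intro add_left_mono mult_left_mono) (auto simp: Z_def)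
      also have "\<dots> = \<epsilon> / 3 * real J + (Z * \<delta>) * real J + 3 * Z" by (simp add: algebra_simps)
      also have "\<dots> \<le> \<epsilon> / 3 * real J + \<epsilon> / 3 * real J + \<epsilon> / 3 * real J"
      proof (intro add_mono order_refl)
        show "(Z * \<delta>) * real J \<le> \<epsilon> / 3 * real J" using \<delta>(3) by (intro mult_right_mono) (auto simp: Z_def)
        show "3 * Z \<le> \<epsilon> / 3 * real J" using elim(2) \<epsilon> by (simp add: field_simps)
      qed
      finally show ?thesis by (simp add: bad_event_def)
    qed
  qed
qed

lemma eventually_bad_event_symb:
  assumes "\<omega> \<in> seqs" "has_symb_local_dim m n D \<Lambda> \<mu> \<omega> \<alpha>" "0 < \<epsilon>"
  shows "\<forall>\<^sub>F J in sequentially. bad_event \<alpha> \<delta> \<epsilon> J \<omega>"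
proof -
  have lim: "(\<lambda>N. S N \<omega> / (- real N * ln (real m))) \<longlonglongrightarrow> \<alpha>"
    using assms(2) unfolding has_symb_local_dim_iff[OF assms(1)] .
  have "\<forall>\<^sub>F N in sequentially. dist (S N \<omega> / (- real N * ln (real m))) \<alpha> < \<epsilon> / ln (real m)"
    using assms ln_mn by (intro tendstoD[OF lim]) auto
  thus ?thesis using eventually_gt_at_top[of 0]
  proof eventually_elim
    case (elim J)
    have pos: "0 < real J * ln (real m)" using elim(2) ln_mn by simp
    have "S J \<omega> + \<alpha> * (real J * ln (real m)) =
        - (real J * ln (real m)) * (S J \<omega> / (- real J * ln (real m)) - \<alpha>)"
      using elim(2) ln_mn by (simp add: field_simps)
    hence "\<bar>S J \<omega> + \<alpha> * (real J * ln (real m))\<bar> =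
        real J * ln (real m) * \<bar>S J \<omega> / (- real J * ln (real m)) - \<alpha>\<bar>"
      using ln_mn by (simp only: abs_mult abs_minus_cancel abs_of_nat abs_of_pos)
    also have "\<dots> \<le> real J * ln (real m) * (\<epsilon> / ln (real m))"
      using elim(1) pos by (intro mult_left_mono) (auto simp: dist_real_def)
    also have "\<dots> = \<epsilon> * real J" using ln_mn by simp
    finally show ?case by (simp add: bad_event_def)
  qed
qed

section \<open>Bad events are unions of cells and exponentially unlikely\<close>

lemma sets_bad_event: "{\<omega>. bad_event \<alpha> \<delta> \<epsilon> J \<omega>} \<in> sets (\<nu> t)"
proof -
  have "{\<omega>. \<bar>S J \<omega> + \<alpha> * (real J * ln (real m))\<bar> \<le> \<epsilon> * real J} \<in> sets (\<nu> t)"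
    by (rule sets_S_event) measurable
  thus ?thesis using sets.Un[OF sets_run] by (simp add: bad_event_def Collect_disj_eq)
qed

text \<open>This is why the run is sought at a level below \<open>J\<close>. The shift moves the
  window of rows before \<open>J\<close>, and since \<open>1 \<le> \<sigma> * n\<close> it also
  moves the window of columns before \<open>lev J\<close>, so a cell of any level
  \<open>K \<ge> J\<close> decides the event.\<close>

lemma bad_event_cell:
  assumes J: "J \<le> K" and sh: "n * (nat \<lfloor>\<delta> * real J\<rfloor> + 3) \<le> J"
    and bad: "bad_event \<alpha> \<delta> \<epsilon> J \<omega>" and \<tau>: "\<tau> \<in> cell_box K \<omega>"
  shows "bad_event \<alpha> \<delta> \<epsilon> J \<tau>"
proof -
  define l where "l = nat \<lfloor>\<delta> * real J\<rfloor>"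
  define N where "N = J - n * (l + 3)"
  have mem: "\<tau> k \<in> (if k < lev K then {\<omega> k} else {d \<in> D. fst d = fst (\<omega> k)})" if "k < K" for k
    using \<tau> that unfolding cell_box_def by blast
  have f: "fst (\<tau> k) = fst (\<omega> k)" if "k < J" for k
    using mem[of k] that J by (simp split: if_splits)
  have levJ: "lev J \<le> lev K" using J by (rule lev_mono)
  have e: "\<tau> k = \<omega> k" if "k < lev J" for k
    using mem[of k] that levJ lev_le[of J] J by simp
  have "S J \<tau> = S J \<omega>" unfolding S_def log_weight_def
    using e f by (intro sum.cong) auto
  moreover have "run N l \<tau> = run N l \<omega>"
  proof -
    have Nl: "J = N + n * (l + 3)" using sh by (simp add: N_def l_def)
    have "l \<le> 1 * (l + 3)" by simp
    also have "\<dots> \<le> n * (l + 3)" using n2 by (intro mult_le_mono1) simp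
    finally have "l \<le> n * (l + 3)" .
    hence 1: "N + l \<le> J" using Nl by linarith
    have "real l \<le> \<sigma> * real (n * (l + 3))"
    proof -
      have "real l * 1 \<le> real (l + 3) * (\<sigma> * real n)"
        using sigma_n_ge_1 by (intro mult_mono) auto
      thus ?thesis by (simp add: algebra_simps)
    qed
    hence 2: "lev N + l \<le> lev J" using lev_add_ge[of l "n * (l + 3)" N] Nl by simp
    have "(\<forall>k\<in>{N..<N + l}. fst (\<tau> k) = c) \<longleftrightarrow> (\<forall>k\<in>{N..<N + l}. fst (\<omega> k) = c)" for c
      using f 1 by (intro ball_cong) auto
    moreover have "(\<forall>k\<in>{lev N..<lev N + l}. snd (\<tau> k) = c) \<longleftrightarrow>
        (\<forall>k\<in>{lev N..<lev N + l}. snd (\<omega> k) = c)" for c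
      using e 2 by (intro ball_cong) auto
    ultimately show ?thesis unfolding has_run_def by simp
  qed
  ultimately show ?thesis using bad unfolding bad_event_def N_def l_def by simp
qed

text \<open>Of the gap \<open>4 * \<epsilon>\<close>, one \<epsilon> is lost to the tolerance in
  \<open>bad_event\<close> and one to the rounding in \<open>mean_S_approx\<close>; a deviation of
  \<open>2 * \<epsilon> * J\<close> from the mean remains, and Hoeffding's inequality applies. The
  factor \<open>1 / \<kappa>\<close> comes from the floor in the run length.\<close>

lemma measure_bad_event_le:
  assumes \<delta>: "0 < \<delta>" and \<epsilon>: "0 < \<epsilon>" and gap: "4 * \<epsilon> \<le> \<bar>\<sigma> * B + (1 - \<sigma>) * A + \<alpha> * ln (real m)\<bar>"
    and J: "0 < J" "\<bar>B - A\<bar> \<le> \<epsilon> * real J"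
    and t: "\<And>k. k < lev J \<Longrightarrow> mean_p (t k) = B" "\<And>k. lev J \<le> k \<Longrightarrow> k < J \<Longrightarrow> mean_q (t k) = A"
  shows "measure (\<nu> t) {\<omega>. bad_event \<alpha> \<delta> \<epsilon> J \<omega>} \<le>
    2 * real n / \<kappa> * exp (- (- \<delta> * ln \<kappa>) * real J) +
    2 * exp (- ((2 * \<epsilon>)\<^sup>2 / (2 * weight_bound\<^sup>2)) * real J)"
proof -
  interpret \<nu>: prob_space "\<nu> t" by (rule prob_space_\<nu>)
  define l where "l = nat \<lfloor>\<delta> * real J\<rfloor>"
  define N where "N = J - n * (l + 3)"
  have approx: "\<bar>mean_S t J - real J * (\<sigma> * B + (1 - \<sigma>) * A)\<bar> \<le> \<bar>B - A\<bar>"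
    by (rule mean_S_approx) (use t in auto)
  have sub: "{\<omega>. bad_event \<alpha> \<delta> \<epsilon> J \<omega>} \<subseteq> {\<omega>. run N l \<omega>} \<union> {\<omega>. 2 * \<epsilon> * real J \<le> \<bar>S J \<omega> - mean_S t J\<bar>}"
  proof
    fix \<omega> assume "\<omega> \<in> {\<omega>. bad_event \<alpha> \<delta> \<epsilon> J \<omega>}"
    hence "run N l \<omega> \<or> \<bar>S J \<omega> + \<alpha> * (real J * ln (real m))\<bar> \<le> \<epsilon> * real J"
      by (simp add: bad_event_def N_def l_def)
    moreover have "2 * \<epsilon> * real J \<le> \<bar>S J \<omega> - mean_S t J\<bar>"
      if "\<bar>S J \<omega> + \<alpha> * (real J * ln (real m))\<bar> \<le> \<epsilon> * real J"
    proof -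
      have "4 * \<epsilon> * real J \<le> \<bar>\<sigma> * B + (1 - \<sigma>) * A + \<alpha> * ln (real m)\<bar> * real J"
        using gap by (intro mult_right_mono) auto
      also have "\<dots> = \<bar>real J * (\<sigma> * B + (1 - \<sigma>) * A) + \<alpha> * (real J * ln (real m))\<bar>"
      proof -
        have "real J * (\<sigma> * B + (1 - \<sigma>) * A) + \<alpha> * (real J * ln (real m)) =
            (\<sigma> * B + (1 - \<sigma>) * A + \<alpha> * ln (real m)) * real J" by (simp add: algebra_simps)
        thus ?thesis by (simp only: abs_mult abs_of_nat)
      qed
      finally show ?thesis using that J(2) approx by linarith
    qed
    ultimately show "\<omega> \<in> {\<omega>. run N l \<omega>} \<union> {\<omega>. 2 * \<epsilon> * real J \<le> \<bar>S J \<omega> - mean_S t J\<bar>}" by blast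
  qed
  have meas: "{\<omega>. 2 * \<epsilon> * real J \<le> \<bar>S J \<omega> - mean_S t J\<bar>} \<in> sets (\<nu> t)"
    by (rule sets_S_event) measurable
  have "measure (\<nu> t) {\<omega>. bad_event \<alpha> \<delta> \<epsilon> J \<omega>} \<le>
      measure (\<nu> t) ({\<omega>. run N l \<omega>} \<union> {\<omega>. 2 * \<epsilon> * real J \<le> \<bar>S J \<omega> - mean_S t J\<bar>})"
    using sub meas sets_run by (intro \<nu>.finite_measure_mono) auto
  also have "\<dots> \<le> measure (\<nu> t) {\<omega>. run N l \<omega>} + measure (\<nu> t) {\<omega>. 2 * \<epsilon> * real J \<le> \<bar>S J \<omega> - mean_S t J\<bar>}"
    using sets_run meas by (rule measure_Un_le)
  also have "\<dots> \<le> 2 * real n * \<kappa> ^ l + 2 * exp (- ((2 * \<epsilon>)\<^sup>2 / (2 * weight_bound\<^sup>2)) * real J)"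
    using \<epsilon> J by (intro add_mono measure_run_le S_large_deviation) auto
  also have "\<kappa> ^ l \<le> exp (- (- \<delta> * ln \<kappa>) * real J) / \<kappa>"
  proof -
    have "\<delta> * real J - 1 \<le> real l" using \<delta> unfolding l_def by linarith
    hence "real l * ln \<kappa> \<le> (\<delta> * real J - 1) * ln \<kappa>"
      using \<kappa>_bounds by (intro mult_right_mono_neg) auto
    hence "exp (real l * ln \<kappa>) \<le> exp (\<delta> * real J * ln \<kappa> - ln \<kappa>)" by (simp add: algebra_simps)
    also have "\<dots> = exp (- (- \<delta> * ln \<kappa>) * real J) / \<kappa>"
      using \<kappa>_bounds by (simp add: exp_diff mult_ac)
    finally show ?thesis using \<kappa>_bounds by (simp add: exp_of_nat_mult)
  qed
  finally show ?thesis by (simp add: mult_left_mono)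
qed

text \<open>The \<open>mean_q\<close> in force between \<open>lev J\<close> and \<open>J\<close> is \<open>mean_q False\<close> at the finest
  level \<open>J = K\<close>, but \<open>mean_q True\<close> at the coarser level \<open>J = lev K\<close>. A given \<open>\<alpha>\<close> is incompatible with
  at least one of the two.\<close>

lemma packing_dim_level_sets_less:
  assumes ne: "mean_q True \<noteq> mean_q False"
  shows "packing_dim (symb_level_set m n D \<Lambda> \<mu> \<alpha>) < packing_dim \<Lambda>"
    and "packing_dim (level_set \<Lambda> \<mu> \<alpha>) < packing_dim \<Lambda>"
proof -
  define x where "x b = \<sigma> * mean_p True + (1 - \<sigma>) * mean_q b" for b
  have "x True \<noteq> x False" using ne sigma_bounds by (simp add: x_def)
  then obtain b where b: "x b + \<alpha> * ln (real m) \<noteq> 0" by (metis add_right_cancel)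
  define \<epsilon> where "\<epsilon> = \<bar>x b + \<alpha> * ln (real m)\<bar> / 4"
  have \<epsilon>: "0 < \<epsilon>" using b by (simp add: \<epsilon>_def)
  define Z where "Z = real n * (3 * weight_bound + \<bar>\<alpha>\<bar> * ln (real m))"
  have Z: "0 < Z" using n2 weight_bound_pos ln_mn unfolding Z_def
    by (intro mult_pos_pos add_pos_nonneg) auto
  \<comment> \<open>The first bound keeps the shift below \<open>J\<close>, the second makes its
    effect on \<open>S\<close> at most a third of the tolerance.\<close>
  define \<delta> where "\<delta> = min (1 / (2 * real n)) (\<epsilon> / (3 * Z))"
  have \<delta>: "0 < \<delta>" "\<delta> * real n \<le> 1 / 2" "Z * \<delta> \<le> \<epsilon> / 3"
  proof -
    show "0 < \<delta>" using n2 \<epsilon> Z by (simp add: \<delta>_def)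
    have "\<delta> * real n \<le> 1 / (2 * real n) * real n" by (intro mult_right_mono) (auto simp: \<delta>_def)
    thus "\<delta> * real n \<le> 1 / 2" using n2 by simp
    have "Z * \<delta> \<le> Z * (\<epsilon> / (3 * Z))" using Z by (intro mult_left_mono) (auto simp: \<delta>_def)
    thus "Z * \<delta> \<le> \<epsilon> / 3" using Z by simp
  qed
  \<comment> \<open>Fixing the level from which the condition holds gives countably many pieces, on
    each of which the count is valid at all large levels.\<close>
  define Y where "Y j = {\<omega> \<in> seqs. \<forall>J\<ge>j. bad_event \<alpha> \<delta> \<epsilon> J \<omega>}" for j :: nat
  define J where "J K = (if b then lev K else K)" for K
  \<comment> \<open>The factor \<sigma> converts decay in \<open>J K\<close> into decay in
    \<open>K\<close>, as \<open>J K\<close> is at least \<open>\<sigma> * K\<close>.\<close>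
  define c where "c = \<sigma> * min (- \<delta> * ln \<kappa>) ((2 * \<epsilon>)\<^sup>2 / (2 * weight_bound\<^sup>2))"
  have c: "0 < c" unfolding c_def using sigma_bounds \<delta> \<kappa>_bounds \<epsilon> weight_bound_pos
    by (intro mult_pos_pos) (auto simp: mult_less_0_iff)
  define C where "C = real L0 * (2 * real n / \<kappa> + 2)"
  define d where "d = max 0 (dim\<^sub>0 - c / ln (real m))"
  have d: "0 \<le> d" "d < dim\<^sub>0" using dim\<^sub>0_pos c ln_mn by (auto simp: d_def)
  have J_bounds: "J K \<le> K" "\<sigma> * real K \<le> real (J K)" for K
  proof -
    have "\<sigma> * real K \<le> 1 * real K" using sigma_bounds by (intro mult_right_mono) auto
    thus "J K \<le> K" "\<sigma> * real K \<le> real (J K)" using lev_le[of K] lev_bounds[of K] by (auto simp: J_def)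
  qed
  have "filterlim (\<lambda>K. real (J K)) at_top sequentially"
  proof (rule filterlim_at_top_mono)
    show "filterlim (\<lambda>K. \<sigma> * real K) at_top sequentially"
      using sigma_bounds by (intro filterlim_tendsto_pos_mult_at_top[OF tendsto_const] filterlim_real_sequentially)
  qed (use J_bounds in auto)
  hence J_lim: "filterlim J sequentially sequentially"
    by (simp add: filterlim_sequentially_iff_filterlim_real)
  have count: "\<exists>C N0. \<forall>K\<ge>N0. real (card (idx K ` Y j)) \<le> C * exp (real K * (d * ln (real m)))" for j
  proof -
    have "\<forall>\<^sub>F K in sequentially. j \<le> J K \<and> 0 < J K \<and> n * (nat \<lfloor>\<delta> * real (J K)\<rfloor> + 3) \<le> J K"
    proof (intro eventually_conj)
      have ge: "\<forall>\<^sub>F K in sequentially. i \<le> J K" for i using J_lim by (simp add: filterlim_at_top)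
      show "\<forall>\<^sub>F K in sequentially. j \<le> J K" by (rule ge)
      show "\<forall>\<^sub>F K in sequentially. 0 < J K" using ge[of 1] by eventually_elim simp
      show "\<forall>\<^sub>F K in sequentially. n * (nat \<lfloor>\<delta> * real (J K)\<rfloor> + 3) \<le> J K"
        using eventually_compose_filterlim[OF eventually_shift_le[OF \<delta>(1,2)] J_lim] .
    qed
    moreover have "\<forall>\<^sub>F K in sequentially. \<bar>mean_p True - mean_q b\<bar> / \<epsilon> \<le> real (J K)"
      using \<open>filterlim (\<lambda>K. real (J K)) at_top sequentially\<close> by (simp add: filterlim_at_top)
    ultimately have "\<forall>\<^sub>F K in sequentially. real (card (idx K ` Y j)) \<le> C * exp (real K * (d * ln (real m)))"
    proof eventually_elim
      case (elim K)
      let ?t = "\<lambda>k. k < lev K"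
      let ?Ev = "{\<omega>. bad_event \<alpha> \<delta> \<epsilon> (J K) \<omega>}"
      have "measure (\<nu> ?t) ?Ev \<le>
          2 * real n / \<kappa> * exp (- (- \<delta> * ln \<kappa>) * real (J K)) +
          2 * exp (- ((2 * \<epsilon>)\<^sup>2 / (2 * weight_bound\<^sup>2)) * real (J K))"
      proof (rule measure_bad_event_le[where B = "mean_p True" and A = "mean_q b"])
        show "4 * \<epsilon> \<le> \<bar>\<sigma> * mean_p True + (1 - \<sigma>) * mean_q b + \<alpha> * ln (real m)\<bar>"
          by (simp add: \<epsilon>_def x_def)
        show "\<bar>mean_p True - mean_q b\<bar> \<le> \<epsilon> * real (J K)" using elim \<epsilon> by (simp add: field_simps)
        show "mean_p (k < lev K) = mean_p True" if "k < lev (J K)" for k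
          using that lev_mono[OF J_bounds(1), of K] by simp
        show "mean_q (k < lev K) = mean_q b" if "lev (J K) \<le> k" "k < J K" for k
          using that by (cases b) (auto simp: J_def)
      qed (use \<delta> \<epsilon> elim in auto)
      also have "\<dots> \<le> 2 * real n / \<kappa> * exp (- c * real K) + 2 * exp (- c * real K)"
      proof -
        have cK: "c * real K \<le> y * real (J K)"
          if "min (- \<delta> * ln \<kappa>) ((2 * \<epsilon>)\<^sup>2 / (2 * weight_bound\<^sup>2)) \<le> y" "0 \<le> y" for y
        proof -
          have "c * real K = min (- \<delta> * ln \<kappa>) ((2 * \<epsilon>)\<^sup>2 / (2 * weight_bound\<^sup>2)) * (\<sigma> * real K)"
            by (simp add: c_def)
          also have "\<dots> \<le> y * real (J K)"
            using that J_bounds(2)[of K] sigma_bounds by (intro mult_mono) auto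
          finally show ?thesis .
        qed
        have "0 \<le> - \<delta> * ln \<kappa>" using \<delta> \<kappa>_bounds by (simp add: mult_le_0_iff)
        hence "c * real K \<le> (- \<delta> * ln \<kappa>) * real (J K)" by (intro cK) auto
        moreover have "c * real K \<le> ((2 * \<epsilon>)\<^sup>2 / (2 * weight_bound\<^sup>2)) * real (J K)" by (intro cK) auto
        ultimately show ?thesis using \<kappa>_bounds by (intro add_mono mult_left_mono) auto
      qed
      also have "\<dots> = (2 * real n / \<kappa> + 2) * exp (- c * real K)" by (simp add: distrib_right)
      finally have P: "measure (\<nu> ?t) ?Ev \<le> (2 * real n / \<kappa> + 2) * exp (- c * real K)" .
      have "real (card (idx K ` Y j)) \<le> real L0 ^ lev K * real L1 ^ (K - lev K) * measure (\<nu> ?t) ?Ev"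
      proof (rule card_cells_le[OF _ sets_bad_event])
        show "cell_box K \<omega> \<subseteq> ?Ev" if "\<omega> \<in> Y j" for \<omega>
        proof -
          have "bad_event \<alpha> \<delta> \<epsilon> (J K) \<omega>" using that elim by (simp add: Y_def)
          thus ?thesis using bad_event_cell[OF J_bounds(1)] elim by blast
        qed
      qed (auto simp: Y_def)
      also have "\<dots> \<le> (real L0 * exp (real K * (dim\<^sub>0 * ln (real m)))) * ((2 * real n / \<kappa> + 2) * exp (- c * real K))"
        by (rule mult_mono[OF cell_number_le P]) auto
      also have "\<dots> = C * exp (real K * (dim\<^sub>0 * ln (real m)) + - c * real K)"
        unfolding C_def exp_add by simp
      also have "\<dots> \<le> C * exp (real K * (d * ln (real m)))"
      proof -
        have "(dim\<^sub>0 - c / ln (real m)) * ln (real m) \<le> d * ln (real m)"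
          using ln_mn by (intro mult_right_mono) (auto simp: d_def)
        hence "dim\<^sub>0 * ln (real m) - c \<le> d * ln (real m)" using ln_mn by (simp add: left_diff_distrib)
        hence "real K * (dim\<^sub>0 * ln (real m) - c) \<le> real K * (d * ln (real m))"
          by (intro mult_left_mono) auto
        thus ?thesis using \<kappa>_bounds by (intro mult_left_mono) (auto simp: C_def algebra_simps)
      qed
      finally show ?case .
    qed
    thus ?thesis unfolding eventually_sequentially by blast
  qed
  have main: "packing_dim E < packing_dim \<Lambda>" if E: "E \<subseteq> (\<Union>j. cod ` Y j)" for E
  proof -
    have "packing_dim E \<le> ereal d"
      by (rule packing_dim_coding_le[OF E _ d(1) count]) (auto simp: Y_def)
    also have "\<dots> < packing_dim \<Lambda>" using d(2) by (simp add: \<Lambda>_eq packing_dim_all)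
    finally show ?thesis .
  qed
  have in_Y: "cod \<omega> \<in> (\<Union>j. cod ` Y j)"
    if w: "\<omega> \<in> seqs" "\<forall>\<^sub>F J in sequentially. bad_event \<alpha> \<delta> \<epsilon> J \<omega>" for \<omega>
  proof -
    obtain j where "\<forall>J\<ge>j. bad_event \<alpha> \<delta> \<epsilon> J \<omega>" using w(2) unfolding eventually_sequentially by blast
    hence "\<omega> \<in> Y j" using w(1) by (simp add: Y_def)
    thus ?thesis by blast
  qed
  show "packing_dim (symb_level_set m n D \<Lambda> \<mu> \<alpha>) < packing_dim \<Lambda>"
  proof (rule main, rule subsetI)
    fix z assume "z \<in> symb_level_set m n D \<Lambda> \<mu> \<alpha>"
    then obtain \<omega> where w: "\<omega> \<in> seqs" "z = cod \<omega>" "has_symb_local_dim m n D \<Lambda> \<mu> \<omega> \<alpha>"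
      unfolding symb_level_set_def is_expansion_iff by blast
    show "z \<in> (\<Union>j. cod ` Y j)"
      unfolding w(2) by (rule in_Y[OF w(1) eventually_bad_event_symb[OF w(1,3) \<epsilon>]])
  qed
  show "packing_dim (level_set \<Lambda> \<mu> \<alpha>) < packing_dim \<Lambda>"
  proof (rule main, rule subsetI)
    fix z assume "z \<in> level_set \<Lambda> \<mu> \<alpha>"
    then obtain \<omega> where w: "\<omega> \<in> seqs" "z = cod \<omega>" "has_local_dim \<mu> (cod \<omega>) \<alpha>"
      unfolding level_set_def \<Lambda>_eq by blast
    show "z \<in> (\<Union>j. cod ` Y j)"
      unfolding w(2)
      by (rule in_Y[OF w(1) eventually_bad_event_real[OF w(1,3) \<epsilon> \<delta>(1,2) \<delta>(3)[unfolded Z_def]]])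
  qed
qed

end

section \<open>Full packing dimension\<close>

context bernoulli_carpet
begin

text \<open>The weights in \<open>S N\<close> depend on \<open>N\<close>, so these are not partial
  sums of one sequence. Instead, the exponential bound at each \<open>N\<close> is summable and the
  Borel-Cantelli lemma applies. As the means agree for both laws, the arrangement \<open>t\<close>
  of the blocks has no influence on the limit.\<close>

lemma AE_S_LIMSEQ:
  assumes p: "\<And>b. mean_p b = B" and q: "\<And>b. mean_q b = A"
  shows "AE \<omega> in \<nu> t. (\<lambda>N. S N \<omega> / real N) \<longlonglongrightarrow> \<sigma> * B + (1 - \<sigma>) * A"
proof -
  interpret \<nu>: prob_space "\<nu> t" by (rule prob_space_\<nu>)
  let ?x = "\<sigma> * B + (1 - \<sigma>) * A"
  define Ev where "Ev j N = {\<omega>. 1 / real (Suc j) * real N \<le> \<bar>S N \<omega> - mean_S t N\<bar>}" for j N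
  have meas: "Ev j N \<in> sets (\<nu> t)" for j N
    unfolding Ev_def by (rule sets_S_event) measurable
  have "AE \<omega> in \<nu> t. \<forall>\<^sub>F N in sequentially. \<omega> \<in> space (\<nu> t) - Ev j N" for j
  proof (rule borel_cantelli_AE1[OF meas])
    define c where "c = (1 / real (Suc j))\<^sup>2 / (2 * weight_bound\<^sup>2)"
    have c: "0 < c" using weight_bound_pos by (simp add: c_def)
    show "summable (\<lambda>N. measure (\<nu> t) (Ev j N))"
    proof (rule summable_comparison_test_ev)
      show "\<forall>\<^sub>F N in sequentially. norm (measure (\<nu> t) (Ev j N)) \<le> 2 * exp (- c) ^ N"
        using eventually_gt_at_top[of 0]
      proof eventually_elim
        case (elim N)
        have "measure (\<nu> t) (Ev j N) \<le> 2 * exp (- c * real N)"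
          unfolding Ev_def c_def by (rule S_large_deviation[OF elim]) simp
        thus ?case by (simp add: exp_of_nat_mult[symmetric] mult_ac)
      qed
      show "summable (\<lambda>N. 2 * exp (- c) ^ N)" using c by (intro summable_mult summable_geometric) auto
    qed
  qed (simp add: \<nu>.emeasure_eq_measure)
  hence "AE \<omega> in \<nu> t. \<forall>j. \<forall>\<^sub>F N in sequentially. \<omega> \<in> space (\<nu> t) - Ev j N"
    by (simp add: AE_all_countable)
  thus ?thesis
  proof eventually_elim
    case (elim \<omega>)
    show ?case
    proof (rule tendstoI)
      fix \<epsilon> :: real assume \<epsilon>: "0 < \<epsilon>"
      obtain j where j: "1 / real (Suc j) < \<epsilon> / 2"
        using nat_approx_posE[of "\<epsilon> / 2"] \<epsilon> by auto
      have "\<forall>\<^sub>F N in sequentially. \<omega> \<in> space (\<nu> t) - Ev j N" using elim by blast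
      moreover have "\<forall>\<^sub>F N in sequentially. 2 * (\<bar>B - A\<bar> + 1) / \<epsilon> \<le> real N"
        using filterlim_real_sequentially by (simp add: filterlim_at_top)
      ultimately show "\<forall>\<^sub>F N in sequentially. dist (S N \<omega> / real N) ?x < \<epsilon>"
        using eventually_gt_at_top[of 0]
      proof eventually_elim
        case (elim N)
        have "\<bar>S N \<omega> - mean_S t N\<bar> < 1 / real (Suc j) * real N" using elim(1) by (simp add: Ev_def)
        also have "\<dots> \<le> \<epsilon> / 2 * real N" using j by (intro mult_right_mono) auto
        finally have 1: "\<bar>S N \<omega> - mean_S t N\<bar> < \<epsilon> / 2 * real N" .
        have 2: "\<bar>mean_S t N - real N * ?x\<bar> \<le> \<bar>B - A\<bar>"
          by (rule mean_S_approx) (simp_all add: p q)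
        have 3: "\<bar>B - A\<bar> < \<epsilon> / 2 * real N" using elim(2) \<epsilon> by (simp add: field_simps)
        have "\<bar>S N \<omega> - real N * ?x\<bar> < \<epsilon> * real N" using 1 2 3 by linarith
        moreover have "S N \<omega> / real N - ?x = (S N \<omega> - real N * ?x) / real N"
          using elim(3) by (simp add: diff_divide_distrib)
        ultimately show ?case
          using elim(3) by (simp only: dist_real_def abs_divide abs_of_nat) (simp add: divide_less_eq)
      qed
    qed
  qed
qed

text \<open>The length \<open>sqrt N\<close> is long enough for the probabilities to be summable and
  short enough, being sublinear, to be negligible as a shift of the level.\<close>

lemma AE_eventually_no_run: "AE \<omega> in \<nu> t. \<forall>\<^sub>F N in sequentially. \<not> run N (nat \<lceil>sqrt (real N)\<rceil>) \<omega>"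
proof -
  interpret \<nu>: prob_space "\<nu> t" by (rule prob_space_\<nu>)
  have "AE \<omega> in \<nu> t. \<forall>\<^sub>F N in sequentially. \<omega> \<in> space (\<nu> t) - {\<omega>. run N (nat \<lceil>sqrt (real N)\<rceil>) \<omega>}"
  proof (rule borel_cantelli_AE1[OF sets_run])
    define c where "c = - ln \<kappa>"
    have c: "0 < c" using \<kappa>_bounds by (simp add: c_def)
    have "summable (\<lambda>N. exp (- c * sqrt (real N)))"
    proof (rule summable_comparison_test_bigo)
      show "summable (\<lambda>N. norm (1 / real N ^ 2))"
        using inverse_power_summable[of 2, where 'a = real] by (simp add: inverse_eq_divide)
      show "(\<lambda>N. exp (- c * sqrt (real N))) \<in> O(\<lambda>N. 1 / real N ^ 2)" using c by real_asymp
    qed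
    hence sum: "summable (\<lambda>N. 2 * real n * exp (- c * sqrt (real N)))" by (rule summable_mult)
    show "summable (\<lambda>N. measure (\<nu> t) {\<omega>. run N (nat \<lceil>sqrt (real N)\<rceil>) \<omega>})"
    proof (rule summable_comparison_test'[OF sum])
      fix N :: nat
      have "measure (\<nu> t) {\<omega>. run N (nat \<lceil>sqrt (real N)\<rceil>) \<omega>} \<le> 2 * real n * \<kappa> ^ nat \<lceil>sqrt (real N)\<rceil>"
        by (rule measure_run_le)
      also have "\<dots> \<le> 2 * real n * exp (- c * sqrt (real N))"
      proof (intro mult_left_mono)
        have "\<kappa> ^ k = exp (- c * real k)" for k
          using \<kappa>_bounds by (simp add: c_def mult.commute[of "ln \<kappa>"] exp_of_nat_mult)
        hence "\<kappa> ^ nat \<lceil>sqrt (real N)\<rceil> = exp (- c * real (nat \<lceil>sqrt (real N)\<rceil>))" .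
        also have "\<dots> \<le> exp (- c * sqrt (real N))"
          using c real_nat_ceiling_ge[of "sqrt (real N)"] by simp
        finally show "\<kappa> ^ nat \<lceil>sqrt (real N)\<rceil> \<le> exp (- c * sqrt (real N))" .
      qed simp
      finally show "norm (measure (\<nu> t) {\<omega>. run N (nat \<lceil>sqrt (real N)\<rceil>) \<omega>}) \<le>
          2 * real n * exp (- c * sqrt (real N))" by simp
    qed
  qed (simp add: \<nu>.emeasure_eq_measure)
  thus ?thesis by simp
qed

text \<open>For \<open>r = exp (- u)\<close> the ball contains the square of level
  \<open>N1 u\<close>, and its part in the carpet is contained in the square of level
  \<open>N2 u\<close>. Both levels are asymptotic to \<open>u / ln m\<close>, so both bounds for the
  quotient have the limit \<alpha>.\<close>

lemma has_local_dimI: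
  assumes \<omega>: "\<omega> \<in> seqs" and S: "(\<lambda>N. S N \<omega> / real N) \<longlonglongrightarrow> - \<alpha> * ln (real m)"
    and run: "\<forall>\<^sub>F N in sequentially. \<not> run N (nat \<lceil>sqrt (real N)\<rceil>) \<omega>"
  shows "has_local_dim \<mu> (cod \<omega>) \<alpha>"
proof -
  define L where "L = ln (real m)"
  define M where "M = ln (real n)"
  \<comment> \<open>At level \<open>N2 u\<close>, which is at most \<open>u / L\<close>, the run
    length satisfies \<open>l + 2 \<le> sqrt u / sqrt L + 3\<close>, and
    \<open>3 \<le> 3 * sqrt u\<close> for \<open>u \<ge> 1\<close>. Hence \<open>C * sqrt u\<close>
    bounds the logarithm of \<open>n ^ (l + 2)\<close>.\<close>
  define C where "C = (1 / sqrt L + 3) * M"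
  have L: "0 < L" and M: "0 < M" using ln_mn by (auto simp: L_def M_def)
  have C: "0 < C" using L M by (simp add: C_def add_pos_pos)
  \<comment> \<open>The term \<open>ln 2\<close> accounts for the diameter bound
    \<open>2 / m ^ N\<close> of a square.\<close>
  define N1 where "N1 u = nat \<lceil>(u + ln 2) / L\<rceil>" for u
  define N2 where "N2 u = nat \<lfloor>(u - C * sqrt u) / L\<rfloor>" for u
  define g where "g u = ln (measure \<mu> (cball (cod \<omega>) (exp (- u))))" for u
  have pos: "\<forall>\<^sub>F u in at_top. (0::real) \<le> u - C * sqrt u" using C by real_asymp
  have N1_bounds: "(u + ln 2) / L \<le> real (N1 u)" "0 \<le> u \<Longrightarrow> real (N1 u) \<le> (u + ln 2) / L + 1" for u
  proof -
    show "(u + ln 2) / L \<le> real (N1 u)" unfolding N1_def by (rule real_nat_ceiling_ge)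
    assume "0 \<le> u"
    hence "0 \<le> (u + ln 2) / L" using L by simp
    thus "real (N1 u) \<le> (u + ln 2) / L + 1" unfolding N1_def by linarith
  qed
  have N2_bounds: "(u - C * sqrt u) / L - 1 \<le> real (N2 u)"
    "0 \<le> u - C * sqrt u \<Longrightarrow> real (N2 u) \<le> (u - C * sqrt u) / L" for u
  proof -
    show "(u - C * sqrt u) / L - 1 \<le> real (N2 u)" unfolding N2_def by linarith
    assume "0 \<le> u - C * sqrt u"
    hence "0 \<le> (u - C * sqrt u) / L" using L by simp
    thus "real (N2 u) \<le> (u - C * sqrt u) / L" unfolding N2_def by simp
  qed
  have N1_top: "filterlim N1 sequentially at_top"
    unfolding filterlim_sequentially_iff_filterlim_real
  proof (rule filterlim_at_top_mono)
    show "filterlim (\<lambda>u. (u + ln 2) / L) at_top at_top" using L by real_asymp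
  qed (use N1_bounds in auto)
  have N2_top: "filterlim N2 sequentially at_top"
    unfolding filterlim_sequentially_iff_filterlim_real
  proof (rule filterlim_at_top_mono)
    show "filterlim (\<lambda>u. (u - C * sqrt u) / L - 1) at_top at_top" using L C by (real_asymp; simp add: inverse_eq_divide)
  qed (use N2_bounds in auto)
  have N1_lim: "((\<lambda>u. real (N1 u) / u) \<longlongrightarrow> 1 / L) at_top"
  proof (rule tendsto_sandwich)
    show "((\<lambda>u. ((u + ln 2) / L) / u) \<longlongrightarrow> 1 / L) at_top" using L by (real_asymp; simp add: inverse_eq_divide)
    show "((\<lambda>u. ((u + ln 2) / L + 1) / u) \<longlongrightarrow> 1 / L) at_top" using L by (real_asymp; simp add: inverse_eq_divide)
    show "\<forall>\<^sub>F u in at_top. ((u + ln 2) / L) / u \<le> real (N1 u) / u"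
      using eventually_gt_at_top[of 0] by eventually_elim (intro divide_right_mono N1_bounds, auto)
    show "\<forall>\<^sub>F u in at_top. real (N1 u) / u \<le> ((u + ln 2) / L + 1) / u"
      using eventually_gt_at_top[of 0] by eventually_elim (intro divide_right_mono N1_bounds, auto)
  qed
  have N2_lim: "((\<lambda>u. real (N2 u) / u) \<longlongrightarrow> 1 / L) at_top"
  proof (rule tendsto_sandwich)
    show "((\<lambda>u. ((u - C * sqrt u) / L - 1) / u) \<longlongrightarrow> 1 / L) at_top" using L C by (real_asymp; simp add: inverse_eq_divide)
    show "((\<lambda>u. ((u - C * sqrt u) / L) / u) \<longlongrightarrow> 1 / L) at_top" using L C by (real_asymp; simp add: inverse_eq_divide)
    show "\<forall>\<^sub>F u in at_top. ((u - C * sqrt u) / L - 1) / u \<le> real (N2 u) / u"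
      using eventually_gt_at_top[of 0] by eventually_elim (intro divide_right_mono N2_bounds, auto)
    show "\<forall>\<^sub>F u in at_top. real (N2 u) / u \<le> ((u - C * sqrt u) / L) / u"
      using eventually_gt_at_top[of 0] pos by eventually_elim (intro divide_right_mono N2_bounds, auto)
  qed
  have S_lim: "((\<lambda>u. S (N u) \<omega> / (- u)) \<longlongrightarrow> \<alpha>) at_top"
    if top: "filterlim N sequentially at_top" and lim: "((\<lambda>u. real (N u) / u) \<longlongrightarrow> 1 / L) at_top"
    for N :: "real \<Rightarrow> nat"
  proof -
    have "((\<lambda>u. - (S (N u) \<omega> / real (N u) * (real (N u) / u))) \<longlongrightarrow> - (- \<alpha> * L * (1 / L))) at_top"
      unfolding L_def
      by (intro tendsto_minus tendsto_mult filterlim_compose[OF S top] lim[unfolded L_def])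
    moreover have "\<forall>\<^sub>F u in at_top. - (S (N u) \<omega> / real (N u) * (real (N u) / u)) = S (N u) \<omega> / (- u)"
      using filterlim_at_top[THEN iffD1, OF top, rule_format, of 1] by eventually_elim simp
    ultimately have "((\<lambda>u. S (N u) \<omega> / (- u)) \<longlongrightarrow> - (- \<alpha> * L * (1 / L))) at_top"
      by (rule Lim_transform_eventually)
    thus ?thesis using L by simp
  qed
  have lower: "\<forall>\<^sub>F u in at_top. S (N1 u) \<omega> \<le> g u"
  proof (rule always_eventually, rule allI)
    fix u
    have "u + ln 2 \<le> real (N1 u) * L" using N1_bounds(1)[of u] L by (simp add: field_simps)
    hence "exp (u + ln 2) \<le> exp (real (N1 u) * L)" by simp
    also have "\<dots> = real m ^ N1 u" using m2 by (simp add: L_def exp_of_nat_mult)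
    finally have "2 / real m ^ N1 u \<le> exp (- u)"
      using m2 by (simp add: exp_add exp_minus field_simps)
    from measure_cball_ge[OF \<omega> this] show "S (N1 u) \<omega> \<le> g u"
      unfolding g_def by (metis exp_gt_zero less_le_trans ln_exp ln_mono)
  qed
  have upper: "\<forall>\<^sub>F u in at_top. g u \<le> S (N2 u) \<omega>"
    using eventually_compose_filterlim[OF run N2_top] pos lower eventually_ge_at_top[of 1]
  proof eventually_elim
    case (elim u)
    define l where "l = nat \<lceil>sqrt (real (N2 u))\<rceil>"
    have "0 \<le> C * sqrt u" using C elim by simp
    hence "real (N2 u) \<le> u / L" using N2_bounds(2)[OF elim(2)] L by (simp add: field_simps)
    hence "sqrt (real (N2 u)) \<le> sqrt u / sqrt L" by (simp flip: real_sqrt_divide)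
    moreover have "real l \<le> sqrt (real (N2 u)) + 1" unfolding l_def by (simp add: of_nat_ceiling)
    ultimately have "real (l + 2) \<le> sqrt u / sqrt L + 3" by simp
    also have "\<dots> \<le> sqrt u / sqrt L + 3 * sqrt u" using elim by simp
    finally have "real (l + 2) * M \<le> (sqrt u / sqrt L + 3 * sqrt u) * M"
      using M by (intro mult_right_mono) auto
    also have "\<dots> = C * sqrt u" by (simp add: C_def algebra_simps)
    finally have "real (N2 u) * L + real (l + 2) * M \<le> u"
      using N2_bounds(2)[OF elim(2)] L by (simp add: field_simps)
    hence "exp (real (N2 u) * L + real (l + 2) * M) \<le> exp u" by simp
    also have "exp (real (N2 u) * L + real (l + 2) * M) = real m ^ N2 u * real n ^ (l + 2)"
      using m2 n2 unfolding L_def M_def exp_add exp_of_nat_mult by simp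
    finally have "exp (- u) \<le> 1 / (real m ^ N2 u * real n ^ (l + 2))"
      using m2 n2 by (simp add: exp_minus field_simps)
    hence le: "measure \<mu> (cball (cod \<omega>) (exp (- u))) \<le> exp (S (N2 u) \<omega>)"
      using elim(1) by (intro measure_cball_le[OF \<omega>, where l = l]) (auto simp: l_def)
    have "u + ln 2 \<le> real (N1 u) * L" using N1_bounds(1)[of u] L by (simp add: field_simps)
    hence "exp (u + ln 2) \<le> exp (real (N1 u) * L)" by simp
    also have "\<dots> = real m ^ N1 u" using m2 by (simp add: L_def exp_of_nat_mult)
    finally have "2 / real m ^ N1 u \<le> exp (- u)"
      using m2 by (simp add: exp_add exp_minus field_simps)
    hence "0 < measure \<mu> (cball (cod \<omega>) (exp (- u)))"
      using measure_cball_ge[OF \<omega>] by (meson exp_gt_zero less_le_trans)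
    thus ?case unfolding g_def using le by (metis ln_exp ln_mono)
  qed
  have "((\<lambda>u. g u / (- u)) \<longlongrightarrow> \<alpha>) at_top"
  \<comment> \<open>Division by \<open>- u\<close> reverses the inequalities, so the bound through
    \<open>N2\<close> becomes the lower one.\<close>
  proof (rule tendsto_sandwich[OF _ _ S_lim[OF N2_top N2_lim] S_lim[OF N1_top N1_lim]])
    show "\<forall>\<^sub>F u in at_top. S (N2 u) \<omega> / (- u) \<le> g u / (- u)"
      using upper eventually_gt_at_top[of 0] by eventually_elim (simp add: divide_right_mono)
    show "\<forall>\<^sub>F u in at_top. g u / (- u) \<le> S (N1 u) \<omega> / (- u)"
      using lower eventually_gt_at_top[of 0] by eventually_elim (simp add: divide_right_mono)
  qed
  moreover have "filterlim (\<lambda>r. - ln r) at_top (at_right (0::real))"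
    by (rule filterlim_compose[OF filterlim_uminus_at_top_at_bot ln_at_0])
  ultimately have "((\<lambda>r. g (- ln r) / (- (- ln r))) \<longlongrightarrow> \<alpha>) (at_right 0)"
    by (rule filterlim_compose)
  moreover have "\<forall>\<^sub>F r in at_right 0. g (- ln r) / (- (- ln r)) = ln (measure \<mu> (cball (cod \<omega>) r)) / ln r"
    using eventually_at_right_less[of "0::real"] by eventually_elim (simp add: g_def)
  ultimately show ?thesis unfolding has_local_dim_def by (rule Lim_transform_eventually)
qed

lemma packing_dim_level_sets_eq:
  assumes p: "\<And>b. mean_p b = B" and q: "\<And>b. mean_q b = A"
    and \<alpha>: "\<alpha> = - (1 / ln (real m)) * (\<sigma> * B + (1 - \<sigma>) * A)"
  shows "packing_dim (level_set \<Lambda> \<mu> \<alpha>) = packing_dim \<Lambda>"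
    and "packing_dim (symb_level_set m n D \<Lambda> \<mu> \<alpha>) = packing_dim \<Lambda>"
proof -
  have \<alpha>_eq: "\<sigma> * B + (1 - \<sigma>) * A = - \<alpha> * ln (real m)" using ln_mn by (simp add: \<alpha>)
  have ae: "AE \<omega> in \<nu> block_type. \<omega> \<in> seqs \<and> has_local_dim \<mu> (cod \<omega>) \<alpha> \<and> has_symb_local_dim m n D \<Lambda> \<mu> \<omega> \<alpha>"
    using AE_seqs AE_S_LIMSEQ[OF p q] AE_eventually_no_run
  proof eventually_elim
    case (elim \<omega>)
    have S: "(\<lambda>N. S N \<omega> / real N) \<longlonglongrightarrow> - \<alpha> * ln (real m)" using elim(2) by (simp only: \<alpha>_eq)
    have "(\<lambda>N. S N \<omega> / real N / - ln (real m)) \<longlonglongrightarrow> - \<alpha> * ln (real m) / - ln (real m)"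
      using ln_mn by (intro tendsto_divide S tendsto_const) auto
    hence "(\<lambda>N. S N \<omega> / (- real N * ln (real m))) \<longlonglongrightarrow> \<alpha>" using ln_mn by simp
    hence "has_symb_local_dim m n D \<Lambda> \<mu> \<omega> \<alpha>" using has_symb_local_dim_iff[OF elim(1)] by blast
    thus ?case using elim(1) has_local_dimI[OF elim(1) S elim(3)] by blast
  qed
  have "ereal dim\<^sub>0 \<le> packing_dim (level_set \<Lambda> \<mu> \<alpha>)"
    by (rule packing_dim_ge, rule AE_mp[OF ae]) (auto simp: level_set_def \<Lambda>_eq)
  moreover have "ereal dim\<^sub>0 \<le> packing_dim (symb_level_set m n D \<Lambda> \<mu> \<alpha>)"
    by (rule packing_dim_ge, rule AE_mp[OF ae]) (auto simp: symb_level_set_def \<Lambda>_eq is_expansion_iff)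
  moreover have "packing_dim \<Lambda> = ereal dim\<^sub>0" by (simp add: \<Lambda>_eq packing_dim_all)
  moreover have "packing_dim (level_set \<Lambda> \<mu> \<alpha>) \<le> packing_dim \<Lambda>"
    "packing_dim (symb_level_set m n D \<Lambda> \<mu> \<alpha>) \<le> packing_dim \<Lambda>"
    by (intro packing_dim_mono; auto simp: level_set_def symb_level_set_def)+
  ultimately show "packing_dim (level_set \<Lambda> \<mu> \<alpha>) = packing_dim \<Lambda>"
    "packing_dim (symb_level_set m n D \<Lambda> \<mu> \<alpha>) = packing_dim \<Lambda>" by auto
qed

end

theorem theorem2p3:
  fixes m n :: nat and D :: "(nat \<times> nat) set" and \<Lambda> :: "(real \<times> real) set"
    and p :: "nat \<times> nat \<Rightarrow> real" and \<mu> :: "(real \<times> real) measure"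
  assumes "bm_digits m n D"
    and "is_bm_carpet m n D \<Lambda>"
    and "pos_prob_vector D p"
    and "is_bernoulli_measure m n D p \<mu>"
  shows
    "((\<Sum>i\<in>occupied_rows D. 1 / real (card (occupied_rows D)) * ln (row_prob D p i))
        \<noteq> (\<Sum>i\<in>occupied_rows D. real (row_count D i) / real (card D) * ln (row_prob D p i))
      \<longrightarrow> (\<forall>\<alpha>::real. packing_dim (symb_level_set m n D \<Lambda> \<mu> \<alpha>) < packing_dim \<Lambda>
                 \<and> packing_dim (level_set \<Lambda> \<mu> \<alpha>) < packing_dim \<Lambda>))
     \<and>
     (\<forall>A B \<alpha>\<^sub>0 :: real.
        (\<Sum>i\<in>occupied_rows D. 1 / real (card (occupied_rows D)) * ln (row_prob D p i)) = A
        \<and> (\<Sum>i\<in>occupied_rows D. real (row_count D i) / real (card D) * ln (row_prob D p i)) = A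
        \<and> (\<Sum>(i, j)\<in>D. 1 / real (card D) * ln (p (i, j))) = B
        \<and> (\<Sum>(i, j)\<in>D. 1 / (real (row_count D i) * real (card (occupied_rows D))) * ln (p (i, j))) = B
        \<and> \<alpha>\<^sub>0 = - (1 / ln (real m)) * (bm_sigma m n * B + (1 - bm_sigma m n) * A)
      \<longrightarrow> packing_dim (level_set \<Lambda> \<mu> \<alpha>\<^sub>0) = packing_dim \<Lambda>
          \<and> packing_dim (symb_level_set m n D \<Lambda> \<mu> \<alpha>\<^sub>0) = packing_dim \<Lambda>)"
proof -
  interpret bernoulli_carpet m n D \<Lambda> p \<mu>
    using assms by unfold_locales
  have q: "mean_q True = (\<Sum>i\<in>occupied_rows D. real (row_count D i) / real (card D) * ln (row_prob D p i))"
    "mean_q False = (\<Sum>i\<in>occupied_rows D. 1 / real (card (occupied_rows D)) * ln (row_prob D p i))"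
    unfolding mean_q_eq by simp_all
  have p: "mean_p True = (\<Sum>(i, j)\<in>D. 1 / real (card D) * ln (p (i, j)))"
    "mean_p False = (\<Sum>(i, j)\<in>D. 1 / (real (row_count D i) * real (card (occupied_rows D))) * ln (p (i, j)))"
    unfolding mean_p_eq by simp_all
  show ?thesis
    unfolding q[symmetric] p[symmetric]
  proof (intro conjI impI allI)
    fix \<alpha> assume "mean_q False \<noteq> mean_q True"
    hence ne: "mean_q True \<noteq> mean_q False" by simp
    show "packing_dim (symb_level_set m n D \<Lambda> \<mu> \<alpha>) < packing_dim \<Lambda>"
      "packing_dim (level_set \<Lambda> \<mu> \<alpha>) < packing_dim \<Lambda>"
      by (rule packing_dim_level_sets_less[OF ne])+
  next
    fix A B \<alpha>\<^sub>0
    assume *: "mean_q False = A \<and> mean_q True = A \<and> mean_p True = B \<and> mean_p False = B \<and>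
      \<alpha>\<^sub>0 = - (1 / ln (real m)) * (bm_sigma m n * B + (1 - bm_sigma m n) * A)"
    have "mean_p b = B" "mean_q b = A" for b using * by (cases b; simp)+
    from packing_dim_level_sets_eq[OF this] *
    show "packing_dim (level_set \<Lambda> \<mu> \<alpha>\<^sub>0) = packing_dim \<Lambda>"
      "packing_dim (symb_level_set m n D \<Lambda> \<mu> \<alpha>\<^sub>0) = packing_dim \<Lambda>" by blast+
  qed
qed

end
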